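(* Let $M$ and $N$ be complete Riemannian manifolds (separable or non-separable, finite- or infinite-dimensional). Then $M$ and $N$ are equivalent as Riemannian manifolds if and only if $C_b^1(M)$ and $C_b^1(N)$ are equivalent as normed algebras. Moreover, every normed algebra isomorphism $T:C_b^1(N)\to C_b^1(M)$ is of the form $T(f)=f\circ h$, where $h:M\to N$ is a Riemannian isometry.
   Context: A Riemannian manifold is a paracompact smooth manifold $M$ modeled on a real Hilbert space (not necessarily separable, possibly infinite-dimensional) with a Riemannian metric $\langle\cdot,\cdot\rangle_p$ on each $T_pM$ whose norm $\|v\|_p=\langle v,v\rangle_p^{1/2}$ corresponds in charts to a norm equivalent to the Hilbert norm. The distance $d_M(p,q)$ is the infimum of the lengths of piecewise $C^1$ paths joining $p$ to $q$ (with value $+\infty$ if $p,q$ lie in different connected components). $M$ is complete if it is complete for $d_M$. $C_b^1(M)$ is the algebra of all bounded, Lipschitz (for $d_M$) and $C^1$-smooth functions $f:M\to\mathbb{R}$, endowed with the norm $\|f\|_{C_b^1(M)}=\max\{\|f\|_\infty,\|df\|_\infty\}$, where $\|f\|_\infty=\sup_{p\in M}|f(p)|$ and $\|df\|_\infty=\sup_{p\in M}\|df(p)\|_p$, $\|df(p)\|_p=\sup\{|df(p)(v)|: v\in T_pM,\|v\|_p\le1\}$. (It is a Banach algebra with the norm $2\|\cdot\|_{C_b^1(M)}$.) Two normed algebras $(A,\|\cdot\|_A)$ and $(B,\|\cdot\|_B)$ are equivalent as normed algebras if there is an algebra isomorphism $T:A\to B$ (bijective, linear and multiplicative) with $\|T(a)\|_B=\|a\|_A$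 for every $a\in A$; such $T$ is called a normed algebra isomorphism. The Riemannian manifolds $M$ and $N$ are equivalent if there is a Riemannian isometry $h:M\to N$, i.e. a $C^1$-diffeomorphism from $M$ onto $N$ with $\langle dh(x)(v),dh(x)(w)\rangle_{h(x)}=\langle v,w\rangle_x$ for every $x\in M$ and $v,w\in T_xM$. *)

theory Defs
  imports "HOL-Analysis.Analysis"
begin

definition C1_on :: "'a::real_normed_vector set \<Rightarrow> ('a \<Rightarrow> 'b::real_normed_vector) \<Rightarrow> bool" where
  "C1_on S f \<longleftrightarrow> (\<exists>f' :: 'a \<Rightarrow> 'a \<Rightarrow>\<^sub>L 'b.
     continuous_on S f' \<and> (\<forall>x\<in>S. (f has_derivative blinfun_apply (f' x)) (at x)))"

definition bounded_multilinear ::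
  "nat \<Rightarrow> ('a::real_normed_vector list \<Rightarrow> 'b::real_normed_vector) \<Rightarrow> bool" where
  "bounded_multilinear k m \<longleftrightarrow>
     (\<forall>vs i. length vs = k \<longrightarrow> i < k \<longrightarrow> linear (\<lambda>v. m (vs[i := v]))) \<and>
     (\<exists>K. \<forall>vs. length vs = k \<longrightarrow> norm (m vs) \<le> K * prod_list (map norm vs))"

text \<open>
  The type of the \<open>k\<close>-th derivative depends on \<open>k\<close>, so all derivatives of \<open>f\<close> are
  packed into one function: \<open>D x\<close> restricted to lists of length \<open>k\<close> is the \<open>k\<close>-th Frechet
  derivative of \<open>f\<close> at \<open>x\<close>. The last conjunct says that the \<open>(k + 1)\<close>-st derivative is the
  Frechet derivative of the \<open>k\<close>-th one with respect to the norm of bounded \<open>k\<close>-linear maps.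
  It is used for open \<open>S\<close> only.
\<close>

definition smooth_on :: "'a::real_normed_vector set \<Rightarrow> ('a \<Rightarrow> 'b::real_normed_vector) \<Rightarrow> bool" where
  "smooth_on S f \<longleftrightarrow> (\<exists>D :: 'a \<Rightarrow> 'a list \<Rightarrow> 'b.
     (\<forall>x\<in>S. D x [] = f x) \<and>
     (\<forall>x\<in>S. \<forall>k. bounded_multilinear k (D x)) \<and>
     (\<forall>x\<in>S. \<forall>k. \<forall>\<epsilon>>0. \<forall>\<^sub>F y in at x. \<forall>vs. length vs = k \<longrightarrow>
        norm (D y vs - D x vs - D x ((y - x) # vs))
          \<le> \<epsilon> * norm (y - x) * prod_list (map norm vs)))"

text \<open>
  A manifold is carried by a whole type \<open>'p\<close>, with the topology of its type class, and is
  modeled on the Hilbert space \<open>'h\<close>. A chart is a pair of its domain \<open>U\<close> and the coordinate map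
  \<open>\<phi>\<close>; values of \<open>\<phi>\<close> outside \<open>U\<close> are irrelevant. The atlas need not be maximal. Tangent vectors
  at a point are equivalence classes of pairs of a chart around the point and a vector of \<open>'h\<close>,
  see \<open>tangent_rel\<close> below.
\<close>

type_synonym ('p, 'h) chart = "'p set \<times> ('p \<Rightarrow> 'h)"

type_synonym ('p, 'h) tangent = "(('p, 'h) chart \<times> 'h) set"

record ('p, 'h) manifold =
  atlas :: "('p, 'h) chart set"
  metric :: "'p \<Rightarrow> ('p, 'h) tangent \<Rightarrow> ('p, 'h) tangent \<Rightarrow> real"

abbreviation dom_chart :: "('p, 'h) chart \<Rightarrow> 'p set" where
  "dom_chart c \<equiv> fst c"

abbreviation map_chart :: "('p, 'h) chart \<Rightarrow> 'p \<Rightarrow> 'h" where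
  "map_chart c \<equiv> snd c"

definition inv_chart :: "('p, 'h) chart \<Rightarrow> 'h \<Rightarrow> 'p" where
  "inv_chart c = inv_into (dom_chart c) (map_chart c)"

definition charts_at :: "('p, 'h) manifold \<Rightarrow> 'p \<Rightarrow> ('p, 'h) chart set" where
  "charts_at M p = {c \<in> atlas M. p \<in> dom_chart c}"

definition is_chart :: "('p::topological_space, 'h::real_normed_vector) chart \<Rightarrow> bool" where
  "is_chart c \<longleftrightarrow> open (dom_chart c) \<and> open (map_chart c ` dom_chart c) \<and>
     homeomorphism (dom_chart c) (map_chart c ` dom_chart c) (map_chart c) (inv_chart c)"

definition smooth_atlas ::
  "('p::topological_space, 'h::real_normed_vector) chart set \<Rightarrow> bool" where
  "smooth_atlas A \<longleftrightarrow>
     (\<forall>c\<in>A. is_chart c) \<and> (\<Union>c\<in>A. dom_chart c) = UNIV \<and>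
     (\<forall>c\<in>A. \<forall>d\<in>A. smooth_on (map_chart c ` (dom_chart c \<inter> dom_chart d))
        (map_chart d \<circ> inv_chart c))"

definition tangent_rel ::
  "('p, 'h::real_normed_vector) manifold \<Rightarrow> 'p \<Rightarrow> (('p, 'h) chart \<times> 'h) rel" where
  "tangent_rel M p = {((c, v), (d, w)). c \<in> charts_at M p \<and> d \<in> charts_at M p \<and>
     w = frechet_derivative (map_chart d \<circ> inv_chart c) (at (map_chart c p)) v}"

definition tangent_space ::
  "('p, 'h::real_normed_vector) manifold \<Rightarrow> 'p \<Rightarrow> ('p, 'h) tangent set" where
  "tangent_space M p = (charts_at M p \<times> UNIV) // tangent_rel M p"

definition tangent_vec ::
  "('p, 'h::real_normed_vector) manifold \<Rightarrow> 'p \<Rightarrow> ('p, 'h) chart \<Rightarrow> 'h \<Rightarrow> ('p, 'h) tangent" where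
  "tangent_vec M p c v = tangent_rel M p `` {(c, v)}"

definition norm_at :: "('p, 'h) manifold \<Rightarrow> 'p \<Rightarrow> ('p, 'h) tangent \<Rightarrow> real" where
  "norm_at M p X = sqrt (metric M p X X)"

text \<open>
  In every chart the metric is represented by a smooth map \<open>G\<close> into the symmetric bounded
  bilinear forms on \<open>'h\<close>, and its norm is equivalent to the norm of \<open>'h\<close>.
\<close>

definition riemannian_metric :: "('p, 'h::real_normed_vector) manifold \<Rightarrow> bool" where
  "riemannian_metric M \<longleftrightarrow> (\<forall>c\<in>atlas M.
     (\<exists>G :: 'h \<Rightarrow> 'h \<Rightarrow>\<^sub>L 'h \<Rightarrow>\<^sub>L real.
        smooth_on (map_chart c ` dom_chart c) G \<and>
        (\<forall>p\<in>dom_chart c. \<forall>v w.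
           metric M p (tangent_vec M p c v) (tangent_vec M p c w)
             = blinfun_apply (blinfun_apply (G (map_chart c p)) v) w)) \<and>
     (\<forall>p\<in>dom_chart c. \<forall>v w.
        metric M p (tangent_vec M p c v) (tangent_vec M p c w)
          = metric M p (tangent_vec M p c w) (tangent_vec M p c v)) \<and>
     (\<forall>p\<in>dom_chart c. \<exists>a>0. \<exists>b>0. \<forall>v.
        a * norm v \<le> norm_at M p (tangent_vec M p c v) \<and>
        norm_at M p (tangent_vec M p c v) \<le> b * norm v))"

definition paracompact_type :: "'p::topological_space itself \<Rightarrow> bool" where
  "paracompact_type _ \<longleftrightarrow>
     (\<forall>\<U> :: 'p set set. (\<forall>U\<in>\<U>. open U) \<and> \<Union>\<U> = UNIV \<longrightarrow>
        (\<exists>\<V>. (\<forall>V\<in>\<V>. open V) \<and> \<Union>\<V> = UNIV \<and> (\<forall>V\<in>\<V>. \<exists>U\<in>\<U>. V \<subseteq> U) \<and>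
             locally_finite_in euclidean \<V>))"

definition riemannian_manifold ::
  "('p::t2_space, 'h::{real_inner, complete_space}) manifold \<Rightarrow> bool" where
  "riemannian_manifold M \<longleftrightarrow>
     paracompact_type TYPE('p) \<and> smooth_atlas (atlas M) \<and> riemannian_metric M"

definition C1_path_on ::
  "('p::topological_space, 'h::real_normed_vector) manifold \<Rightarrow> real set \<Rightarrow> (real \<Rightarrow> 'p) \<Rightarrow> bool" where
  "C1_path_on M I \<gamma> \<longleftrightarrow> continuous_on I \<gamma> \<and>
     (\<forall>c\<in>atlas M. \<exists>D. continuous_on {t\<in>I. \<gamma> t \<in> dom_chart c} D \<and>
        (\<forall>t\<in>I. \<gamma> t \<in> dom_chart c \<longrightarrow>
           ((map_chart c \<circ> \<gamma>) has_vector_derivative D t) (at t within I)))"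

definition piecewise_C1_path ::
  "('p::topological_space, 'h::real_normed_vector) manifold \<Rightarrow> (real \<Rightarrow> 'p) \<Rightarrow> bool" where
  "piecewise_C1_path M \<gamma> \<longleftrightarrow> (\<exists>n (t :: nat \<Rightarrow> real).
     t 0 = 0 \<and> t n = 1 \<and>
     (\<forall>i<n. t i < t (Suc i) \<and> C1_path_on M {t i..t (Suc i)} \<gamma>))"

text \<open>
  The set of coordinate representations of the velocity of \<open>\<gamma>\<close> at \<open>t\<close> is an element of the
  tangent space at \<open>\<gamma> t\<close> wherever \<open>\<gamma>\<close> is differentiable. At the finitely many break points of a
  piecewise path it may be arbitrary, which does not affect the integral defining the length.
\<close>

definition velocity ::
  "('p, 'h::real_normed_vector) manifold \<Rightarrow> (real \<Rightarrow> 'p) \<Rightarrow> real \<Rightarrow> ('p, 'h) tangent" where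
  "velocity M \<gamma> t = {(c, v). c \<in> charts_at M (\<gamma> t) \<and>
     v = vector_derivative (map_chart c \<circ> \<gamma>) (at t within {0..1})}"

definition path_length ::
  "('p, 'h::real_normed_vector) manifold \<Rightarrow> (real \<Rightarrow> 'p) \<Rightarrow> real" where
  "path_length M \<gamma> = integral {0..1} (\<lambda>t. norm_at M (\<gamma> t) (velocity M \<gamma> t))"

text \<open>The infimum of the empty set in \<^typ>\<open>ennreal\<close> is \<open>\<infinity>\<close>.\<close>

definition rdist ::
  "('p::topological_space, 'h::real_normed_vector) manifold \<Rightarrow> 'p \<Rightarrow> 'p \<Rightarrow> ennreal" where
  "rdist M p q =
     (INF \<gamma> \<in> {\<gamma>. piecewise_C1_path M \<gamma> \<and> \<gamma> 0 = p \<and> \<gamma> 1 = q}. ennreal (path_length M \<gamma>))"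

definition complete_manifold ::
  "('p::topological_space, 'h::real_normed_vector) manifold \<Rightarrow> bool" where
  "complete_manifold M \<longleftrightarrow> (\<forall>x :: nat \<Rightarrow> 'p.
     (\<forall>\<epsilon>>0. \<exists>K. \<forall>m\<ge>K. \<forall>n\<ge>K. rdist M (x m) (x n) < \<epsilon>) \<longrightarrow>
     (\<exists>p. (\<lambda>n. rdist M (x n) p) \<longlonglongrightarrow> 0))"

definition C1_fun ::
  "('p, 'h::real_normed_vector) manifold \<Rightarrow> ('p \<Rightarrow> real) \<Rightarrow> bool" where
  "C1_fun M f \<longleftrightarrow> (\<forall>c\<in>atlas M. C1_on (map_chart c ` dom_chart c) (f \<circ> inv_chart c))"

definition lipschitz_fun ::
  "('p::topological_space, 'h::real_normed_vector) manifold \<Rightarrow> ('p \<Rightarrow> real) \<Rightarrow> bool" where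
  "lipschitz_fun M f \<longleftrightarrow>
     (\<exists>L>0. \<forall>p q. ennreal (dist (f p) (f q)) \<le> ennreal L * rdist M p q)"

definition Cb1 ::
  "('p::topological_space, 'h::real_normed_vector) manifold \<Rightarrow> ('p \<Rightarrow> real) set" where
  "Cb1 M = {f. bounded (range f) \<and> lipschitz_fun M f \<and> C1_fun M f}"

definition differential ::
  "('p, 'h::real_normed_vector) manifold \<Rightarrow> ('p \<Rightarrow> real) \<Rightarrow> 'p \<Rightarrow> ('p, 'h) tangent \<Rightarrow> real" where
  "differential M f p X =
     (THE r. \<exists>(c, v)\<in>X. r = frechet_derivative (f \<circ> inv_chart c) (at (map_chart c p)) v)"

definition differential_norm ::
  "('p, 'h::real_normed_vector) manifold \<Rightarrow> ('p \<Rightarrow> real) \<Rightarrow> 'p \<Rightarrow> real" where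
  "differential_norm M f p =
     (SUP X \<in> {X \<in> tangent_space M p. norm_at M p X \<le> 1}. \<bar>differential M f p X\<bar>)"

definition Cb1_norm ::
  "('p, 'h::real_normed_vector) manifold \<Rightarrow> ('p \<Rightarrow> real) \<Rightarrow> real" where
  "Cb1_norm M f = max (SUP p. \<bar>f p\<bar>) (SUP p. differential_norm M f p)"

definition normed_algebra_iso ::
  "('a \<Rightarrow> real) set \<Rightarrow> (('a \<Rightarrow> real) \<Rightarrow> real) \<Rightarrow> ('b \<Rightarrow> real) set \<Rightarrow> (('b \<Rightarrow> real) \<Rightarrow> real)
     \<Rightarrow> (('a \<Rightarrow> real) \<Rightarrow> 'b \<Rightarrow> real) \<Rightarrow> bool" where
  "normed_algebra_iso A nA B nB T \<longleftrightarrow>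
     bij_betw T A B \<and>
     (\<forall>f\<in>A. \<forall>g\<in>A. T (\<lambda>x. f x + g x) = (\<lambda>y. T f y + T g y)) \<and>
     (\<forall>r. \<forall>f\<in>A. T (\<lambda>x. r * f x) = (\<lambda>y. r * T f y)) \<and>
     (\<forall>f\<in>A. \<forall>g\<in>A. T (\<lambda>x. f x * g x) = (\<lambda>y. T f y * T g y)) \<and>
     (\<forall>f\<in>A. nB (T f) = nA f)"

definition normed_algebra_equivalent ::
  "('a \<Rightarrow> real) set \<Rightarrow> (('a \<Rightarrow> real) \<Rightarrow> real) \<Rightarrow> ('b \<Rightarrow> real) set \<Rightarrow> (('b \<Rightarrow> real) \<Rightarrow> real)
     \<Rightarrow> bool" where
  "normed_algebra_equivalent A nA B nB \<longleftrightarrow> (\<exists>T. normed_algebra_iso A nA B nB T)"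

definition C1_map ::
  "('p::topological_space, 'h::real_normed_vector) manifold \<Rightarrow>
   ('q::topological_space, 'k::real_normed_vector) manifold \<Rightarrow> ('p \<Rightarrow> 'q) \<Rightarrow> bool" where
  "C1_map M N h \<longleftrightarrow> continuous_on UNIV h \<and>
     (\<forall>c\<in>atlas M. \<forall>d\<in>atlas N.
        C1_on (map_chart c ` (dom_chart c \<inter> h -` dom_chart d)) (map_chart d \<circ> h \<circ> inv_chart c))"

text \<open>
  The image of a tangent vector under \<open>dh(p)\<close>, given as the set of all its representatives
  with respect to charts of \<open>N\<close> around \<open>h p\<close>.
\<close>

definition tangent_map ::
  "('p, 'h::real_normed_vector) manifold \<Rightarrow> ('q, 'k::real_normed_vector) manifold \<Rightarrow>
   ('p \<Rightarrow> 'q) \<Rightarrow> 'p \<Rightarrow> ('p, 'h) tangent \<Rightarrow> ('q, 'k) tangent" where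
  "tangent_map M N h p X = {(d, w). d \<in> charts_at N (h p) \<and>
     (\<exists>(c, v)\<in>X. w = frechet_derivative (map_chart d \<circ> h \<circ> inv_chart c) (at (map_chart c p)) v)}"

definition riemannian_isometry ::
  "('p::topological_space, 'h::real_normed_vector) manifold \<Rightarrow>
   ('q::topological_space, 'k::real_normed_vector) manifold \<Rightarrow> ('p \<Rightarrow> 'q) \<Rightarrow> bool" where
  "riemannian_isometry M N h \<longleftrightarrow>
     bij h \<and> C1_map M N h \<and> C1_map N M (inv h) \<and>
     (\<forall>p. \<forall>X\<in>tangent_space M p. \<forall>Y\<in>tangent_space M p.
        metric N (h p) (tangent_map M N h p X) (tangent_map M N h p Y) = metric M p X Y)"

definition riemannian_equivalent ::
  "('p::topological_space, 'h::real_normed_vector) manifold \<Rightarrow>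
   ('q::topological_space, 'k::real_normed_vector) manifold \<Rightarrow> bool" where
  "riemannian_equivalent M N \<longleftrightarrow> (\<exists>h. riemannian_isometry M N h)"

end

theory Submission
  imports Defs
begin

text \<open>
Let \<open>\<rho>(p, q)\<close> be the supremum of \<open>\<bar>f p - f q\<bar>\<close> over the unit ball of the algebra. The mean value
theorem and test functions that are radial in a chart, with slope \<open>1 - C s\<close> at distance \<open>s\<close>, give
\<open>\<rho>(x, y) = \<bar>x - y\<bar>\<^sub>y + O(\<bar>x - y\<bar>\<^sub>y\<^sup>2)\<close> in every chart, where \<open>\<bar>\<cdot>\<bar>\<^sub>y\<close> is the norm of the metric at \<open>y\<close>.

Given an isomorphism \<open>T\<close>, call \<open>x\<close> and \<open>y\<close> related if \<open>T f x = f y\<close> for all \<open>f\<close>. Since positivity is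
an algebraic notion, evaluation at a point of \<open>M\<close>, composed with \<open>T\<close>, is a limit of evaluations
at a sequence of points of \<open>N\<close>, and vice versa. A character that is the limit of a sequence in a small coordinate
ball is evaluation at a point, because a norm-separated sequence in a Hilbert ball does not converge when tested
on sums of disjoint humps. Hence the points of \<open>M\<close> that are related to some point of \<open>N\<close> form a dense open set \<open>M0\<close>,
on which a map \<open>h\<close> into \<open>N\<close> preserves \<open>\<rho>\<close>. By the parallelogram law such a map has second
differences of order \<open>3/2\<close> in charts; it is therefore continuously differentiable, and its
derivative is isometric. Completeness of \<open>N\<close> then propagates \<open>M0\<close> along segments, so \<open>M0 = M\<close>.

This replaces the usual passage through geodesics and through smooth approximation of Lipschitz functions.
\<close>

section \<open>Continuously differentiable maps\<close>

text \<open>Coordinate balls need not be compact and a character of the algebra need not be a point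
  evaluation, so points can first be matched only on a dense open set; completeness has to supply
  the rest, that of \<open>N\<close> to define the point map everywhere and that of
  \<open>M\<close>, by exchanging the roles, to make it onto. The exponent 3/2 is what a quadratic
  error leaves. Distances of size \<open>r\<close> are known up to \<open>r^2\<close>, so their
  squares are known up to \<open>r^3\<close>; the parallelogram law expresses the squared second
  difference through such squares, and its root has order \<open>r^(3/2)\<close>. Divided by
  \<open>r\<close> this still tends to zero, and geometrically so along halved steps. The quadratic
  error in turn rests on the coefficients of the metric being locally Lipschitz in a chart. The
  bound on the supremum in the unit ball costs nothing locally: a test function with slope
  \<open>1 - C * s\<close> never exceeds \<open>1 / (2 * C)\<close>. Sequences suffice in place of
  nets because one function of the algebra, peaking at a point with a uniform gap outside each
  neighbourhood, controls a neighbourhood base of that point.\<close>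

lemma C1_on_D:
  assumes "C1_on S f"
  obtains f' where "continuous_on S f'" "\<And>x. x \<in> S \<Longrightarrow> (f has_derivative blinfun_apply (f' x)) (at x)"
  using assms unfolding C1_on_def by blast

lemma C1_on_I:
  assumes "continuous_on S f'" "\<And>x. x \<in> S \<Longrightarrow> (f has_derivative blinfun_apply (f' x)) (at x)"
  shows "C1_on S f"
  using assms unfolding C1_on_def by blast

lemma C1_on_subset: "C1_on S f \<Longrightarrow> T \<subseteq> S \<Longrightarrow> C1_on T f"
  unfolding C1_on_def by (meson continuous_on_subset subsetD)

lemma C1_on_has_derivative:
  assumes "C1_on S f" "x \<in> S"
  shows "(f has_derivative frechet_derivative f (at x)) (at x)"
  using assms by (metis C1_on_def frechet_derivative_at)

lemma C1_on_blinfun_derivative: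
  assumes "C1_on S f"
  obtains f' where "continuous_on S f'" "\<And>x. x \<in> S \<Longrightarrow> frechet_derivative f (at x) = blinfun_apply (f' x)"
  using assms unfolding C1_on_def by (metis frechet_derivative_at)

lemma C1_on_imp_continuous_on: "C1_on S f \<Longrightarrow> continuous_on S f"
  unfolding C1_on_def
  by (meson continuous_at_imp_continuous_on has_derivative_continuous)

text \<open>Derivatives at a point of an open set are unique, so the local derivative maps glue to
  \<open>Blinfun (frechet_derivative f (at x))\<close>, and continuity of that map is a local
  matter.\<close>

lemma C1_on_localI:
  assumes "\<And>x. x \<in> S \<Longrightarrow> \<exists>W g. open W \<and> x \<in> W \<and> C1_on W g \<and> (\<forall>y\<in>W. f y = g y)"
  shows "C1_on S f"
proof (rule C1_on_I)
  define f' where "f' x = Blinfun (frechet_derivative f (at x))" for x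
  have *: "(f has_derivative blinfun_apply (f' x)) (at x) \<and> isCont f' x" if x: "x \<in> S" for x
  proof -
    obtain W g g' where W: "open W" "x \<in> W" "\<forall>y\<in>W. f y = g y"
      and g': "continuous_on W g'" "\<And>y. y \<in> W \<Longrightarrow> (g has_derivative blinfun_apply (g' y)) (at y)"
      using assms[OF x] by (metis C1_on_def)
    have fd: "(f has_derivative blinfun_apply (g' y)) (at y)" if "y \<in> W" for y
      using has_derivative_transform_within_open[OF g'(2)[OF that] W(1) that] W(3) by metis
    have eq: "f' y = g' y" if "y \<in> W" for y
      unfolding f'_def using frechet_derivative_at[OF fd[OF that]]
      by (metis blinfun_apply_inverse)
    have "isCont g' x" using g'(1) W by (simp add: continuous_on_eq_continuous_at)
    moreover have "\<forall>\<^sub>F y in nhds x. f' y = g' y"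
      using W eq eventually_nhds by blast
    ultimately have "isCont f' x" using isCont_cong by blast
    then show ?thesis using fd W eq by auto
  qed
  show "continuous_on S f'" using * by (simp add: continuous_at_imp_continuous_on)
  show "(f has_derivative blinfun_apply (f' x)) (at x)" if "x \<in> S" for x using * that by blast
qed

lemma C1_on_cong:
  assumes "C1_on S f" "open S" "\<And>x. x \<in> S \<Longrightarrow> f x = g x"
  shows "C1_on S g"
  using assms by (intro C1_on_localI exI[of _ S] exI[of _ f]) auto

lemma C1_on_compose:
  assumes "C1_on S f" "C1_on T g" "f ` S \<subseteq> T"
  shows "C1_on S (g \<circ> f)"
proof -
  obtain f' where f': "continuous_on S f'" "\<And>x. x \<in> S \<Longrightarrow> (f has_derivative blinfun_apply (f' x)) (at x)"
    using C1_on_D[OF assms(1)] by blast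
  obtain g' where g': "continuous_on T g'" "\<And>x. x \<in> T \<Longrightarrow> (g has_derivative blinfun_apply (g' x)) (at x)"
    using C1_on_D[OF assms(2)] by blast
  show ?thesis
  proof (rule C1_on_I)
    show "continuous_on S (\<lambda>x. g' (f x) o\<^sub>L f' x)"
      by (intro continuous_intros f' continuous_on_compose2[OF g'(1)] C1_on_imp_continuous_on[OF assms(1)] assms(3))
    show "(g \<circ> f has_derivative blinfun_apply (g' (f x) o\<^sub>L f' x)) (at x)" if "x \<in> S" for x
      using diff_chain_at[OF f'(2)[OF that] g'(2)] that assms(3)
      by (auto simp: o_def blinfun_compose.rep_eq image_subset_iff)
  qed
qed

lemma C1_on_const: "C1_on S (\<lambda>x. c)"
  by (rule C1_on_I[where f'="\<lambda>x. 0"]) (auto simp: zero_blinfun.rep_eq)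

lemma C1_on_add:
  assumes "C1_on S f" "C1_on S g" shows "C1_on S (\<lambda>x. f x + g x)"
proof -
  obtain f' where f': "continuous_on S f'" "\<And>x. x \<in> S \<Longrightarrow> (f has_derivative blinfun_apply (f' x)) (at x)"
    using C1_on_D[OF assms(1)] by blast
  obtain g' where g': "continuous_on S g'" "\<And>x. x \<in> S \<Longrightarrow> (g has_derivative blinfun_apply (g' x)) (at x)"
    using C1_on_D[OF assms(2)] by blast
  show ?thesis
    by (rule C1_on_I[where f'="\<lambda>x. f' x + g' x"])
       (auto intro!: continuous_intros f' g' has_derivative_add simp: plus_blinfun.rep_eq)
qed

lemma C1_on_mult:
  fixes f g :: "'a::real_normed_vector \<Rightarrow> real"
  assumes "C1_on S f" "C1_on S g" shows "C1_on S (\<lambda>x. f x * g x)"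
proof -
  obtain f' where f': "continuous_on S f'" "\<And>x. x \<in> S \<Longrightarrow> (f has_derivative blinfun_apply (f' x)) (at x)"
    using C1_on_D[OF assms(1)] by blast
  obtain g' where g': "continuous_on S g'" "\<And>x. x \<in> S \<Longrightarrow> (g has_derivative blinfun_apply (g' x)) (at x)"
    using C1_on_D[OF assms(2)] by blast
  show ?thesis
  proof (rule C1_on_I[where f'="\<lambda>x. f x *\<^sub>R g' x + g x *\<^sub>R f' x"])
    show "continuous_on S (\<lambda>x. f x *\<^sub>R g' x + g x *\<^sub>R f' x)"
      by (intro continuous_intros f' g' C1_on_imp_continuous_on assms)
    show "((\<lambda>x. f x * g x) has_derivative blinfun_apply (f x *\<^sub>R g' x + g x *\<^sub>R f' x)) (at x)" if "x \<in> S" for x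
      by (rule has_derivative_eq_rhs[OF has_derivative_mult[OF f'(2)[OF that] g'(2)[OF that]]])
         (auto simp: plus_blinfun.rep_eq scaleR_blinfun.rep_eq)
  qed
qed

lemma C1_on_real:
  fixes k k' :: "real \<Rightarrow> real"
  assumes "\<And>t. t \<in> S \<Longrightarrow> (k has_real_derivative k' t) (at t)" "continuous_on S k'"
  shows "C1_on S k"
proof (rule C1_on_I[where f'="\<lambda>t. blinfun_scaleR_left (k' t)"])
  show "continuous_on S (\<lambda>t. blinfun_scaleR_left (k' t))"
    by (intro continuous_intros assms)
  show "(k has_derivative blinfun_apply (blinfun_scaleR_left (k' t))) (at t)" if "t \<in> S" for t
    using assms(1)[OF that] by (simp add: has_field_derivative_def mult_commute_abs)
qed

text \<open>Continuity of the derivative at \<open>x\<close> bounds it by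
  \<open>norm (f' x) + 1\<close> on a small ball, and the mean value inequality applies because
  balls are convex.\<close>

lemma C1_on_locally_lipschitz:
  assumes "C1_on S f" "open S" "x \<in> S"
  obtains r L where "r > 0" "L > 0" "ball x r \<subseteq> S"
    "\<And>y z. y \<in> ball x r \<Longrightarrow> z \<in> ball x r \<Longrightarrow> norm (f y - f z) \<le> L * norm (y - z)"
proof -
  obtain f' where f': "continuous_on S f'" "\<And>x. x \<in> S \<Longrightarrow> (f has_derivative blinfun_apply (f' x)) (at x)"
    using C1_on_D[OF assms(1)] by blast
  have "isCont f' x" using f'(1) assms by (simp add: continuous_on_eq_continuous_at)
  then obtain d where d: "d > 0" "\<And>y. dist y x < d \<Longrightarrow> dist (f' y) (f' x) < 1"
    unfolding continuous_at_eps_delta by (meson zero_less_one)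
  obtain e where e: "e > 0" "ball x e \<subseteq> S" using assms(2,3) openE by blast
  define r where "r = min d e"
  have sub: "ball x r \<subseteq> S" using e by (auto simp: r_def)
  have bd: "onorm (blinfun_apply (f' y)) \<le> norm (f' x) + 1" if "y \<in> ball x r" for y
  proof -
    have "dist (f' y) (f' x) < 1" using that d(2)[of y] by (auto simp: r_def dist_commute)
    then have "norm (f' y) \<le> norm (f' x) + 1"
      by (smt (verit) dist_norm norm_triangle_sub)
    then show ?thesis by (simp add: norm_blinfun.rep_eq)
  qed
  show ?thesis
  proof (rule that[of r "norm (f' x) + 1"])
    show "r > 0" using d e by (auto simp: r_def)
    show "norm (f' x) + 1 > 0" by (smt (verit) norm_ge_zero)
    show "ball x r \<subseteq> S" by (rule sub)
    show "norm (f y - f z) \<le> (norm (f' x) + 1) * norm (y - z)" if "y \<in> ball x r" "z \<in> ball x r" for y z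
      by (rule differentiable_bound[OF convex_ball _ bd])
         (use that f'(2) sub has_derivative_at_withinI in blast)+
  qed
qed

text \<open>Level \<open>0\<close> of the packed derivative \<open>D\<close> says that
  \<open>D x [v]\<close> is the Frechet derivative; level \<open>1\<close>, with the bound on
  \<open>D x\<close> for lists of length two, makes this derivative Lipschitz at \<open>x\<close> in
  operator norm.\<close>

lemma smooth_on_imp_C1_on:
  fixes f :: "'a::real_normed_vector \<Rightarrow> 'b::real_normed_vector"
  assumes "smooth_on S f" "open S"
  shows "C1_on S f"
proof -
  obtain D :: "'a \<Rightarrow> 'a list \<Rightarrow> 'b" where D0: "\<And>x. x \<in> S \<Longrightarrow> D x [] = f x"
    and Dm: "\<And>x k. x \<in> S \<Longrightarrow> bounded_multilinear k (D x)"
    and Dd: "\<And>x k e. x \<in> S \<Longrightarrow> e > 0 \<Longrightarrow> \<forall>\<^sub>F y in at x. \<forall>vs. length vs = k \<longrightarrow>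
        norm (D y vs - D x vs - D x ((y - x) # vs)) \<le> e * norm (y - x) * prod_list (map norm vs)"
    using assms(1) unfolding smooth_on_def by blast
  have lin: "bounded_linear (\<lambda>v. D x [v])" if x: "x \<in> S" for x
  proof -
    have l: "linear (\<lambda>v. D x ([0][0 := v]))"
      using Dm[OF x, of 1] unfolding bounded_multilinear_def
      by (metis One_nat_def length_Cons list.size(3) zero_less_one)
    obtain K where K: "\<forall>vs. length vs = 1 \<longrightarrow> norm (D x vs) \<le> K * prod_list (map norm vs)"
      using Dm[OF x, of 1] unfolding bounded_multilinear_def by blast
    have "norm (D x [v]) \<le> norm v * K" for v using K[rule_format, of "[v]"] by (simp add: mult.commute)
    then show ?thesis using l by (simp add: bounded_linear_def bounded_linear_axioms_def) blast
  qed
  define f' where "f' x = Blinfun (\<lambda>v. D x [v])" for x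
  have ap: "blinfun_apply (f' x) v = D x [v]" if "x \<in> S" for x v
    using lin[OF that] by (simp add: f'_def bounded_linear_Blinfun_apply)
  have der: "(f has_derivative blinfun_apply (f' x)) (at x)" if x: "x \<in> S" for x
    unfolding has_derivative_at_within
  proof (intro conjI blinfun.bounded_linear_right tendstoI)
    fix e :: real assume e: "e > 0"
    have "\<forall>\<^sub>F y in at x. norm (D y [] - D x [] - D x [y - x]) \<le> (e/2) * norm (y - x)"
      using Dd[OF x, of "e/2" 0] e by simp
    moreover have "\<forall>\<^sub>F y in at x. y \<in> S" using assms(2) x eventually_at_in_open' by blast
    moreover have "\<forall>\<^sub>F y in at x. y \<noteq> x" by (simp add: eventually_at_filter)
    ultimately show "\<forall>\<^sub>F y in at x. dist ((f y - f x - blinfun_apply (f' x) (y - x)) /\<^sub>R norm (y - x)) 0 < e"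
    proof eventually_elim
      case (elim y)
      then have "norm (f y - f x - blinfun_apply (f' x) (y - x)) \<le> (e/2) * norm (y - x)"
        by (simp add: D0 x ap algebra_simps)
      then have "norm (f y - f x - blinfun_apply (f' x) (y - x)) / norm (y - x) \<le> e/2"
        using elim by (simp add: divide_simps)
      then have "norm (f y - f x - blinfun_apply (f' x) (y - x)) / norm (y - x) < e" using e by linarith
      then show ?case by (simp add: divide_inverse_commute)
    qed
  qed
  have cont: "isCont f' x" if x: "x \<in> S" for x
  proof -
    obtain K where K: "\<forall>vs. length vs = 2 \<longrightarrow> norm (D x vs) \<le> K * prod_list (map norm vs)"
      using Dm[OF x, of 2] unfolding bounded_multilinear_def by blast
    have ev: "\<forall>\<^sub>F y in at x. norm (f' y - f' x) \<le> (1 + \<bar>K\<bar>) * norm (y - x)"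
    proof -
      have "\<forall>\<^sub>F y in at x. \<forall>vs. length vs = 1 \<longrightarrow>
        norm (D y vs - D x vs - D x ((y - x) # vs)) \<le> 1 * norm (y - x) * prod_list (map norm vs)"
        using Dd[OF x, of 1 1] by simp
      moreover have "\<forall>\<^sub>F y in at x. y \<in> S" using assms(2) x eventually_at_in_open' by blast
      ultimately show ?thesis
      proof eventually_elim
        case (elim y)
        show ?case
        proof (rule norm_blinfun_bound)
          show "0 \<le> (1 + \<bar>K\<bar>) * norm (y - x)" by simp
          fix v
          have 1: "norm (D y [v] - D x [v] - D x [y - x, v]) \<le> norm (y - x) * norm v"
            using elim(1)[rule_format, of "[v]"] by simp
          have "norm (D x [y - x, v]) \<le> K * (norm (y - x) * norm v)"
            using K[rule_format, of "[y - x, v]"] by simp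
          also have "\<dots> \<le> \<bar>K\<bar> * (norm (y - x) * norm v)" by (intro mult_right_mono) auto
          finally have 2: "norm (D x [y - x, v]) \<le> \<bar>K\<bar> * (norm (y - x) * norm v)" .
          have "norm (D y [v] - D x [v]) \<le> norm (D y [v] - D x [v] - D x [y - x, v]) + norm (D x [y - x, v])"
            by (metis diff_add_cancel norm_triangle_ineq)
          then show "norm (blinfun_apply (f' y - f' x) v) \<le> (1 + \<bar>K\<bar>) * norm (y - x) * norm v"
            using 1 2 by (simp add: minus_blinfun.rep_eq ap elim(2) x algebra_simps)
        qed
      qed
    qed
    have "((\<lambda>y. (1 + \<bar>K\<bar>) * norm (y - x)) \<longlongrightarrow> (1 + \<bar>K\<bar>) * norm (x - x)) (at x)"
      by (intro tendsto_intros)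
    then have "((\<lambda>y. f' y - f' x) \<longlongrightarrow> 0) (at x)"
      by (intro Lim_null_comparison[OF ev]) simp
    then show ?thesis by (simp add: isCont_def LIM_zero_iff)
  qed
  show ?thesis
    by (rule C1_on_I[of _ f']) (auto intro!: continuous_at_imp_continuous_on cont der)
qed

lemma directional_derivative:
  assumes "(F has_derivative D) (at (x + t *\<^sub>R v))"
  shows "((\<lambda>t. F (x + t *\<^sub>R v)) has_real_derivative D v) (at t)"
proof -
  have "((\<lambda>t. x + t *\<^sub>R v) has_derivative (\<lambda>t. t *\<^sub>R v)) (at t)" by (auto intro!: derivative_eq_intros)
  from has_derivative_compose[OF this assms]
  have "((\<lambda>t. F (x + t *\<^sub>R v)) has_derivative (\<lambda>t. D (t *\<^sub>R v))) (at t)" .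
  moreover have "(\<lambda>t. D (t *\<^sub>R v)) = (*) (D v)"
    using has_derivative_bounded_linear[OF assms] by (auto simp: linear_simps)
  ultimately show ?thesis by (simp add: has_field_derivative_def)
qed

section \<open>Maps with second differences of order 3/2\<close>

text \<open>Cauchy's functional equation: the defect
  \<open>D (t *\<^sub>R u) - t *\<^sub>R D u\<close> is additive in \<open>t\<close> and vanishes at
  the integers, hence is periodic and therefore bounded; an additive bounded function of
  \<open>t\<close> is zero.\<close>

lemma additive_bounded_imp_bounded_linear:
  fixes D :: "'a::real_normed_vector \<Rightarrow> 'b::real_normed_vector"
  assumes add: "\<And>u v. D (u + v) = D u + D v" and bd: "\<And>u. norm (D u) \<le> L * norm u"
  shows "bounded_linear D"
proof -
  have "D (t *\<^sub>R u) = t *\<^sub>R D u" for t u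
  proof -
    define k where "k t = D (t *\<^sub>R u) - t *\<^sub>R D u" for t
    have kadd: "k (s + t) = k s + k t" for s t by (simp add: k_def add algebra_simps)
    have kn: "k (real n * t) = real n *\<^sub>R k t" for n t
    proof (induction n)
      case 0
      show ?case using kadd[of 0 0] by simp
    next
      case (Suc n)
      then show ?case using kadd[of "real n * t" t] by (simp add: algebra_simps)
    qed
    have k1: "k 1 = 0" by (simp add: k_def)
    have kneg: "k (- t) = - k t" for t using kadd[of t "-t"] kn[of 0 0] by (simp add: eq_neg_iff_add_eq_0 add.commute)
    have kint: "k (of_int i) = 0" for i :: int
      by (cases i rule: int_cases2) (use kn[of _ 1] kneg k1 in \<open>auto\<close>)
    have kbd: "norm (k t) \<le> 2 * \<bar>L\<bar> * norm u" for t
    proof -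
      have "k t = k (frac t)" using kadd[of "frac t" "of_int \<lfloor>t\<rfloor>"] kint by (simp add: frac_def)
      moreover have "norm (k (frac t)) \<le> norm (D (frac t *\<^sub>R u)) + norm (frac t *\<^sub>R D u)"
        unfolding k_def by (rule norm_triangle_ineq4)
      moreover have "norm (D (frac t *\<^sub>R u)) \<le> \<bar>L\<bar> * norm u"
      proof -
        have "norm (D (frac t *\<^sub>R u)) \<le> L * norm (frac t *\<^sub>R u)" by (rule bd)
        also have "\<dots> \<le> \<bar>L\<bar> * norm (frac t *\<^sub>R u)" by (intro mult_right_mono) auto
        also have "\<dots> \<le> \<bar>L\<bar> * norm u" using frac_lt_1[of t]
          by (intro mult_left_mono) (auto simp: frac_ge_0 mult_left_le_one_le less_imp_le)
        finally show ?thesis .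
      qed
      moreover have "norm (frac t *\<^sub>R D u) \<le> \<bar>L\<bar> * norm u"
      proof -
        have "norm (frac t *\<^sub>R D u) \<le> norm (D u)"
          using frac_lt_1[of t] by (auto simp: frac_ge_0 mult_left_le_one_le less_imp_le)
        also have "\<dots> \<le> L * norm u" by (rule bd)
        also have "\<dots> \<le> \<bar>L\<bar> * norm u" by (intro mult_right_mono) auto
        finally show ?thesis .
      qed
      ultimately show ?thesis by simp
    qed
    have "k t = 0" for t
    proof (rule ccontr)
      assume "k t \<noteq> 0"
      then obtain n :: nat where "2 * \<bar>L\<bar> * norm u < real n * norm (k t)"
        using reals_Archimedean3[of "norm (k t)"] by auto
      then show False using kbd[of "real n * t"] kn[of n t] by simp
    qed
    then show ?thesis by (simp add: k_def)
  qed
  then show ?thesis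
    by (intro bounded_linear_intro[where K=L]) (use add bd in \<open>auto simp: mult.commute\<close>)
qed

text \<open>Second differences of order \<open>3/2\<close> force continuous differentiability: the difference
  quotients along \<open>2\<^sup>-\<^sup>n u\<close> form a Cauchy sequence, and the parallelogram with sides \<open>u\<close> and \<open>y - x\<close>
  compares the derivatives at \<open>x\<close> and \<open>y\<close>.\<close>

locale second_difference =
  fixes f :: "'a::real_normed_vector \<Rightarrow> 'b::{real_normed_vector, complete_space}" and x0 :: 'a and R K L :: real
  assumes R: "R > 0"
    and lip: "\<And>x y. x \<in> ball x0 R \<Longrightarrow> y \<in> ball x0 R \<Longrightarrow> norm (f x - f y) \<le> L * norm (x - y)"
    and sd: "\<And>x y. x \<in> ball x0 R \<Longrightarrow> y \<in> ball x0 R \<Longrightarrow>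
       norm (f x + f y - 2 *\<^sub>R f ((1/2) *\<^sub>R (x + y))) \<le> K * (norm (x - y) * sqrt (norm (x - y)))"
begin

text \<open>Steps are halved because hypothesis \<open>sd\<close> speaks of midpoints: it relates
  the value at one step to the value at half of it.\<close>

definition quot :: "'a \<Rightarrow> 'a \<Rightarrow> nat \<Rightarrow> 'b" where
  "quot x u n = 2 ^ n *\<^sub>R (f (x + (1/2) ^ n *\<^sub>R u) - f x)"

definition der :: "'a \<Rightarrow> 'a \<Rightarrow> 'b" where
  "der x u = lim (quot x u)"

text \<open>An error of order 3/2 divided by the step is of order 1/2, so along halved steps it
  decays geometrically with ratio \<open>sqrt (1/2)\<close>.\<close>

lemma half_pow_sqrt: "(2::real) ^ n * ((1/2) ^ n * r * sqrt ((1/2) ^ n * r)) = r * sqrt r * sqrt (1/2) ^ n"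
proof -
  have "sqrt ((1/2) ^ n * r) = sqrt (1/2) ^ n * sqrt r" by (simp add: real_sqrt_mult real_sqrt_power)
  moreover have "(2::real) ^ n * (1/2) ^ n = 1" by (simp add: power_mult_distrib[symmetric])
  ultimately show ?thesis by (simp add: mult_ac)
qed

lemma in_ball:
  assumes "x \<in> ball x0 R" "norm u < R - dist x0 x" "0 \<le> t" "t \<le> 1"
  shows "x + t *\<^sub>R u \<in> ball x0 R"
proof -
  have "dist x0 (x + t *\<^sub>R u) \<le> dist x0 x + norm (t *\<^sub>R u)"
    using dist_triangle[of x0 "x + t *\<^sub>R u" x] by (simp add: dist_norm)
  also have "norm (t *\<^sub>R u) \<le> norm u" using assms by (simp add: mult_left_le_one_le)
  finally show ?thesis using assms by simp
qed

text \<open>The next quotient evaluates \<open>f\<close> at the midpoint between \<open>x\<close>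
  and the current point, so two consecutive quotients differ by \<open>2 ^ n\<close> times a second
  difference.\<close>

lemma quot_step:
  assumes "x \<in> ball x0 R" "norm u < R - dist x0 x"
  shows "norm (quot x u (Suc n) - quot x u n) \<le> \<bar>K\<bar> * (norm u * sqrt (norm u)) * sqrt (1/2) ^ n"
proof -
  define w where "w = (1/2::real) ^ n *\<^sub>R u"
  have m: "(1/2) *\<^sub>R ((x + w) + x) = x + (1/2) *\<^sub>R w"
    by (simp add: algebra_simps flip: scaleR_add_left)
  have two: "(2 * c) *\<^sub>R a = c *\<^sub>R a + c *\<^sub>R a" for c and a :: 'b
    by (metis mult_2 scaleR_left_distrib)
  have "quot x u (Suc n) - quot x u n = - (2 ^ n *\<^sub>R (f (x + w) + f x - 2 *\<^sub>R f (x + (1/2) *\<^sub>R w)))"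
    by (simp add: quot_def w_def algebra_simps two)
  then have "norm (quot x u (Suc n) - quot x u n) = 2 ^ n * norm (f (x + w) + f x - 2 *\<^sub>R f ((1/2) *\<^sub>R ((x + w) + x)))"
    by (simp only: m) simp
  also have "\<dots> \<le> 2 ^ n * (K * (norm w * sqrt (norm w)))"
    using sd[of "x + w" x] in_ball[OF assms, of "(1/2)^n"] assms(1)
    by (intro mult_left_mono) (auto simp: w_def power_le_one)
  also have "\<dots> = K * (2 ^ n * ((1/2) ^ n * norm u * sqrt ((1/2) ^ n * norm u)))"
    by (simp add: w_def)
  also have "\<dots> = K * (norm u * sqrt (norm u) * sqrt (1/2) ^ n)" by (simp only: half_pow_sqrt)
  also have "\<dots> \<le> \<bar>K\<bar> * (norm u * sqrt (norm u) * sqrt (1/2) ^ n)" by (intro mult_right_mono) auto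
  finally show ?thesis by (simp add: mult.assoc)
qed

lemma quot_sums:
  assumes "x \<in> ball x0 R" "norm u < R - dist x0 x"
  shows "quot x u \<longlonglongrightarrow> der x u"
    and "norm (der x u - (f (x + u) - f x)) \<le> 4 * \<bar>K\<bar> * (norm u * sqrt (norm u))"
proof -
  define C where "C = \<bar>K\<bar> * (norm u * sqrt (norm u))"
  define q where "q = sqrt (1/2)"
  have C: "C \<ge> 0" by (simp add: C_def)
  \<comment> \<open>The bound \<open>3/4\<close> gives \<open>1 \<le> 4 * (1 - q)\<close>; this is
    where the factor \<open>4\<close> of the geometric sum comes from.\<close>
  have q: "0 \<le> q" "q < 3/4"
  proof -
    show "0 \<le> q" by (simp add: q_def)
    show "q < 3/4" unfolding q_def by (rule real_less_lsqrt) (auto simp: power2_eq_square)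
  qed
  have bd: "norm (quot x u (Suc n) - quot x u n) \<le> C * q ^ n" for n
    using quot_step[OF assms] by (simp add: C_def q_def)
  \<comment> \<open>The subtracted term \<open>q ^ (n + k)\<close> is kept so that the induction
    telescopes; it is dropped only afterwards.\<close>
  have dist_le: "norm (quot x u (n + k) - quot x u n) \<le> 4 * C * (q ^ n - q ^ (n + k))" for n k
  proof (induction k)
    case (Suc k)
    have "norm (quot x u (n + Suc k) - quot x u n) \<le> C * q ^ (n + k) + 4 * C * (q ^ n - q ^ (n + k))"
      using norm_triangle_ineq[of "quot x u (Suc (n + k)) - quot x u (n + k)" "quot x u (n + k) - quot x u n"]
        bd[of "n + k"] Suc by simp
    also have "C * q ^ (n + k) \<le> C * q ^ (n + k) * (4 * (1 - q))"
      using mult_left_mono[of 1 "4 * (1 - q)" "C * q ^ (n + k)"] q C by simp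
    finally show ?case by (simp add: algebra_simps)
  qed simp
  have dist_le': "norm (quot x u m - quot x u n) \<le> 4 * C * q ^ n" if "n \<le> m" for m n
  proof -
    have "4 * C * (q ^ n - q ^ m) \<le> 4 * C * q ^ n" using C q by (intro mult_left_mono) auto
    then show ?thesis using dist_le[of n "m - n"] that by simp
  qed
  have "Cauchy (quot x u)"
  proof (rule CauchyI')
    fix e :: real assume e: "e > 0"
    have "(\<lambda>n. 4 * C * q ^ n) \<longlonglongrightarrow> 4 * C * 0"
      using q by (intro tendsto_mult tendsto_const LIMSEQ_power_zero) auto
    then have "\<forall>\<^sub>F n in sequentially. 4 * C * q ^ n < e" by (rule order_tendstoD) (use e in simp)
    then obtain M where "\<And>n. n \<ge> M \<Longrightarrow> 4 * C * q ^ n < e" unfolding eventually_sequentially by blast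
    then have "dist (quot x u m) (quot x u n) < e" if "m \<ge> M" "n > m" for m n
      using dist_le'[of m n] that by (force simp: dist_norm norm_minus_commute)
    then show "\<exists>M. \<forall>m\<ge>M. \<forall>n>m. dist (quot x u m) (quot x u n) < e" by blast
  qed
  then obtain l where l: "quot x u \<longlonglongrightarrow> l" using Cauchy_convergent_iff convergent_def by blast
  then show lim: "quot x u \<longlonglongrightarrow> der x u" unfolding der_def by (metis limI)
  have "(\<lambda>n. norm (quot x u n - quot x u 0)) \<longlonglongrightarrow> norm (der x u - quot x u 0)"
    by (intro tendsto_intros lim)
  then have "norm (der x u - quot x u 0) \<le> 4 * C"
    by (rule tendsto_upperbound) (use dist_le'[of 0] in \<open>auto intro!: always_eventually\<close>)
  then show "norm (der x u - (f (x + u) - f x)) \<le> 4 * \<bar>K\<bar> * (norm u * sqrt (norm u))"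
    by (simp add: C_def quot_def mult_ac)
qed

text \<open>For directions too long to stay in the ball: after finitely many halvings they are short
  enough, and a limit ignores the first terms.\<close>

lemma der_shift:
  assumes "x \<in> ball x0 R"
  obtains m where "\<And>n. n \<ge> m \<Longrightarrow> norm ((1/2) ^ n *\<^sub>R u) < R - dist x0 x"
proof -
  have p: "R - dist x0 x > 0" using assms by simp
  obtain m where m: "(1/2) ^ m * norm u < R - dist x0 x"
  proof (cases "u = 0")
    case False
    then obtain m where "(1/2::real) ^ m < (R - dist x0 x) / norm u"
      using real_arch_pow_inv[of "(R - dist x0 x) / norm u" "1/2"] p by auto
    then show ?thesis using that False by (simp add: field_simps)
  qed (use that p in auto)
  show ?thesis
  proof (rule that[of m])
    fix n assume "n \<ge> m"
    then have "(1/2::real) ^ n \<le> (1/2) ^ m" by (intro power_decreasing) auto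
    then have "(1/2::real) ^ n * norm u \<le> (1/2) ^ m * norm u" by (intro mult_right_mono) auto
    then show "norm ((1/2) ^ n *\<^sub>R u) < R - dist x0 x" using m by simp
  qed
qed

text \<open>Dropping the first \<open>m\<close> terms of the sequence is the same as replacing
  \<open>u\<close> by \<open>(1/2) ^ m *\<^sub>R u\<close>, up to the factor \<open>2 ^ m\<close>,
  so the case of short directions suffices.\<close>

lemma quot_tendsto_der:
  assumes "x \<in> ball x0 R"
  shows "quot x u \<longlonglongrightarrow> der x u"
proof -
  obtain m where m: "\<And>n. n \<ge> m \<Longrightarrow> norm ((1/2) ^ n *\<^sub>R u) < R - dist x0 x"
    using der_shift[OF assms] by blast
  have "quot x u (n + m) = 2 ^ m *\<^sub>R quot x ((1/2) ^ m *\<^sub>R u) n" for n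
    by (simp add: quot_def power_add mult.commute)
  moreover have "(\<lambda>n. 2 ^ m *\<^sub>R quot x ((1/2) ^ m *\<^sub>R u) n) \<longlonglongrightarrow> 2 ^ m *\<^sub>R der x ((1/2) ^ m *\<^sub>R u)"
    by (intro tendsto_intros quot_sums(1) assms m) simp
  ultimately have "(\<lambda>n. quot x u (n + m)) \<longlonglongrightarrow> 2 ^ m *\<^sub>R der x ((1/2) ^ m *\<^sub>R u)" by simp
  then have "quot x u \<longlonglongrightarrow> 2 ^ m *\<^sub>R der x ((1/2) ^ m *\<^sub>R u)" by (rule LIMSEQ_offset)
  then show ?thesis unfolding der_def by (metis limI)
qed

lemma der_bound:
  assumes "x \<in> ball x0 R"
  shows "norm (der x u) \<le> \<bar>L\<bar> * norm u"
proof -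
  obtain m where m: "\<And>n. n \<ge> m \<Longrightarrow> norm ((1/2) ^ n *\<^sub>R u) < R - dist x0 x"
    using der_shift[OF assms] by blast
  have "norm (quot x u n) \<le> \<bar>L\<bar> * norm u" if "n \<ge> m" for n
  proof -
    have "norm (f (x + (1/2) ^ n *\<^sub>R u) - f x) \<le> L * norm (x + (1/2) ^ n *\<^sub>R u - x)"
      using in_ball[OF assms m[OF that], of 1] by (intro lip assms) simp
    also have "\<dots> \<le> \<bar>L\<bar> * norm (x + (1/2) ^ n *\<^sub>R u - x)" by (intro mult_right_mono) auto
    finally have "2 ^ n * norm (f (x + (1/2) ^ n *\<^sub>R u) - f x) \<le> 2 ^ n * (\<bar>L\<bar> * ((1/2) ^ n * norm u))"
      by (intro mult_left_mono) auto
    also have "\<dots> = \<bar>L\<bar> * norm u" by (simp add: power_one_over)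
    finally show ?thesis by (simp add: quot_def)
  qed
  then show ?thesis
    using tendsto_le[OF _ tendsto_const tendsto_norm[OF quot_tendsto_der[OF assms]]]
    by (metis (mono_tags, lifting) eventually_sequentially trivial_limit_sequentially)
qed

text \<open>The points \<open>x + h *\<^sub>R u\<close> and \<open>x + h *\<^sub>R v\<close> have
  the same midpoint as \<open>x + h *\<^sub>R (u + v)\<close> and \<open>x\<close>. Subtracting the
  two second differences eliminates the value there, and what remains is the additivity defect of
  the quotients.\<close>

lemma der_add:
  assumes "x \<in> ball x0 R"
  shows "der x (u + v) = der x u + der x v"
proof -
  obtain m where m: "\<And>n. n \<ge> m \<Longrightarrow> norm ((1/2) ^ n *\<^sub>R u) < R - dist x0 x"
    using der_shift[OF assms, of u] by blast
  obtain m1 where m1: "\<And>n. n \<ge> m1 \<Longrightarrow> norm ((1/2) ^ n *\<^sub>R v) < R - dist x0 x"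
    using der_shift[OF assms, of v] by blast
  obtain m2 where m2: "\<And>n. n \<ge> m2 \<Longrightarrow> norm ((1/2) ^ n *\<^sub>R (u + v)) < R - dist x0 x"
    using der_shift[OF assms, of "u + v"] by blast
  define B where "B = \<bar>K\<bar> * (norm (u - v) * sqrt (norm (u - v))) + \<bar>K\<bar> * (norm (u + v) * sqrt (norm (u + v)))"
  have est: "norm (quot x u n + quot x v n - quot x (u + v) n) \<le> B * sqrt (1/2) ^ n" if n: "n \<ge> m" "n \<ge> m1" "n \<ge> m2" for n
  proof -
    define h where "h = (1/2::real) ^ n"
    have h: "0 \<le> h" by (simp add: h_def)
    have inb: "x + h *\<^sub>R u \<in> ball x0 R" "x + h *\<^sub>R v \<in> ball x0 R" "x + h *\<^sub>R (u + v) \<in> ball x0 R"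
      using in_ball[OF assms m[OF n(1)], of 1] in_ball[OF assms m1[OF n(2)], of 1] in_ball[OF assms m2[OF n(3)], of 1]
      by (auto simp: h_def)
    have e1: "x + h *\<^sub>R u - (x + h *\<^sub>R v) = h *\<^sub>R (u - v)" and e2: "x + h *\<^sub>R (u + v) - x = h *\<^sub>R (u + v)"
      by (auto simp: algebra_simps)
    define c where "c = (1/2) *\<^sub>R ((x + h *\<^sub>R u) + (x + h *\<^sub>R v))"
    have c2: "c = (1/2) *\<^sub>R ((x + h *\<^sub>R (u + v)) + x)" by (simp add: c_def algebra_simps)
    have 1: "norm (f (x + h *\<^sub>R u) + f (x + h *\<^sub>R v) - 2 *\<^sub>R f c) \<le> K * (h * norm (u - v) * sqrt (h * norm (u - v)))"
      using sd[OF inb(1,2)] h unfolding e1 c_def by simp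
    have 2: "norm (f (x + h *\<^sub>R (u + v)) + f x - 2 *\<^sub>R f c) \<le> K * (h * norm (u + v) * sqrt (h * norm (u + v)))"
      using sd[OF inb(3) assms] h unfolding e2 c2 by simp
    have "norm (f (x + h *\<^sub>R u) + f (x + h *\<^sub>R v) - f (x + h *\<^sub>R (u + v)) - f x)
      \<le> K * (h * norm (u - v) * sqrt (h * norm (u - v))) + K * (h * norm (u + v) * sqrt (h * norm (u + v)))"
      using norm_triangle_ineq4[of "f (x + h *\<^sub>R u) + f (x + h *\<^sub>R v) - 2 *\<^sub>R f c" "f (x + h *\<^sub>R (u + v)) + f x - 2 *\<^sub>R f c"] 1 2
      by (simp add: algebra_simps)
    then have "2 ^ n * norm (f (x + h *\<^sub>R u) + f (x + h *\<^sub>R v) - f (x + h *\<^sub>R (u + v)) - f x)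
      \<le> 2 ^ n * (K * (h * norm (u - v) * sqrt (h * norm (u - v))) + K * (h * norm (u + v) * sqrt (h * norm (u + v))))"
      by (intro mult_left_mono) auto
    also have "\<dots> = K * (2 ^ n * (h * norm (u - v) * sqrt (h * norm (u - v)))) + K * (2 ^ n * (h * norm (u + v) * sqrt (h * norm (u + v))))"
      by (simp add: algebra_simps)
    also have "\<dots> = K * (norm (u - v) * sqrt (norm (u - v)) * sqrt (1/2) ^ n) + K * (norm (u + v) * sqrt (norm (u + v)) * sqrt (1/2) ^ n)"
      by (simp only: h_def half_pow_sqrt)
    also have "\<dots> \<le> \<bar>K\<bar> * (norm (u - v) * sqrt (norm (u - v)) * sqrt (1/2) ^ n) + \<bar>K\<bar> * (norm (u + v) * sqrt (norm (u + v)) * sqrt (1/2) ^ n)"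
      by (intro add_mono mult_right_mono) auto
    finally have "2 ^ n * norm (f (x + h *\<^sub>R u) + f (x + h *\<^sub>R v) - f (x + h *\<^sub>R (u + v)) - f x) \<le> B * sqrt (1/2) ^ n"
      by (simp add: B_def algebra_simps)
    moreover have "quot x u n + quot x v n - quot x (u + v) n = 2 ^ n *\<^sub>R (f (x + h *\<^sub>R u) + f (x + h *\<^sub>R v) - f (x + h *\<^sub>R (u + v)) - f x)"
      by (simp add: quot_def h_def algebra_simps)
    ultimately show ?thesis by simp
  qed
  have "sqrt (1/2) < 1" by simp
  then have "(\<lambda>n. B * sqrt (1/2) ^ n) \<longlonglongrightarrow> B * 0"
    by (intro tendsto_mult tendsto_const LIMSEQ_power_zero) auto
  then have lim0: "(\<lambda>n. B * sqrt (1/2) ^ n) \<longlonglongrightarrow> 0" by (simp only: mult_zero_right)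
  have "(\<lambda>n. quot x u n + quot x v n - quot x (u + v) n) \<longlonglongrightarrow> 0"
    by (rule Lim_null_comparison[OF _ lim0], rule eventually_sequentiallyI[of "m + m1 + m2"], rule est) auto
  moreover have "(\<lambda>n. quot x u n + quot x v n - quot x (u + v) n) \<longlonglongrightarrow> der x u + der x v - der x (u + v)"
    by (intro tendsto_intros quot_tendsto_der assms)
  ultimately have "der x u + der x v - der x (u + v) = 0" using LIMSEQ_unique by blast
  then show ?thesis by simp
qed

lemma bounded_linear_der: "x \<in> ball x0 R \<Longrightarrow> bounded_linear (der x)"
  by (rule additive_bounded_imp_bounded_linear[OF der_add der_bound])

lemma has_derivative_der:
  assumes x: "x \<in> ball x0 R"
  shows "(f has_derivative der x) (at x)"
  unfolding has_derivative_at_within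
proof (intro conjI bounded_linear_der x)
  have "\<forall>\<^sub>F y in at x. norm ((f y - f x - der x (y - x)) /\<^sub>R norm (y - x)) \<le> 4 * \<bar>K\<bar> * sqrt (norm (y - x))"
  proof -
    have "\<forall>\<^sub>F y in at x. y \<in> ball x (R - dist x0 x)" using x
      by (intro eventually_at_in_open') auto
    moreover have "\<forall>\<^sub>F y in at x. y \<noteq> x" by (simp add: eventually_at_filter)
    ultimately show ?thesis
    proof eventually_elim
      case (elim y)
      have "norm (der x (y - x) - (f (x + (y - x)) - f x)) \<le> 4 * \<bar>K\<bar> * (norm (y - x) * sqrt (norm (y - x)))"
        using elim by (intro quot_sums(2) x) (simp add: dist_norm norm_minus_commute)
      then have "norm (f y - f x - der x (y - x)) \<le> 4 * \<bar>K\<bar> * sqrt (norm (y - x)) * norm (y - x)"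
        by (simp add: norm_minus_commute mult_ac)
      moreover have "norm ((f y - f x - der x (y - x)) /\<^sub>R norm (y - x)) = norm (f y - f x - der x (y - x)) / norm (y - x)"
        by (simp only: norm_scaleR) (simp add: divide_inverse_commute)
      ultimately show ?case using elim by (simp only: pos_divide_le_eq zero_less_norm_iff right_minus_eq simp_thms)
    qed
  qed
  moreover have "((\<lambda>y. 4 * \<bar>K\<bar> * sqrt (norm (y - x))) \<longlongrightarrow> 4 * \<bar>K\<bar> * sqrt (norm (x - x))) (at x)"
    by (intro tendsto_intros)
  then have "((\<lambda>y. 4 * \<bar>K\<bar> * sqrt (norm (y - x))) \<longlongrightarrow> 0) (at x)" by simp
  ultimately show "((\<lambda>y. (f y - f x - der x (y - x)) /\<^sub>R norm (y - x)) \<longlongrightarrow> 0) (at x)"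
    by (rule Lim_null_comparison)
qed

lemma der_hoelder:
  assumes x: "x \<in> ball x0 R" and y: "y \<in> ball x0 R" and s: "norm (y - x) < (R - dist x0 x) / 3"
  shows "norm (der y u - der x u) \<le> 16 * \<bar>K\<bar> * sqrt (norm (y - x)) * norm u"
proof (cases "u = 0 \<or> y = x")
  case True
  then show ?thesis using bounded_linear_der[OF x] bounded_linear_der[OF y]
    by (auto simp: linear_simps)
next
  case False
  define r where "r = norm (y - x)"
  have r: "r > 0" using False by (simp add: r_def)
  \<comment> \<open>With \<open>norm w = r\<close> the diagonals of the parallelogram
    \<open>x, y, y + w, x + w\<close> have length at most \<open>2 * r\<close>, so all four error
    terms are multiples of \<open>r * sqrt r\<close>. Both diagonals have midpoint \<open>c\<close>.
    The hypothesis on \<open>norm (y - x)\<close> keeps all corners in the ball.\<close>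
  define w where "w = (r / norm u) *\<^sub>R u"
  have w: "norm w = r" using False r by (simp add: w_def)
  have dy: "dist x0 y \<le> dist x0 x + r" using dist_triangle[of x0 y x] by (simp add: r_def dist_norm norm_minus_commute)
  have wx: "norm w < R - dist x0 x" and wy: "norm w < R - dist x0 y"
    using s dy r w x by (auto simp: r_def)
  have xw: "x + w \<in> ball x0 R" "y + w \<in> ball x0 R" using in_ball[OF x wx, of 1] in_ball[OF y wy, of 1] by auto
  define Q where "Q = \<bar>K\<bar> * (r * sqrt r)"
  have 1: "norm (der x w - (f (x + w) - f x)) \<le> 4 * Q" using quot_sums(2)[OF x wx] by (simp add: w Q_def)
  have 2: "norm (der y w - (f (y + w) - f y)) \<le> 4 * Q" using quot_sums(2)[OF y wy] by (simp add: w Q_def)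
  define c where "c = (1/2) *\<^sub>R (y + w + x)"
  \<comment> \<open>Enlarging the radicand to \<open>4 * r\<close> makes the bound equal to
    \<open>4 * r * sqrt r\<close>; four terms of this size give the constant
    \<open>16\<close>.\<close>
  have sr: "s * sqrt s \<le> (2 * r) * sqrt (4 * r)" if "s \<le> 2 * r" "0 \<le> s" for s
    using that r by (intro mult_mono real_sqrt_le_mono) auto
  have sr': "K * (s * sqrt s) \<le> 4 * Q" if "s \<le> 2 * r" "0 \<le> s" for s
  proof -
    have "K * (s * sqrt s) \<le> \<bar>K\<bar> * (s * sqrt s)" using that by (intro mult_right_mono) auto
    also have "\<dots> \<le> \<bar>K\<bar> * ((2 * r) * sqrt (4 * r))" by (intro mult_left_mono sr that) auto
    finally show ?thesis by (simp add: Q_def real_sqrt_mult)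
  qed
  have "norm (y + w - x) \<le> 2 * r" using norm_triangle_ineq[of "y - x" w] w by (simp add: r_def algebra_simps)
  then have 3: "norm (f (y + w) + f x - 2 *\<^sub>R f c) \<le> 4 * Q"
    using sd[OF xw(2) x] sr'[of "norm (y + w - x)"] by (simp add: c_def)
  have "norm (y - (x + w)) \<le> 2 * r" using norm_triangle_ineq4[of "y - x" w] w by (simp add: r_def algebra_simps)
  moreover have "c = (1/2) *\<^sub>R (y + (x + w))" by (simp add: c_def algebra_simps)
  ultimately have 4: "norm (f y + f (x + w) - 2 *\<^sub>R f c) \<le> 4 * Q"
    using sd[OF y xw(1)] sr'[of "norm (y - (x + w))"] by simp
  have "der y w - der x w = (der y w - (f (y + w) - f y)) - (der x w - (f (x + w) - f x))
     + (f (y + w) + f x - 2 *\<^sub>R f c) - (f y + f (x + w) - 2 *\<^sub>R f c)" by (simp add: algebra_simps)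
  also have "norm \<dots> \<le> 16 * Q"
    using 1 2 3 4 by (smt (verit) norm_triangle_ineq norm_triangle_ineq4)
  finally have *: "norm (der y w - der x w) \<le> 16 * Q" .
  have lw: "der z w = (r / norm u) *\<^sub>R der z u" if "z \<in> ball x0 R" for z
    using bounded_linear_der[OF that] by (simp add: w_def linear_simps)
  have "norm (der y w - der x w) = (r / norm u) * norm (der y u - der x u)"
    using r by (simp only: lw[OF x] lw[OF y] flip: scaleR_diff_right) simp
  then have "norm (der y u - der x u) \<le> 16 * Q * norm u / r"
    using * r False by (simp add: field_simps)
  then show ?thesis using r by (simp add: Q_def r_def)
qed

lemma C1_on_ball: "C1_on (ball x0 R) f"
proof -
  define f' where "f' x = Blinfun (der x)" for x
  have ap: "blinfun_apply (f' x) = der x" if "x \<in> ball x0 R" for x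
    using bounded_linear_der[OF that] by (simp add: f'_def bounded_linear_Blinfun_apply)
  have "isCont f' x" if x: "x \<in> ball x0 R" for x
  proof -
    have "\<forall>\<^sub>F y in at x. y \<in> ball x0 R \<inter> ball x ((R - dist x0 x) / 3)"
      using x by (intro eventually_at_in_open' open_Int open_ball) auto
    then have "\<forall>\<^sub>F y in at x. norm (f' y - f' x) \<le> 16 * \<bar>K\<bar> * sqrt (norm (y - x))"
    proof eventually_elim
      case (elim y)
      show ?case
      proof (rule norm_blinfun_bound)
        show "norm (blinfun_apply (f' y - f' x) u) \<le> 16 * \<bar>K\<bar> * sqrt (norm (y - x)) * norm u" for u
          using der_hoelder[OF x, of y u] elim x
          by (simp add: minus_blinfun.rep_eq ap dist_norm norm_minus_commute)
      qed simp
    qed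
    moreover have "((\<lambda>y. 16 * \<bar>K\<bar> * sqrt (norm (y - x))) \<longlongrightarrow> 16 * \<bar>K\<bar> * sqrt (norm (x - x))) (at x)"
      by (intro tendsto_intros)
    then have "((\<lambda>y. 16 * \<bar>K\<bar> * sqrt (norm (y - x))) \<longlongrightarrow> 0) (at x)" by simp
    ultimately have "((\<lambda>y. f' y - f' x) \<longlongrightarrow> 0) (at x)"
      by (rule Lim_null_comparison)
    then show ?thesis by (simp add: isCont_def LIM_zero_iff)
  qed
  then show ?thesis unfolding C1_on_def
    by (intro exI[of _ f'] conjI continuous_at_imp_continuous_on ballI)
       (auto simp: ap has_derivative_der)
qed

end

section \<open>Approximate isometries and radial test functions\<close>

text \<open>This is \<open>h\<close> read in charts, with \<open>nM\<close> and \<open>nN\<close>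
  the metric norms at a base point. The triangle inequality and the parallelogram law are asked of
  \<open>nN\<close>, in which second differences of \<open>h\<close> are measured.
  \<open>upper\<close> and \<open>lower\<close> arise because both norms agree, up to quadratic
  errors, with the same number \<open>rho\<close>.\<close>

locale approx_isometry =
  fixes h :: "'a::real_normed_vector \<Rightarrow> 'b::{real_normed_vector, complete_space}" and x0 :: 'a and R :: real and E :: "'b set"
    and nM :: "'a \<Rightarrow> 'a \<Rightarrow> real" and nN :: "'b \<Rightarrow> 'b \<Rightarrow> real" and aM bM aN bN C :: real
  assumes R: "R > 0" and pos: "aM > 0" "bM > 0" "aN > 0" "bN > 0" "C > 0"
    and hE: "h ` ball x0 R \<subseteq> E"
    and M_bounds: "\<And>x v. x \<in> ball x0 R \<Longrightarrow> aM * norm v \<le> nM x v \<and> nM x v \<le> bM * norm v"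
    and N_bounds: "\<And>y w. y \<in> E \<Longrightarrow> aN * norm w \<le> nN y w \<and> nN y w \<le> bN * norm w"
    and M_scale: "\<And>x t v. x \<in> ball x0 R \<Longrightarrow> nM x (t *\<^sub>R v) = \<bar>t\<bar> * nM x v"
    and N_scale: "\<And>y t w. y \<in> E \<Longrightarrow> nN y (t *\<^sub>R w) = \<bar>t\<bar> * nN y w"
    and N_triangle: "\<And>y w w'. y \<in> E \<Longrightarrow> nN y (w + w') \<le> nN y w + nN y w'"
    and N_parallelogram: "\<And>y w w'. y \<in> E \<Longrightarrow> (nN y (w + w'))\<^sup>2 + (nN y (w - w'))\<^sup>2 = 2 * (nN y w)\<^sup>2 + 2 * (nN y w')\<^sup>2"
    and M_var: "\<And>x y v. x \<in> ball x0 R \<Longrightarrow> y \<in> ball x0 R \<Longrightarrow> nM x v \<le> (1 + C * nM y (x - y)) * nM y v"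
    and N_var: "\<And>x y w. x \<in> E \<Longrightarrow> y \<in> E \<Longrightarrow> nN y w \<le> (1 + C * nN x (y - x)) * nN x w"
    and M_small: "\<And>x y. x \<in> ball x0 R \<Longrightarrow> y \<in> ball x0 R \<Longrightarrow> C * nM y (x - y) \<le> 1/2"
    and N_small: "\<And>x y. x \<in> ball x0 R \<Longrightarrow> y \<in> ball x0 R \<Longrightarrow> C * nN (h y) (h x - h y) \<le> 1/2"
    and upper: "\<And>x y. x \<in> ball x0 R \<Longrightarrow> y \<in> ball x0 R \<Longrightarrow>
      nN (h y) (h x - h y) - C * (nN (h y) (h x - h y))\<^sup>2 \<le> nM y (x - y) + C * (nM y (x - y))\<^sup>2"
    and lower: "\<And>x y. x \<in> ball x0 R \<Longrightarrow> y \<in> ball x0 R \<Longrightarrow>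
      nM y (x - y) - C * (nM y (x - y))\<^sup>2 \<le> nN (h y) (h x - h y) + C * (nN (h y) (h x - h y))\<^sup>2"
begin

lemma nM_nonneg: "x \<in> ball x0 R \<Longrightarrow> 0 \<le> nM x v"
  using M_bounds[of x v] pos by (smt (verit) mult_nonneg_nonneg norm_ge_zero)

lemma nN_nonneg: "y \<in> E \<Longrightarrow> 0 \<le> nN y v"
  using N_bounds[of y v] pos by (smt (verit) mult_nonneg_nonneg norm_ge_zero)

lemma hB: "x \<in> ball x0 R \<Longrightarrow> h x \<in> E"
  using hE by blast

text \<open>Write \<open>s\<close> and \<open>S\<close> for the source and target lengths. By
  smallness half of each absorbs its quadratic term, which gives \<open>S \<le> 4 * s\<close>;
  inserted once more, this turns \<open>C * S^2\<close> into \<open>16 * C * s^2\<close>, and one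
  further \<open>C * s^2\<close> comes from the source.\<close>

lemma distortion:
  assumes x: "x \<in> ball x0 R" and y: "y \<in> ball x0 R"
  shows "\<bar>nN (h y) (h x - h y) - nM y (x - y)\<bar> \<le> 17 * C * (nM y (x - y))\<^sup>2"
proof -
  define s S where "s = nM y (x - y)" and "S = nN (h y) (h x - h y)"
  have s: "0 \<le> s" "C * s \<le> 1/2" using nM_nonneg[OF y] M_small[OF x y] by (auto simp: s_def)
  have S: "0 \<le> S" "C * S \<le> 1/2" using nN_nonneg[OF hB[OF y]] N_small[OF x y] by (auto simp: S_def)
  have u: "S - C * S\<^sup>2 \<le> s + C * s\<^sup>2" and l: "s - C * s\<^sup>2 \<le> S + C * S\<^sup>2"
    using upper[OF x y] lower[OF x y] by (auto simp: s_def S_def)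
  have "C * S\<^sup>2 \<le> (1/2) * S" using mult_right_mono[OF S(2) S(1)] by (simp add: power2_eq_square mult_ac)
  moreover have "C * s\<^sup>2 \<le> (1/2) * s" using mult_right_mono[OF s(2) s(1)] by (simp add: power2_eq_square mult_ac)
  ultimately have "S \<le> 4 * s" using u s(1) by linarith
  then have "S\<^sup>2 \<le> (4 * s)\<^sup>2" using S(1) by (intro power_mono) auto
  then have "C * S\<^sup>2 \<le> C * (16 * s\<^sup>2)" using pos by (intro mult_left_mono) (auto simp: power_mult_distrib)
  then show ?thesis using u l unfolding s_def[symmetric] S_def[symmetric] by (simp add: abs_le_iff)
qed

text \<open>With \<open>C * nM y (x - y) \<le> 1/2\<close> the error \<open>17 * C * s^2\<close> is
  at most \<open>9 * s\<close>.\<close>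

lemma near_isometry:
  assumes "x \<in> ball x0 R" "y \<in> ball x0 R"
  shows "nN (h y) (h x - h y) \<le> 10 * nM y (x - y)"
proof -
  have "17 * C * (nM y (x - y))\<^sup>2 \<le> 9 * nM y (x - y)"
    using mult_right_mono[OF M_small[OF assms] nM_nonneg[OF assms(2)], of "x - y"] nM_nonneg[OF assms(2), of "x - y"]
    by (simp add: power2_eq_square mult_ac)
  then show ?thesis using distortion[OF assms] by linarith
qed

lemma lipschitz:
  assumes "x \<in> ball x0 R" "y \<in> ball x0 R"
  shows "norm (h x - h y) \<le> 10 * bM / aN * norm (x - y)"
proof -
  have "aN * norm (h x - h y) \<le> nN (h y) (h x - h y)" using N_bounds[OF hB[OF assms(2)]] by blast
  also have "\<dots> \<le> 10 * nM y (x - y)" by (rule near_isometry[OF assms])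
  also have "\<dots> \<le> 10 * (bM * norm (x - y))" using M_bounds[OF assms(2), of "x - y"] by simp
  finally show ?thesis using pos by (simp add: field_simps)
qed

text \<open>The parallelogram law at the midpoint: the three distances agree with their Euclidean
  counterparts up to a quadratic error, so the second difference, whose square is a difference
  of squared distances, is of order \<open>3/2\<close>.\<close>

lemma second_difference_bound:
  obtains K where "\<And>x y. x \<in> ball x0 R \<Longrightarrow> y \<in> ball x0 R \<Longrightarrow>
    norm (h x + h y - 2 *\<^sub>R h ((1/2) *\<^sub>R (x + y))) \<le> K * (norm (x - y) * sqrt (norm (x - y)))"
proof -
  \<comment> \<open>The losses collected in \<open>D2\<close>: \<open>2 * C\<close> for moving the
    base point from \<open>m\<close> to \<open>y\<close> in the source,
    \<open>68 * C = 17 * C * 2^2\<close> for the distortion at length \<open>2 * e\<close>, and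
    \<open>200 * C\<close> for moving the base point from \<open>h m\<close> to \<open>h y\<close>
    in the target.\<close>
  define K2 where "K2 = (2 * C + 68 * C + 200 * C) * bM\<^sup>2"
  \<comment> \<open>Expanding the squares below leaves
    \<open>12 * K2 * a * r^2 + 4 * K2^2 * r^4\<close>; the bounds \<open>a \<le> bM * r\<close> and
    \<open>r \<le> 2 * R\<close> turn both terms into multiples of \<open>r^3\<close>.\<close>
  define K3 where "K3 = 12 * bM * K2 + 8 * K2\<^sup>2 * R"
  have K2: "K2 \<ge> 0" using pos by (simp add: K2_def)
  have K3: "K3 \<ge> 0" using pos K2 R by (simp add: K3_def)
  have "norm (h x + h y - 2 *\<^sub>R h ((1/2) *\<^sub>R (x + y))) \<le> sqrt K3 / aN * (norm (x - y) * sqrt (norm (x - y)))"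
    if x: "x \<in> ball x0 R" and y: "y \<in> ball x0 R" for x y
  proof -
    define m u r where "m = (1/2) *\<^sub>R (x + y)" and "u = (1/2) *\<^sub>R (x - y)" and "r = norm (x - y)"
    have m: "m \<in> ball x0 R"
      using convexD[OF convex_ball x y, of "1/2" "1/2"] by (simp add: m_def algebra_simps)
    have xm: "x - m = u" and ym: "y - m = (-1) *\<^sub>R u" and my: "m - y = u" and xy: "x - y = 2 *\<^sub>R u"
      by (auto simp: m_def u_def algebra_simps simp flip: scaleR_add_left)
    have r: "0 \<le> r" "r \<le> 2 * R"
      using x y dist_triangle[of x y x0] by (auto simp: r_def dist_norm norm_minus_commute)
    have nu: "norm u \<le> r" by (simp add: u_def r_def)
    define a e A B D where "a = nM m u" and "e = nM y u" and "A = nN (h m) (h x - h m)"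
      and "B = nN (h m) (h y - h m)" and "D = nN (h m) (h x - h y)"
    have bound: "nM z u \<le> bM * r" if "z \<in> ball x0 R" for z
      using M_bounds[OF that, of u] mult_left_mono[OF nu, of bM] pos by linarith
    have a: "0 \<le> a" "a \<le> bM * r" and e: "0 \<le> e" "e \<le> bM * r"
      using nM_nonneg m y bound by (auto simp: a_def e_def)
    have sq: "s\<^sup>2 \<le> bM\<^sup>2 * r\<^sup>2" if "0 \<le> s" "s \<le> bM * r" for s
      using power_mono[OF that(2,1), of 2] by (simp add: power_mult_distrib)
    have nMym: "nM m (y - m) = a" using M_scale[OF m, of "-1" u] by (simp add: ym a_def)
    have A: "A \<le> a + 17 * C * a\<^sup>2" "A \<le> 10 * a" "0 \<le> A"
      using distortion[OF x m] near_isometry[OF x m] nN_nonneg[OF hB[OF m]] by (auto simp: A_def xm a_def)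
    have B: "B \<le> a + 17 * C * a\<^sup>2" "B \<le> 10 * a" "0 \<le> B"
      using distortion[OF y m] near_isometry[OF y m] nN_nonneg[OF hB[OF m]] unfolding nMym by (auto simp: B_def)
    have D: "0 \<le> D" "D \<le> A + B"
    proof -
      show "0 \<le> D" using nN_nonneg[OF hB[OF m]] by (simp add: D_def)
      have "nN (h m) ((h x - h m) + (-1) *\<^sub>R (h y - h m)) \<le> A + B"
        using N_triangle[OF hB[OF m], of "h x - h m" "(-1) *\<^sub>R (h y - h m)"]
          N_scale[OF hB[OF m], of "-1" "h y - h m"] by (simp add: A_def B_def)
      then show "D \<le> A + B" by (simp add: D_def)
    qed
    have exy: "nM y (x - y) = 2 * e" using M_scale[OF y, of 2 u] by (simp add: xy e_def)
    have "a \<le> (1 + C * e) * e" using M_var[OF m y, of u] by (simp add: my a_def e_def)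
    then have e1: "e \<ge> a - C * e\<^sup>2" by (simp add: algebra_simps power2_eq_square)
    have "nN (h y) (h x - h y) \<ge> 2 * e - 68 * C * e\<^sup>2"
      using distortion[OF x y] unfolding exy by (simp add: power_mult_distrib abs_le_iff)
    moreover have "nN (h y) (h x - h y) \<le> D + C * (B * D)"
      using N_var[OF hB[OF m] hB[OF y], of "h x - h y"] by (simp add: B_def D_def algebra_simps)
    moreover have "B * D \<le> 200 * (bM\<^sup>2 * r\<^sup>2)"
    proof -
      have "B * D \<le> (10 * a) * (20 * a)" using A B D a by (intro mult_mono) auto
      also have "\<dots> = 200 * a\<^sup>2" by (simp add: power2_eq_square)
      finally show ?thesis using sq[OF a] by linarith
    qed
    then have "C * (B * D) \<le> C * (200 * (bM\<^sup>2 * r\<^sup>2))" using pos by (intro mult_left_mono) auto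
    moreover have "C * e\<^sup>2 \<le> C * (bM\<^sup>2 * r\<^sup>2)" using pos sq[OF e] by (intro mult_left_mono) auto
    ultimately have D2: "D \<ge> 2 * a - K2 * r\<^sup>2" using e1 by (simp add: K2_def algebra_simps)
    have "C * a\<^sup>2 \<le> C * (bM\<^sup>2 * r\<^sup>2)" using pos sq[OF a] by (intro mult_left_mono) auto
    moreover have "0 \<le> C * (bM\<^sup>2 * r\<^sup>2)" using pos by simp
    ultimately have aK: "a + 17 * C * a\<^sup>2 \<le> a + K2 * r\<^sup>2" by (simp add: K2_def algebra_simps)
    have Kr: "0 \<le> K2 * r\<^sup>2" using K2 by simp
    have A2: "A\<^sup>2 \<le> (a + K2 * r\<^sup>2)\<^sup>2" "B\<^sup>2 \<le> (a + K2 * r\<^sup>2)\<^sup>2"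
      using A B aK by (auto intro!: power_mono)
    \<comment> \<open>\<open>D2\<close> may be squared only if its left-hand bound is nonnegative;
      otherwise the bound claimed here is itself at most zero.\<close>
    have D3: "D\<^sup>2 \<ge> 4 * a\<^sup>2 - 4 * a * (K2 * r\<^sup>2)"
    proof (cases "2 * a - K2 * r\<^sup>2 \<ge> 0")
      case True
      then have "(2 * a - K2 * r\<^sup>2)\<^sup>2 \<le> D\<^sup>2" using D2 by (intro power_mono)
      then have "4 * a\<^sup>2 - 4 * a * (K2 * r\<^sup>2) + (K2 * r\<^sup>2)\<^sup>2 \<le> D\<^sup>2"
        by (simp only: power2_diff) (simp add: power_mult_distrib)
      moreover have "u \<le> d" if "u + w\<^sup>2 \<le> d" for u w d :: real using that zero_le_power2[of w] by linarith
      ultimately show ?thesis by blast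
    next
      case False
      then have "4 * a * (a - K2 * r\<^sup>2) \<le> 0" using a by (intro mult_nonneg_nonpos) auto
      then have "4 * a\<^sup>2 - 4 * a * (K2 * r\<^sup>2) \<le> 0" by (simp only: power2_eq_square right_diff_distrib mult.assoc)
      then show ?thesis using zero_le_power2[of D] by linarith
    qed
    have "(nN (h m) (h x + h y - 2 *\<^sub>R h m))\<^sup>2 = 2 * A\<^sup>2 + 2 * B\<^sup>2 - D\<^sup>2"
      using N_parallelogram[OF hB[OF m], of "h x - h m" "h y - h m"]
      by (simp add: A_def B_def D_def scaleR_2 algebra_simps)
    also have "\<dots> \<le> 4 * (a + K2 * r\<^sup>2)\<^sup>2 - (4 * a\<^sup>2 - 4 * a * (K2 * r\<^sup>2))" using A2 D3 by linarith
    also have "\<dots> = 12 * K2 * a * r\<^sup>2 + 4 * K2\<^sup>2 * (r * r ^ 3)"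
      by (simp add: power2_sum power_mult_distrib algebra_simps power2_eq_square power3_eq_cube)
    also have "\<dots> \<le> 12 * K2 * (bM * r) * r\<^sup>2 + 4 * K2\<^sup>2 * ((2 * R) * r ^ 3)"
      using a r K2 by (intro add_mono mult_left_mono mult_right_mono) auto
    also have "\<dots> = K3 * r ^ 3" by (simp add: K3_def algebra_simps power2_eq_square power3_eq_cube)
    finally have "nN (h m) (h x + h y - 2 *\<^sub>R h m) \<le> sqrt (K3 * r ^ 3)" by (rule real_le_rsqrt)
    also have "\<dots> = sqrt K3 * (r * sqrt r)" using r by (simp add: real_sqrt_mult power3_eq_cube)
    finally have "aN * norm (h x + h y - 2 *\<^sub>R h m) \<le> sqrt K3 * (r * sqrt r)"
      using N_bounds[OF hB[OF m], of "h x + h y - 2 *\<^sub>R h m"] by linarith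
    then show ?thesis using pos by (simp add: field_simps m_def r_def)
  qed
  then show ?thesis by (rule that)
qed

lemma C1: "C1_on (ball x0 R) h"
proof -
  obtain K where K: "\<And>x y. x \<in> ball x0 R \<Longrightarrow> y \<in> ball x0 R \<Longrightarrow>
    norm (h x + h y - 2 *\<^sub>R h ((1/2) *\<^sub>R (x + y))) \<le> K * (norm (x - y) * sqrt (norm (x - y)))"
    using second_difference_bound by blast
  interpret second_difference h x0 R K "10 * bM / aN"
    by unfold_locales (use R lipschitz K in auto)
  show ?thesis by (rule C1_on_ball)
qed

text \<open>Along \<open>x + t *\<^sub>R v\<close> the distortion is quadratic in \<open>t\<close>.
  After division by \<open>\<bar>t\<bar>\<close> it vanishes in the limit, while the difference
  quotients tend to the derivative, so the same family has both numbers as limits.\<close>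

lemma derivative_isometric:
  assumes x: "x \<in> ball x0 R"
  shows "nN (h x) (frechet_derivative h (at x) v) = nM x v"
proof -
  define D where "D = frechet_derivative h (at x)"
  have D: "(h has_derivative D) (at x)" unfolding D_def by (rule C1_on_has_derivative[OF C1 x])
  have hx: "h x \<in> E" by (rule hB[OF x])
  define q where "q t = (1/t) *\<^sub>R (h (x + t *\<^sub>R v) - h x)" for t
  have "((\<lambda>t. h (x + t *\<^sub>R v)) has_vector_derivative D v) (at 0)"
  proof -
    have "((\<lambda>t. x + t *\<^sub>R v) has_derivative (\<lambda>t. t *\<^sub>R v)) (at 0)" by (auto intro!: derivative_eq_intros)
    moreover have "(h has_derivative D) (at (x + 0 *\<^sub>R v))" using D by simp
    ultimately have "((\<lambda>t. h (x + t *\<^sub>R v)) has_derivative (\<lambda>t. D (t *\<^sub>R v))) (at 0)"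
      by (rule has_derivative_compose)
    then show ?thesis using has_derivative_bounded_linear[OF D]
      by (simp add: has_vector_derivative_def linear_simps)
  qed
  then have "((\<lambda>t. norm (h (x + t *\<^sub>R v) - h x - t *\<^sub>R D v) / \<bar>t\<bar>) \<longlongrightarrow> 0) (at 0)"
    unfolding has_vector_derivative_def has_derivative_at by simp
  moreover have "norm (h (x + t *\<^sub>R v) - h x - t *\<^sub>R D v) / \<bar>t\<bar> = norm (q t - D v)" if "t \<noteq> 0" for t
  proof -
    have "h (x + t *\<^sub>R v) - h x - t *\<^sub>R D v = t *\<^sub>R (q t - D v)" using that by (simp add: q_def algebra_simps)
    then show ?thesis using that by simp
  qed
  ultimately have qlim: "((\<lambda>t. norm (q t - D v)) \<longlongrightarrow> 0) (at 0)"
    by (elim Lim_transform_eventually) (auto simp: eventually_at_filter)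
  have diff: "\<bar>nN (h x) (q t) - nN (h x) (D v)\<bar> \<le> bN * norm (q t - D v)" for t
  proof -
    have "nN (h x) (D v - q t) = nN (h x) (q t - D v)" using N_scale[OF hx, of "-1" "q t - D v"] by simp
    then show ?thesis
      using N_triangle[OF hx, of "q t - D v" "D v"] N_triangle[OF hx, of "D v - q t" "q t"] conjunct2[OF N_bounds[OF hx, of "q t - D v"]]
      by simp
  qed
  have "((\<lambda>t. bN * norm (q t - D v)) \<longlongrightarrow> 0) (at 0)" using tendsto_mult_right_zero[OF qlim] by blast
  then have "((\<lambda>t. nN (h x) (q t) - nN (h x) (D v)) \<longlongrightarrow> 0) (at 0)"
    by (rule Lim_null_comparison[rotated]) (use diff in \<open>auto simp del: right_diff_distrib\<close>)
  then have 1: "((\<lambda>t. nN (h x) (q t)) \<longlongrightarrow> nN (h x) (D v)) (at 0)" by (simp add: LIM_zero_iff)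
  have "\<forall>\<^sub>F t in at 0. x + t *\<^sub>R v \<in> ball x0 R"
  proof -
    have "((\<lambda>t. x + t *\<^sub>R v) \<longlongrightarrow> x + 0 *\<^sub>R v) (at 0)" by (intro tendsto_intros)
    then show ?thesis using x topological_tendstoD[OF _ open_ball, of _ "x + 0 *\<^sub>R v"] by simp
  qed
  then have "\<forall>\<^sub>F t in at 0. norm (nN (h x) (q t) - nM x v) \<le> 17 * C * (nM x v)\<^sup>2 * \<bar>t\<bar>"
    using eventually_neq_at_within[of "0::real" 0 UNIV]
  proof eventually_elim
    case (elim t)
    then have t: "t \<noteq> 0" by simp
    have "nN (h x) (h (x + t *\<^sub>R v) - h x) = \<bar>t\<bar> * nN (h x) (q t)"
      using N_scale[OF hx, of t "q t"] t by (simp add: q_def)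
    moreover have "nM x (x + t *\<^sub>R v - x) = \<bar>t\<bar> * nM x v" using M_scale[OF x, of t v] by simp
    ultimately have "\<bar>\<bar>t\<bar> * nN (h x) (q t) - \<bar>t\<bar> * nM x v\<bar> \<le> 17 * C * (\<bar>t\<bar> * nM x v)\<^sup>2"
      using distortion[OF elim(1) x] by simp
    then have "\<bar>t\<bar> * \<bar>nN (h x) (q t) - nM x v\<bar> \<le> \<bar>t\<bar> * (17 * C * (nM x v)\<^sup>2 * \<bar>t\<bar>)"
      by (simp add: abs_mult power2_eq_square mult_ac flip: right_diff_distrib)
    then show ?case using t by simp
  qed
  moreover have "((\<lambda>t. 17 * C * (nM x v)\<^sup>2 * \<bar>t\<bar>) \<longlongrightarrow> 0) (at 0)"
    by (rule tendsto_eq_intros refl)+ simp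
  ultimately have "((\<lambda>t. nN (h x) (q t) - nM x v) \<longlongrightarrow> 0) (at 0)" by (rule Lim_null_comparison)
  then have "((\<lambda>t. nN (h x) (q t)) \<longlongrightarrow> nM x v) (at 0)" by (simp add: LIM_zero_iff)
  then show ?thesis using 1 LIM_unique unfolding D_def by blast
qed

end

text \<open>Squaring the positive part removes its corner at \<open>0\<close>; the truncations in
  \<open>cone\<close> and \<open>hump\<close> are continuously differentiable for this
  reason.\<close>

lemma has_derivative_max_0_power2:
  "((\<lambda>x::real. (max 0 x)\<^sup>2) has_real_derivative 2 * max 0 x) (at x)"
proof -
  consider "x > 0" | "x < 0" | "x = 0" by linarith
  then show ?thesis
  proof cases
    case 1
    have "((\<lambda>x. x\<^sup>2) has_real_derivative 2 * max 0 x) (at x)"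
      using 1 by (auto intro!: derivative_eq_intros)
    then show ?thesis
      by (rule has_field_derivative_transform_within_open[where S="{0<..}"]) (use 1 in auto)
  next
    case 2
    have "((\<lambda>x. 0) has_real_derivative 2 * max 0 x) (at x)"
      using 2 by (auto intro!: derivative_eq_intros)
    then show ?thesis
      by (rule has_field_derivative_transform_within_open[where S="{..<0}"]) (use 2 in auto)
  next
    case 3
    have "((\<lambda>h. ((max 0 (0 + h))\<^sup>2 - (max 0 0)\<^sup>2) / h) \<longlongrightarrow> (0::real)) (at 0)"
    proof (rule Lim_null_comparison)
      show "\<forall>\<^sub>F h in at 0. norm (((max 0 (0 + h))\<^sup>2 - (max 0 0)\<^sup>2) / h) \<le> \<bar>h::real\<bar>"
        by (rule eventuallyI) (auto simp: max_def power2_eq_square)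
      show "((\<lambda>h::real. \<bar>h\<bar>) \<longlongrightarrow> 0) (at 0)" by (rule tendsto_eq_intros refl)+ simp
    qed
    then show ?thesis using 3 by (simp add: DERIV_def)
  qed
qed

text \<open>A primitive of \<open>s \<mapsto> max 0 (1 - C s)\<close>: the slope of a radial function
  that may be subtracted without exceeding gradient norm one in a metric that varies at rate \<open>C\<close>.\<close>

definition cone :: "real \<Rightarrow> real \<Rightarrow> real" where
  "cone C s = (C / 2) * ((1 / C)\<^sup>2 - (max 0 (1 / C - s))\<^sup>2)"

lemma cone_derivative:
  assumes "C > 0"
  shows "(cone C has_real_derivative max 0 (1 - C * s)) (at s)"
proof -
  have "((\<lambda>s. (max 0 (1 / C - s))\<^sup>2) has_real_derivative 2 * max 0 (1 / C - s) * (- 1)) (at s)"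
    by (rule DERIV_chain2[OF has_derivative_max_0_power2]) (auto intro!: derivative_eq_intros)
  then have "(cone C has_real_derivative (C / 2) * (0 - 2 * max 0 (1 / C - s) * (- 1))) (at s)"
    unfolding cone_def by (intro DERIV_cmult DERIV_diff DERIV_const)
  moreover have "(C / 2) * (0 - 2 * max 0 (1 / C - s) * (- 1)) = max 0 (1 - C * s)"
    using assms by (auto simp: max_def field_simps)
  ultimately show ?thesis by simp
qed

lemma cone_nonneg: "C > 0 \<Longrightarrow> s \<ge> 0 \<Longrightarrow> 0 \<le> cone C s"
  unfolding cone_def by (intro mult_nonneg_nonneg) (auto intro!: power_mono simp: max_def)

lemma cone_le: "C > 0 \<Longrightarrow> cone C s \<le> 1 / (2 * C)"
  unfolding cone_def by (simp add: field_simps power2_eq_square)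

lemma cone_far: "C > 0 \<Longrightarrow> s \<ge> 1 / C \<Longrightarrow> cone C s = 1 / (2 * C)"
  unfolding cone_def by (simp add: max_def field_simps power2_eq_square)

lemma cone_strict_mono:
  assumes "C > 0" "s < t" "s < 1 / C"
  shows "cone C s < cone C t"
  unfolding cone_def using assms
  by (auto intro!: power_strict_mono simp: max_def)

lemma cone_mono:
  assumes "C > 0" "s \<le> t"
  shows "cone C s \<le> cone C t"
  unfolding cone_def using assms
  by (auto intro!: power_mono simp: max_def)

text \<open>Up to \<open>1 / C\<close> the function is \<open>s - C * s^2 / 2\<close>; beyond that
  the left-hand side is no longer positive.\<close>

lemma cone_ge:
  assumes "C > 0" "s \<ge> 0"
  shows "s - C * s\<^sup>2 \<le> cone C s"
proof (cases "s \<le> 1 / C")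
  case True
  then have "cone C s = s - C * s\<^sup>2 / 2" unfolding cone_def using assms
    by (simp add: max_def field_simps power2_eq_square)
  then show ?thesis using assms by simp
next
  case False
  then have "s * 1 \<le> s * (C * s)" using assms by (intro mult_left_mono) (auto simp: field_simps)
  then have "s - C * s\<^sup>2 \<le> 0" by (simp add: power2_eq_square mult_ac)
  then show ?thesis using cone_nonneg[OF assms] by linarith
qed

lemma cone_0: "C > 0 \<Longrightarrow> cone C 0 = 0"
  by (simp add: cone_def)

locale inner_form =
  fixes Q :: "'a::real_normed_vector \<Rightarrow>\<^sub>L 'a \<Rightarrow>\<^sub>L real"
  assumes sym: "Q v w = Q w v" and nonneg: "Q v v \<ge> 0"
begin

definition nrm :: "'a \<Rightarrow> real" where "nrm v = sqrt (Q v v)"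

lemma nrm_sq: "(nrm v)\<^sup>2 = Q v v"
  by (simp add: nrm_def nonneg)

lemma nrm_nonneg: "0 \<le> nrm v"
  by (simp add: nrm_def nonneg)

lemma nrm_scale: "nrm (t *\<^sub>R v) = \<bar>t\<bar> * nrm v"
  by (simp add: nrm_def blinfun.scaleR_left blinfun.scaleR_right real_sqrt_mult flip: mult.assoc power2_eq_square)

lemma nrm_parallelogram: "(nrm (v + w))\<^sup>2 + (nrm (v - w))\<^sup>2 = 2 * (nrm v)\<^sup>2 + 2 * (nrm w)\<^sup>2"
  by (simp add: nrm_sq blinfun.add_left blinfun.add_right blinfun.diff_left blinfun.diff_right)

lemma polarization: "Q v w = ((nrm (v + w))\<^sup>2 - (nrm (v - w))\<^sup>2) / 4"
  by (simp add: nrm_sq blinfun.add_left blinfun.add_right blinfun.diff_left blinfun.diff_right sym[of w v])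

text \<open>The usual discriminant argument, with a separate case for a vector of length zero, as
  the form is only semidefinite here.\<close>

lemma cauchy_schwarz: "\<bar>Q v w\<bar> \<le> nrm v * nrm w"
proof -
  have pos: "0 \<le> Q v v + 2 * t * Q v w + t\<^sup>2 * Q w w" for t
    using nonneg[of "v + t *\<^sub>R w"]
    by (simp add: blinfun.add_left blinfun.add_right blinfun.scaleR_left blinfun.scaleR_right sym[of w v] power2_eq_square algebra_simps)
  have "(Q v w)\<^sup>2 \<le> Q v v * Q w w"
  proof (cases "Q w w = 0")
    case True
    have "Q v w = 0"
    proof (rule ccontr)
      assume "Q v w \<noteq> 0"
      \<comment> \<open>At this value of \<open>t\<close> the expression that \<open>pos\<close>
        declares nonnegative equals \<open>-1\<close>.\<close>
      then show False using pos[of "- (Q v v + 1) / (2 * Q v w)"] True by (simp add: field_simps)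
    qed
    then show ?thesis using True by simp
  next
    case False
    then have "Q w w > 0" using nonneg[of w] by simp
    then show ?thesis using pos[of "- Q v w / Q w w"] by (simp add: field_simps power2_eq_square)
  qed
  then have "\<bar>Q v w\<bar> \<le> sqrt (Q v v * Q w w)" by (simp add: real_le_rsqrt)
  then show ?thesis by (simp add: nrm_def real_sqrt_mult)
qed

lemma nrm_triangle: "nrm (v + w) \<le> nrm v + nrm w"
proof (rule power2_le_imp_le)
  have "(nrm (v + w))\<^sup>2 = (nrm v)\<^sup>2 + 2 * Q v w + (nrm w)\<^sup>2"
    by (simp add: nrm_sq blinfun.add_left blinfun.add_right sym[of w v])
  also have "\<dots> \<le> (nrm v)\<^sup>2 + 2 * (nrm v * nrm w) + (nrm w)\<^sup>2" using cauchy_schwarz[of v w] by simp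
  finally show "(nrm (v + w))\<^sup>2 \<le> (nrm v + nrm w)\<^sup>2" by (simp add: power2_sum)
  show "0 \<le> nrm v + nrm w" using nrm_nonneg by simp
qed

text \<open>The parameter \<open>e\<close> rounds off the distance from \<open>y\<close> at the
  centre, where the norm itself has a corner. In the comparison with \<open>rho\<close> it is sent
  to zero.\<close>

definition radial :: "real \<Rightarrow> real \<Rightarrow> 'a \<Rightarrow> 'a \<Rightarrow> real" where
  "radial C e y z = cone C (sqrt (e\<^sup>2 + (nrm (z - y))\<^sup>2))"

lemma nrm_sq_derivative:
  "((\<lambda>z. e\<^sup>2 + (nrm (z - y))\<^sup>2) has_derivative blinfun_apply (2 *\<^sub>R Q (z - y))) (at z)"
  unfolding nrm_sq
  by (rule has_derivative_eq_rhs, (rule derivative_intros blinfun.FDERIV refl)+)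
     (auto simp: fun_eq_iff sym scaleR_blinfun.rep_eq)

text \<open>By the Cauchy-Schwarz inequality the rounded distance has slope at most one, so the
  gradient is controlled by the slope of \<open>cone\<close>. The bound keeps the factor
  \<open>1 - C * nrm (z - y)\<close>, which later compensates for measuring \<open>v\<close> at
  \<open>z\<close> instead of \<open>y\<close>.\<close>

lemma radial_derivative:
  assumes "C > 0" "e > 0"
  defines "s \<equiv> \<lambda>z y. sqrt (e\<^sup>2 + (nrm (z - y))\<^sup>2)"
  shows "C1_on UNIV (radial C e y)"
    and "\<bar>frechet_derivative (radial C e y) (at z) v\<bar> \<le> max 0 (1 - C * nrm (z - y)) * nrm v"
proof -
  define q where "q z = e\<^sup>2 + (nrm (z - y))\<^sup>2" for z
  have q: "q z > 0" for z using assms by (simp add: q_def add_pos_nonneg)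
  define k where "k t = cone C (sqrt t)" for t
  define k' where "k' t = max 0 (1 - C * sqrt t) * (inverse (sqrt t) / 2)" for t
  have k: "(k has_real_derivative k' t) (at t)" if "t > 0" for t
    unfolding k_def k'_def
    by (rule DERIV_chain2[OF cone_derivative[OF assms(1)] DERIV_real_sqrt[OF that]])
  have eq: "radial C e y = k \<circ> q" by (auto simp: radial_def k_def q_def)
  have dq: "(q has_derivative blinfun_apply (2 *\<^sub>R Q (z - y))) (at z)" for z
    unfolding q_def by (rule nrm_sq_derivative)
  have "C1_on UNIV q"
    by (rule C1_on_I[OF _ dq]) (intro continuous_intros)
  moreover have "C1_on {0<..} k"
    by (rule C1_on_real[where k'=k', OF k]) (auto intro!: continuous_intros simp: k'_def)
  ultimately show "C1_on UNIV (radial C e y)"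
    unfolding eq by (rule C1_on_compose) (use q in auto)
  have "(k has_derivative (*) (k' (q z))) (at (q z))"
    using k[OF q[of z]] by (simp add: has_field_derivative_def)
  then have "(radial C e y has_derivative (*) (k' (q z)) \<circ> blinfun_apply (2 *\<^sub>R Q (z - y))) (at z)"
    unfolding eq by (rule diff_chain_at[OF dq])
  then have "frechet_derivative (radial C e y) (at z) v = k' (q z) * (2 * Q (z - y) v)"
    using frechet_derivative_at[symmetric] by (fastforce simp: scaleR_blinfun.rep_eq)
  also have "\<bar>\<dots>\<bar> = max 0 (1 - C * sqrt (q z)) * (\<bar>Q (z - y) v\<bar> / sqrt (q z))"
    using q[of z] by (simp add: k'_def abs_mult field_simps)
  also have "\<dots> \<le> max 0 (1 - C * nrm (z - y)) * nrm v"
  proof (intro mult_mono)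
    have l: "nrm (z - y) \<le> sqrt (q z)" by (rule real_le_rsqrt) (simp add: q_def)
    then show "max 0 (1 - C * sqrt (q z)) \<le> max 0 (1 - C * nrm (z - y))"
      using assms(1) mult_left_mono[OF l, of C] by linarith
    have "\<bar>Q (z - y) v\<bar> \<le> sqrt (q z) * nrm v"
      using cauchy_schwarz[of "z - y" v] mult_right_mono[OF l nrm_nonneg[of v]] by linarith
    then show "\<bar>Q (z - y) v\<bar> / sqrt (q z) \<le> nrm v" using q[of z] by (simp add: field_simps)
  qed (use q[of z] in auto)
  finally show "\<bar>frechet_derivative (radial C e y) (at z) v\<bar> \<le> max 0 (1 - C * nrm (z - y)) * nrm v" .
qed

lemma radial_far:
  assumes "C > 0" "nrm (z - y) \<ge> 1 / C"
  shows "radial C e y z = 1 / (2 * C)"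
  unfolding radial_def
proof (rule cone_far[OF assms(1)])
  have "nrm (z - y) \<le> sqrt (e\<^sup>2 + (nrm (z - y))\<^sup>2)" by (rule real_le_rsqrt) simp
  then show "1 / C \<le> sqrt (e\<^sup>2 + (nrm (z - y))\<^sup>2)" using assms(2) by linarith
qed

lemma radial_bounds: "C > 0 \<Longrightarrow> 0 \<le> radial C e y z \<and> radial C e y z \<le> 1 / (2 * C)"
  unfolding radial_def by (intro conjI cone_nonneg cone_le) auto

end

section \<open>Sums of separated humps\<close>

text \<open>Built from the squared norm, which in an inner product space is differentiable at the
  centre too; the outer square smooths the edge of the support.\<close>

definition hump :: "'a::real_inner \<Rightarrow> real \<Rightarrow> 'a \<Rightarrow> real" where
  "hump z r x = (max 0 (1 - (norm (x - z) / r)\<^sup>2))\<^sup>2"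

lemma hump_derivative:
  fixes z :: "'a::real_inner"
  assumes "r > 0"
  shows "C1_on UNIV (hump z r)"
    and "\<bar>frechet_derivative (hump z r) (at x) v\<bar> \<le> 4 / r * norm v"
proof -
  define c where "c = inverse (r\<^sup>2)"
  define q where "q x = 1 - c * ((x - z) \<bullet> (x - z))" for x
  have eq: "hump z r = (\<lambda>t. (max 0 t)\<^sup>2) \<circ> q"
    by (auto simp: hump_def q_def fun_eq_iff power_divide dot_square_norm c_def power_mult_distrib divide_inverse power_inverse mult.commute)
  have dq: "(q has_derivative blinfun_apply (- (2 * c) *\<^sub>R blinfun_inner_left (x - z))) (at x)" for x
    unfolding q_def
  proof (rule has_derivative_eq_rhs)
    show "((\<lambda>x. 1 - c * ((x - z) \<bullet> (x - z))) has_derivative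
      (\<lambda>v. 0 - c * ((x - z) \<bullet> (v - 0) + (v - 0) \<bullet> (x - z)))) (at x)"
      by (intro derivative_intros has_derivative_const has_derivative_ident)
    show "(\<lambda>v. 0 - c * ((x - z) \<bullet> (v - 0) + (v - 0) \<bullet> (x - z))) =
      blinfun_apply (- (2 * c) *\<^sub>R blinfun_inner_left (x - z))"
      by (simp add: fun_eq_iff blinfun.scaleR_left blinfun.minus_left inner_commute algebra_simps)
  qed
  have "C1_on UNIV q"
    by (rule C1_on_I[OF _ dq]) (intro continuous_intros)
  moreover have "C1_on UNIV (\<lambda>t::real. (max 0 t)\<^sup>2)"
    by (rule C1_on_real[OF has_derivative_max_0_power2]) (intro continuous_intros)
  ultimately show "C1_on UNIV (hump z r)" unfolding eq by (rule C1_on_compose) simp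
  have "((\<lambda>t. (max 0 t)\<^sup>2) has_derivative (*) (2 * max 0 (q x))) (at (q x))"
    using has_derivative_max_0_power2 by (simp add: has_field_derivative_def)
  then have "(hump z r has_derivative (*) (2 * max 0 (q x)) \<circ> blinfun_apply (- (2 * c) *\<^sub>R blinfun_inner_left (x - z))) (at x)"
    unfolding eq by (rule diff_chain_at[OF dq])
  then have "frechet_derivative (hump z r) (at x) v = 2 * max 0 (q x) * (- (2 * c) * ((x - z) \<bullet> v))"
    using frechet_derivative_at[symmetric] by (fastforce simp: blinfun.scaleR_left blinfun.minus_left inner_commute)
  then have "\<bar>frechet_derivative (hump z r) (at x) v\<bar> = 4 * (max 0 (q x) * (\<bar>(x - z) \<bullet> v\<bar> / r\<^sup>2))"
    using assms by (simp add: abs_mult c_def divide_inverse mult_ac)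
  also have "max 0 (q x) * (\<bar>(x - z) \<bullet> v\<bar> / r\<^sup>2) \<le> norm v / r"
  proof (cases "norm (x - z) \<le> r")
    case True
    have "\<bar>(x - z) \<bullet> v\<bar> \<le> norm (x - z) * norm v" by (rule Cauchy_Schwarz_ineq2)
    also have "\<dots> \<le> r * norm v" using True by (intro mult_right_mono) auto
    finally have 1: "\<bar>(x - z) \<bullet> v\<bar> / r\<^sup>2 \<le> norm v / r" using assms by (simp add: field_simps power2_eq_square)
    have "max 0 (q x) \<le> 1" using assms by (auto simp: q_def c_def)
    then have "max 0 (q x) * (\<bar>(x - z) \<bullet> v\<bar> / r\<^sup>2) \<le> 1 * (\<bar>(x - z) \<bullet> v\<bar> / r\<^sup>2)" by (intro mult_right_mono) auto
    then show ?thesis using 1 by linarith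
  next
    case False
    then have "r\<^sup>2 \<le> (norm (x - z))\<^sup>2" using assms by (intro power_mono) auto
    then have "q x \<le> 0" using assms by (simp add: q_def c_def dot_square_norm field_simps)
    then show ?thesis using assms by simp
  qed
  finally show "\<bar>frechet_derivative (hump z r) (at x) v\<bar> \<le> 4 / r * norm v" by simp
qed

lemma hump_center: "hump z r z = 1"
  by (simp add: hump_def)

lemma hump_bounds: "r > 0 \<Longrightarrow> 0 \<le> hump z r x \<and> hump z r x \<le> 1"
  unfolding hump_def by (intro conjI power_le_one) auto

lemma hump_far:
  assumes "r > 0" "norm (x - z) \<ge> r"
  shows "hump z r x = 0"
proof -
  have "1 \<le> (norm (x - z) / r)\<^sup>2" using assms by (intro one_le_power) (auto simp: field_simps)
  then show ?thesis by (simp add: hump_def)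
qed

lemma hump_near:
  assumes "r > 0" "norm (x - z) \<le> r / 2"
  shows "hump z r x \<ge> 1/2"
proof -
  have "(norm (x - z) / r)\<^sup>2 \<le> (1/2)\<^sup>2" using assms by (intro power_mono) (auto simp: field_simps)
  then have "3/4 \<le> 1 - (norm (x - z) / r)\<^sup>2" by (simp add: power_one_over del: power_divide)
  then have "(3/4)\<^sup>2 \<le> hump z r x" unfolding hump_def by (intro power_mono) auto
  then show ?thesis by (simp add: power2_eq_square)
qed

text \<open>The set \<open>Z\<close> may be infinite. Supports have radius \<open>r\<close> and
  centres are \<open>3 * r\<close> apart, so a ball of radius \<open>r / 2\<close> meets at most one
  support. Hence the sum is locally a single hump or zero, and its gradient bound does not grow with
  the number of humps.\<close>

lemma separated_humps:
  fixes Z :: "'a::real_inner set"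
  assumes r: "r > 0" and sep: "\<And>y z. y \<in> Z \<Longrightarrow> z \<in> Z \<Longrightarrow> y \<noteq> z \<Longrightarrow> norm (y - z) \<ge> 3 * r"
  obtains F where "C1_on UNIV F" "\<And>x. 0 \<le> F x \<and> F x \<le> 1"
    "\<And>x v. \<bar>frechet_derivative F (at x) v\<bar> \<le> 4 / r * norm v"
    "\<And>x z. z \<in> Z \<Longrightarrow> norm (x - z) < r \<Longrightarrow> F x = hump z r x"
    "\<And>x. (\<And>z. z \<in> Z \<Longrightarrow> norm (x - z) \<ge> r) \<Longrightarrow> F x = 0"
proof -
  define F where "F x = (if \<exists>z\<in>Z. norm (x - z) < r then hump (SOME z. z \<in> Z \<and> norm (x - z) < r) r x else 0)" for x
  have F1: "F x = hump z r x" if "z \<in> Z" "norm (x - z) < r" for x z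
  proof -
    have "z' = z" if "z' \<in> Z \<and> norm (x - z') < r" for z'
    proof (rule ccontr)
      assume "z' \<noteq> z"
      then have "norm (z' - z) \<ge> 3 * r" using sep that \<open>z \<in> Z\<close> by blast
      moreover have "norm (z' - z) \<le> norm (x - z) + norm (x - z')"
        using norm_triangle_ineq4[of "x - z" "x - z'"] by simp
      ultimately show False using that \<open>norm (x - z) < r\<close> r by linarith
    qed
    then have "(SOME z. z \<in> Z \<and> norm (x - z) < r) = z" using that by (metis (mono_tags, lifting) someI_ex)
    moreover have "\<exists>z\<in>Z. norm (x - z) < r" using that by blast
    ultimately show ?thesis by (simp only: F_def if_True)
  qed
  have F0: "F x = 0" if "\<And>z. z \<in> Z \<Longrightarrow> norm (x - z) \<ge> r" for x
  proof -
    have "\<not> (\<exists>z\<in>Z. norm (x - z) < r)" using that not_less by blast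
    then show ?thesis by (simp only: F_def if_False)
  qed
  have loc: "\<exists>g. C1_on UNIV g \<and> (\<forall>v. \<bar>frechet_derivative g (at x) v\<bar> \<le> 4 / r * norm v) \<and> (\<forall>y\<in>ball x (r/2). F y = g y)" for x
  proof (cases "\<exists>z\<in>Z. norm (x - z) < 3/2 * r")
    case True
    then obtain z where z: "z \<in> Z" "norm (x - z) < 3/2 * r" by blast
    have "F y = hump z r y" if y: "y \<in> ball x (r/2)" for y
    proof (cases "norm (y - z) < r")
      case False
      have "norm (y - z') \<ge> r" if z': "z' \<in> Z" for z'
      proof (cases "z' = z")
        case False
        then have "norm (z' - z) \<ge> 3 * r" using sep z z' by blast
        moreover have "norm (z' - z) \<le> norm (x - z) + norm (x - z')"
          using norm_triangle_ineq4[of "x - z" "x - z'"] by simp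
        moreover have "norm (x - z') \<le> norm (y - z') + norm (x - y)"
          using norm_triangle_ineq[of "x - y" "y - z'"] by simp
        ultimately show ?thesis using y z by (simp add: dist_norm)
      qed (use False in simp)
      then show ?thesis using F0 hump_far[OF r] False by (metis linorder_not_less)
    qed (use F1 z in simp)
    then show ?thesis using hump_derivative[OF r] by blast
  next
    case False
    have "F y = 0" if y: "y \<in> ball x (r/2)" for y
    proof (rule F0)
      fix z assume "z \<in> Z"
      then have "norm (x - z) \<ge> 3/2 * r" using False by force
      moreover have "norm (x - z) \<le> norm (y - z) + norm (x - y)"
        using norm_triangle_ineq[of "x - y" "y - z"] by simp
      ultimately show "norm (y - z) \<ge> r" using y by (simp add: dist_norm)
    qed
    then show ?thesis using r by (intro exI[of _ "\<lambda>_. 0"]) (auto simp: C1_on_const frechet_derivative_const)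
  qed
  show ?thesis
  proof (rule that[of F])
    show "C1_on UNIV F"
      by (rule C1_on_localI) (metis loc open_ball centre_in_ball half_gt_zero r C1_on_subset subset_UNIV)
    show "0 \<le> F x \<and> F x \<le> 1" for x
      using hump_bounds[OF r] by (auto simp: F_def)
    show "\<bar>frechet_derivative F (at x) v\<bar> \<le> 4 / r * norm v" for x v
    proof -
      obtain g where g: "C1_on UNIV g" "\<forall>v. \<bar>frechet_derivative g (at x) v\<bar> \<le> 4 / r * norm v" "\<forall>y\<in>ball x (r/2). F y = g y"
        using loc by blast
      have "(g has_derivative frechet_derivative g (at x)) (at x)" using g(1) C1_on_has_derivative by blast
      then have "(F has_derivative frechet_derivative g (at x)) (at x)"
        by (rule has_derivative_transform_within_open[OF _ open_ball[of x "r/2"]]) (use g r in auto)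
      then show ?thesis using g(2) frechet_derivative_at by metis
    qed
  qed (use F1 F0 in auto)
qed

text \<open>A separated subsequence could be split into two by a sum of disjoint humps, whose values along
  the sequence would not converge.\<close>

lemma Cauchy_if_C1_convergent:
  fixes X :: "nat \<Rightarrow> 'a::real_inner"
  assumes conv: "\<And>F L. C1_on UNIV F \<Longrightarrow> (\<And>x. 0 \<le> F x \<and> F x \<le> 1) \<Longrightarrow>
      (\<And>x v. \<bar>frechet_derivative F (at x) v\<bar> \<le> L * norm v) \<Longrightarrow> convergent (\<lambda>n. F (X n))"
  shows "Cauchy X"
proof -
  have cover: "\<exists>Z. finite Z \<and> range X \<subseteq> (\<Union>z\<in>Z. ball z r)" if r: "r > 0" for r
  proof (rule ccontr)
    assume neg: "\<nexists>Z. finite Z \<and> range X \<subseteq> (\<Union>z\<in>Z. ball z r)"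
    \<comment> \<open>Total boundedness of the range is proved by contradiction with a greedy
      choice: no finite family of balls covers, so a separated finite set can always be
      enlarged.\<close>
    define good where "good Z \<longleftrightarrow> finite Z \<and> Z \<subseteq> range X \<and> (\<forall>y\<in>Z. \<forall>z\<in>Z. y \<noteq> z \<longrightarrow> norm (y - z) \<ge> r)" for Z
    have "\<exists>g. \<forall>n::nat. good (g n) \<and> g n \<subset> g (Suc n)"
    proof (rule dependent_nat_choice)
      show "\<exists>Z. good Z" by (rule exI[of _ "{}"]) (simp add: good_def)
      fix Z and n :: nat assume Z: "good Z"
      then have "finite Z" by (simp add: good_def)
      then have "\<not> range X \<subseteq> (\<Union>z\<in>Z. ball z r)" using neg by metis
      then obtain x where x: "x \<in> range X" "x \<notin> (\<Union>z\<in>Z. ball z r)" by blast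
      then have "good (insert x Z)" using Z by (auto simp: good_def dist_norm norm_minus_commute not_less)
      moreover have "x \<notin> Z" using x r by auto
      ultimately show "\<exists>y. good y \<and> Z \<subset> y" by blast
    qed
    then obtain g :: "nat \<Rightarrow> 'a set" where g: "\<And>n. good (g n)" "\<And>n. g n \<subset> g (Suc n)" by blast
    have mono: "g m \<subseteq> g n" if "m \<le> n" for m n
      by (rule lift_Suc_mono_le[of g, OF _ that]) (use g(2) in blast)
    define Z where "Z = (\<Union>n. g n)"
    have Zsep: "norm (y - z) \<ge> r" if yz: "y \<in> Z" "z \<in> Z" "y \<noteq> z" for y z
    proof -
      obtain m n where "y \<in> g m" "z \<in> g n" using yz unfolding Z_def by blast
      then have "y \<in> g (max m n)" "z \<in> g (max m n)" using mono[of m "max m n"] mono[of n "max m n"] by auto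
      then show ?thesis using g(1)[of "max m n"] yz(3) unfolding good_def by blast
    qed
    have ZX: "Z \<subseteq> range X" using g(1) unfolding Z_def good_def by fast
    have "infinite Z"
    proof
      assume fin: "finite Z"
      have "n \<le> card (g n)" for n
      proof (induction n)
        case (Suc n)
        have "card (g n) < card (g (Suc n))" using g by (intro psubset_card_mono) (auto simp: good_def)
        then show ?case using Suc by simp
      qed simp
      moreover have "card (g n) \<le> card Z" for n using fin by (intro card_mono) (auto simp: Z_def)
      ultimately show False by (meson le_trans not_less_eq_eq order_refl)
    qed
    then obtain f :: "nat \<Rightarrow> 'a" where f: "inj f" "range f \<subseteq> Z" using infinite_countable_subset by blast
    define Z1 where "Z1 = f ` {n. even n}"
    define Z2 where "Z2 = f ` {n. odd n}"
    have "\<exists>n>m. even n" "\<exists>n>m. odd n" for m :: nat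
      by (rule exI[of _ "2 * Suc m"], simp) (rule exI[of _ "Suc (2 * Suc m)"], simp)
    then have inf: "infinite {n::nat. even n}" "infinite {n::nat. odd n}"
      unfolding infinite_nat_iff_unbounded by auto
    have Zinf: "infinite Z1" "infinite Z2" unfolding Z1_def Z2_def
      using inf finite_imageD[OF _ inj_on_subset[OF f(1)]] by auto
    have disj: "Z1 \<inter> Z2 = {}" using f(1) by (auto simp: Z1_def Z2_def inj_def)
    have sub: "Z1 \<subseteq> Z" "Z2 \<subseteq> Z" using f(2) by (auto simp: Z1_def Z2_def)
    define \<rho> where "\<rho> = r / 3"
    have \<rho>: "\<rho> > 0" using r by (simp add: \<rho>_def)
    obtain F where F: "C1_on UNIV F" "\<And>x. 0 \<le> F x \<and> F x \<le> 1"
      "\<And>x v. \<bar>frechet_derivative F (at x) v\<bar> \<le> 4 / \<rho> * norm v"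
      "\<And>x z. z \<in> Z1 \<Longrightarrow> norm (x - z) < \<rho> \<Longrightarrow> F x = hump z \<rho> x"
      "\<And>x. (\<And>z. z \<in> Z1 \<Longrightarrow> norm (x - z) \<ge> \<rho>) \<Longrightarrow> F x = 0"
      by (rule separated_humps[OF \<rho>, of Z1]) (use Zsep sub in \<open>auto simp: \<rho>_def\<close>)
    obtain l where l: "(\<lambda>n. F (X n)) \<longlonglongrightarrow> l" using conv[OF F(1-3)] by (auto simp: convergent_def)
    have F1: "F z = 1" if "z \<in> Z1" for z using F(4)[OF that, of z] \<rho> by (simp add: hump_center)
    have F2: "F z = 0" if "z \<in> Z2" for z
    proof (rule F(5))
      fix y assume "y \<in> Z1"
      then have "norm (z - y) \<ge> r" using that disj sub Zsep[of z y] by blast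
      then show "norm (z - y) \<ge> \<rho>" using r by (simp add: \<rho>_def)
    qed
    \<comment> \<open>Infinitely many distinct values cannot all be taken among the first
      \<open>m\<close> terms, so both families of points are visited arbitrarily late.\<close>
    have freq: "\<exists>n\<ge>m. F (X n) = c" if W: "infinite W" "W \<subseteq> Z" "\<And>z. z \<in> W \<Longrightarrow> F z = c" for W c m
    proof (rule ccontr)
      assume "\<not> (\<exists>n\<ge>m. F (X n) = c)"
      then have "W \<subseteq> X ` {..<m}" using W(2,3) ZX by (force simp: not_le[symmetric])
      then show False using W(1) finite_surj by blast
    qed
    have "\<forall>\<^sub>F n in sequentially. dist (F (X n)) l < 1/2" using l by (rule tendstoD) simp
    then obtain m where m: "\<And>n. n \<ge> m \<Longrightarrow> dist (F (X n)) l < 1/2" unfolding eventually_sequentially by blast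
    obtain n1 n2 where "n1 \<ge> m" "F (X n1) = 1" "n2 \<ge> m" "F (X n2) = 0"
      using freq[OF Zinf(1) sub(1) F1] freq[OF Zinf(2) sub(2) F2] by metis
    then show False using m[of n1] m[of n2] by (auto simp: dist_real_def)
  qed
  show ?thesis
  proof (rule metric_CauchyI)
    fix e :: real assume e: "e > 0"
    define r where "r = e / 4"
    have r: "r > 0" using e by (simp add: r_def)
    obtain Z where Z: "finite Z" "range X \<subseteq> (\<Union>z\<in>Z. ball z r)" using cover[OF r] by blast
    have "UNIV = (\<Union>z\<in>Z. {n. X n \<in> ball z r})" using Z(2) by blast
    \<comment> \<open>By the pigeonhole principle some ball is visited infinitely often. A hump of
      radius \<open>2 * r\<close> around its centre is at least \<open>1/2\<close> at those visits,
      so its limit along \<open>X\<close> exceeds \<open>1/4\<close>, and late terms cannot lie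
      outside the support. Thus one ball contains the whole tail.\<close>
    then have "\<exists>z\<in>Z. infinite {n. X n \<in> ball z r}" using Z(1) by (metis (lifting) finite_UN infinite_UNIV_nat)
    then obtain z where z: "infinite {n. X n \<in> ball z r}" by blast
    have r2: "2 * r > 0" using r by simp
    have "convergent (\<lambda>n. hump z (2 * r) (X n))"
      by (rule conv[OF hump_derivative(1)[OF r2] hump_bounds[OF r2] hump_derivative(2)[OF r2]])
    then obtain l where l: "(\<lambda>n. hump z (2 * r) (X n)) \<longlonglongrightarrow> l" by (auto simp: convergent_def)
    then have "\<forall>\<^sub>F n in sequentially. dist (hump z (2 * r) (X n)) l < 1/4" by (rule tendstoD) simp
    then obtain m where m: "\<And>n. n \<ge> m \<Longrightarrow> dist (hump z (2 * r) (X n)) l < 1/4" unfolding eventually_sequentially by blast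
    obtain k where k: "k \<ge> m" "X k \<in> ball z r" using z unfolding infinite_nat_iff_unbounded_le by blast
    have "hump z (2 * r) (X k) \<ge> 1/2"
      using k(2) r by (intro hump_near) (auto simp: dist_norm norm_minus_commute)
    then have l2: "l > 1/4" using m[OF k(1)] unfolding dist_real_def by linarith
    have near: "dist (X n) z < 2 * r" if "n \<ge> m" for n
    proof (rule ccontr)
      assume "\<not> dist (X n) z < 2 * r"
      then have "hump z (2 * r) (X n) = 0" using r by (intro hump_far) (auto simp: dist_norm)
      then show False using m[OF that] l2 by (auto simp: dist_real_def)
    qed
    have "dist (X i) (X j) < e" if "i \<ge> m" "j \<ge> m" for i j
      using near[OF that(1)] near[OF that(2)] dist_triangle2[of "X i" "X j" z] by (simp add: r_def)
    then show "\<exists>M. \<forall>m\<ge>M. \<forall>n\<ge>M. dist (X m) (X n) < e" by blast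
  qed
qed

section \<open>Charts, tangent spaces and the metric in coordinates\<close>

abbreviation coord_deriv :: "('p, 'h::real_normed_vector) chart \<Rightarrow> ('p \<Rightarrow> 'b::real_normed_vector) \<Rightarrow> 'p \<Rightarrow> 'h \<Rightarrow> 'b" where
  "coord_deriv c f p \<equiv> frechet_derivative (f \<circ> inv_chart c) (at (map_chart c p))"

abbreviation chart_norm :: "('p, 'h::real_normed_vector) manifold \<Rightarrow> 'p \<Rightarrow> ('p, 'h) chart \<Rightarrow> 'h \<Rightarrow> real" where
  "chart_norm M p c v \<equiv> norm_at M p (tangent_vec M p c v)"

abbreviation coords :: "('p, 'h) chart \<Rightarrow> 'h set" where
  "coords c \<equiv> map_chart c ` dom_chart c"

text \<open>Points outside \<open>U\<close> get neighbourhoods separated from \<open>p\<close>;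
  these and \<open>U\<close> form a cover. In a locally finite refinement closure commutes with
  union, so the closure of the union of all members not inside \<open>U\<close> still misses
  \<open>p\<close>, and its complement is the required neighbourhood.\<close>

lemma paracompact_t2_regular:
  fixes U :: "'p::t2_space set"
  assumes pc: "paracompact_type TYPE('p)" and U: "open U" "p \<in> U"
  obtains V where "open V" "p \<in> V" "closure V \<subseteq> U"
proof -
  have "\<forall>x\<in>-U. \<exists>W W'. open W \<and> open W' \<and> x \<in> W \<and> p \<in> W' \<and> W \<inter> W' = {}"
    using U(2) hausdorff by (metis ComplD)
  then obtain W where W: "\<And>x. x \<in> -U \<Longrightarrow> open (W x) \<and> x \<in> W x \<and> (\<exists>W'. open W' \<and> p \<in> W' \<and> W x \<inter> W' = {})"
    by metis
  define \<U> where "\<U> = insert U (W ` (-U))"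
  have "(\<forall>U\<in>\<U>. open U) \<and> \<Union>\<U> = UNIV" using U W by (auto simp: \<U>_def)
  then obtain \<V> where \<V>: "\<forall>V\<in>\<V>. open V" "\<Union>\<V> = UNIV" "\<forall>V\<in>\<V>. \<exists>U\<in>\<U>. V \<subseteq> U" "locally_finite_in euclidean \<V>"
    using pc unfolding paracompact_type_def by metis
  define \<W> where "\<W> = {V\<in>\<V>. \<not> V \<subseteq> U}"
  have lf: "locally_finite_in euclidean \<W>"
    by (rule locally_finite_in_subset[OF \<V>(4)]) (auto simp: \<W>_def)
  have cl: "closure (\<Union>\<W>) = \<Union>(closure ` \<W>)"
    using closure_of_locally_finite_Union[OF lf] by (simp only: euclidean_closure_of)
  have "p \<notin> closure V" if V: "V \<in> \<W>" for V
  proof -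
    obtain x where x: "x \<in> -U" "V \<subseteq> W x" using V \<V>(3) by (auto simp: \<W>_def \<U>_def)
    obtain W' where W': "open W'" "p \<in> W'" "W x \<inter> W' = {}" using W[OF x(1)] by blast
    have "closure V \<subseteq> - W'" using W' x(2) by (intro closure_minimal) auto
    then show ?thesis using W'(2) by blast
  qed
  then have p: "p \<notin> closure (\<Union>\<W>)" unfolding cl by blast
  have "-U \<subseteq> \<Union>\<W>"
  proof
    fix x assume x: "x \<in> -U"
    have "x \<in> \<Union>\<V>" using \<V>(2) by simp
    then obtain V where V: "V \<in> \<V>" "x \<in> V" by (rule UnionE)
    then have "V \<in> \<W>" using x by (auto simp: \<W>_def)
    then show "x \<in> \<Union>\<W>" using V(2) by (rule UnionI)
  qed
  moreover have "open (\<Union>\<W>)" using \<V>(1) by (auto simp: \<W>_def)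
  ultimately have "closure (- closure (\<Union>\<W>)) \<subseteq> - \<Union>\<W>"
    using closure_subset[of "\<Union>\<W>"] by (intro closure_minimal) (auto simp: closed_Compl)
  then have "closure (- closure (\<Union>\<W>)) \<subseteq> U" using \<open>-U \<subseteq> \<Union>\<W>\<close> by blast
  then show ?thesis using that[of "- closure (\<Union>\<W>)"] p by (simp add: open_Compl)
qed

locale riem_manifold =
  fixes M :: "('p::t2_space, 'h::{real_inner, complete_space}) manifold"
  assumes riem: "riemannian_manifold M"
begin

lemma smooth: "smooth_atlas (atlas M)" and rmetric: "riemannian_metric M" and paracompact: "paracompact_type TYPE('p)"
  using riem by (auto simp: riemannian_manifold_def)

lemma charts_atD: "c \<in> charts_at M p \<Longrightarrow> c \<in> atlas M \<and> p \<in> dom_chart c"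
  by (simp add: charts_at_def)

lemma charts_atI: "c \<in> atlas M \<Longrightarrow> p \<in> dom_chart c \<Longrightarrow> c \<in> charts_at M p"
  by (simp add: charts_at_def)

lemma chart_exists: obtains c where "c \<in> charts_at M p"
  using smooth unfolding smooth_atlas_def charts_at_def by blast

lemma
  assumes "c \<in> atlas M"
  shows open_dom: "open (dom_chart c)" and open_coords: "open (coords c)"
    and chart_homeo: "homeomorphism (dom_chart c) (coords c) (map_chart c) (inv_chart c)"
  using assms smooth unfolding smooth_atlas_def is_chart_def by blast+

lemma inv_chart_map [simp]: "c \<in> atlas M \<Longrightarrow> p \<in> dom_chart c \<Longrightarrow> inv_chart c (map_chart c p) = p"
  using chart_homeo homeomorphism_apply1 by metis

lemma map_inv_chart [simp]: "c \<in> atlas M \<Longrightarrow> x \<in> coords c \<Longrightarrow> map_chart c (inv_chart c x) = x"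
  using chart_homeo homeomorphism_apply2 by metis

lemma inv_chart_in [simp]: "c \<in> atlas M \<Longrightarrow> x \<in> coords c \<Longrightarrow> inv_chart c x \<in> dom_chart c"
  using chart_homeo homeomorphism_image2 by fastforce

lemma continuous_on_map_chart: "c \<in> atlas M \<Longrightarrow> continuous_on (dom_chart c) (map_chart c)"
  using chart_homeo homeomorphism_cont1 by blast

lemma continuous_on_inv_chart: "c \<in> atlas M \<Longrightarrow> continuous_on (coords c) (inv_chart c)"
  using chart_homeo homeomorphism_cont2 by blast

lemma inv_chart_image: "c \<in> atlas M \<Longrightarrow> W \<subseteq> dom_chart c \<Longrightarrow> map_chart c ` W = coords c \<inter> inv_chart c -` W"
  by (auto simp: image_iff)

lemma open_map_chart_image:
  assumes "c \<in> atlas M" "open W" "W \<subseteq> dom_chart c"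
  shows "open (map_chart c ` W)"
  unfolding inv_chart_image[OF assms(1,3)]
  by (rule continuous_open_preimage[OF continuous_on_inv_chart open_coords]) (use assms in auto)

lemma open_inv_chart_image:
  assumes "c \<in> atlas M" "open W" "W \<subseteq> coords c"
  shows "open (inv_chart c ` W)"
proof -
  have "inv_chart c ` W = dom_chart c \<inter> map_chart c -` W"
    using assms(1,3) by (auto simp: image_iff) (metis inv_chart_map)+
  then show ?thesis
    using continuous_open_preimage[OF continuous_on_map_chart open_dom] assms by metis
qed

lemma C1_transition:
  assumes "c \<in> atlas M" "d \<in> atlas M"
  shows "C1_on (map_chart c ` (dom_chart c \<inter> dom_chart d)) (map_chart d \<circ> inv_chart c)"
    and "open (map_chart c ` (dom_chart c \<inter> dom_chart d))"
proof -
  show o: "open (map_chart c ` (dom_chart c \<inter> dom_chart d))"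
    by (intro open_map_chart_image open_Int open_dom assms) auto
  show "C1_on (map_chart c ` (dom_chart c \<inter> dom_chart d)) (map_chart d \<circ> inv_chart c)"
    using assms smooth o unfolding smooth_atlas_def by (intro smooth_on_imp_C1_on) auto
qed

lemma transition_has_derivative:
  assumes "c \<in> charts_at M p" "d \<in> charts_at M p"
  shows "(map_chart d \<circ> inv_chart c has_derivative coord_deriv c (map_chart d) p) (at (map_chart c p))"
  using assms C1_on_has_derivative[OF C1_transition(1)] by (auto simp: charts_at_def)

lemma coord_deriv_change:
  assumes c: "c \<in> charts_at M p" and d: "d \<in> charts_at M p"
    and f: "(f \<circ> inv_chart d has_derivative D) (at (map_chart d p))"
  shows "(f \<circ> inv_chart c has_derivative D \<circ> coord_deriv c (map_chart d) p) (at (map_chart c p))"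
proof -
  have p: "(map_chart d \<circ> inv_chart c) (map_chart c p) = map_chart d p"
    using c by (simp add: charts_at_def)
  have "(f \<circ> inv_chart d \<circ> (map_chart d \<circ> inv_chart c) has_derivative D \<circ> coord_deriv c (map_chart d) p) (at (map_chart c p))"
    by (rule diff_chain_at[OF transition_has_derivative[OF c d]]) (use f p in metis)
  then show ?thesis
    by (rule has_derivative_transform_within_open[OF _ C1_transition(2), of _ _ _ _ c d])
       (use c d in \<open>auto simp: charts_at_def\<close>)
qed

lemma coord_deriv_chain:
  assumes "c \<in> charts_at M p" "d \<in> charts_at M p"
    and "(f \<circ> inv_chart d has_derivative D) (at (map_chart d p))"
  shows "coord_deriv c f p v = D (coord_deriv c (map_chart d) p v)"
  using frechet_derivative_at[OF coord_deriv_change[OF assms]] by (metis comp_apply)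

lemma transition_id:
  assumes "c \<in> charts_at M p"
  shows "coord_deriv c (map_chart c) p = id"
proof -
  have "(id has_derivative id) (at (map_chart c p))" by (simp add: id_def)
  then have "(map_chart c \<circ> inv_chart c has_derivative id) (at (map_chart c p))"
    by (rule has_derivative_transform_within_open[OF _ open_coords, of _ _ _ _ c])
       (use assms in \<open>auto simp: charts_at_def\<close>)
  then show ?thesis using frechet_derivative_at by metis
qed

lemma transition_comp:
  assumes "c \<in> charts_at M p" "d \<in> charts_at M p" "e \<in> charts_at M p"
  shows "coord_deriv d (map_chart e) p (coord_deriv c (map_chart d) p v) = coord_deriv c (map_chart e) p v"
  using coord_deriv_chain[OF assms(1,2) transition_has_derivative[OF assms(2,3)]] by simp

lemma tangent_vec_eq:
  assumes "c \<in> charts_at M p"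
  shows "tangent_vec M p c v = {(d, w). d \<in> charts_at M p \<and> w = coord_deriv c (map_chart d) p v}"
  using assms by (auto simp: tangent_vec_def tangent_rel_def)

lemma tangent_vec_change:
  assumes "c \<in> charts_at M p" "d \<in> charts_at M p"
  shows "tangent_vec M p d (coord_deriv c (map_chart d) p v) = tangent_vec M p c v"
  unfolding tangent_vec_eq[OF assms(1)] tangent_vec_eq[OF assms(2)]
  by (rule set_eqI) (simp add: case_prod_beta transition_comp[OF assms] cong: conj_cong)

lemma tangent_space_eq:
  assumes c: "c \<in> charts_at M p"
  shows "tangent_space M p = range (tangent_vec M p c)"
proof
  show "tangent_space M p \<subseteq> range (tangent_vec M p c)"
  proof
    fix X assume "X \<in> tangent_space M p"
    then obtain d v where d: "d \<in> charts_at M p" and X: "X = tangent_vec M p d v"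
      by (auto simp: tangent_space_def quotient_def tangent_vec_def)
    then show "X \<in> range (tangent_vec M p c)" using tangent_vec_change[OF d c] by blast
  qed
  show "range (tangent_vec M p c) \<subseteq> tangent_space M p"
    using c by (auto simp: tangent_space_def quotient_def tangent_vec_def)
qed

definition gram :: "('p, 'h) chart \<Rightarrow> 'h \<Rightarrow> 'h \<Rightarrow>\<^sub>L 'h \<Rightarrow>\<^sub>L real" where
  "gram c = (SOME G :: 'h \<Rightarrow> 'h \<Rightarrow>\<^sub>L 'h \<Rightarrow>\<^sub>L real. smooth_on (coords c) G \<and>
     (\<forall>p\<in>dom_chart c. \<forall>v w. metric M p (tangent_vec M p c v) (tangent_vec M p c w) = blinfun_apply (blinfun_apply (G (map_chart c p)) v) w))"

lemma gram:
  assumes "c \<in> atlas M"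
  shows "smooth_on (coords c) (gram c)"
    and "p \<in> dom_chart c \<Longrightarrow> metric M p (tangent_vec M p c v) (tangent_vec M p c w) = gram c (map_chart c p) v w"
proof -
  have "\<exists>G :: 'h \<Rightarrow> 'h \<Rightarrow>\<^sub>L 'h \<Rightarrow>\<^sub>L real. smooth_on (coords c) G \<and>
     (\<forall>p\<in>dom_chart c. \<forall>v w. metric M p (tangent_vec M p c v) (tangent_vec M p c w) = blinfun_apply (blinfun_apply (G (map_chart c p)) v) w)"
    by (rule conjunct1[OF bspec[OF rmetric[unfolded riemannian_metric_def] assms]])
  from someI_ex[OF this, folded gram_def]
  show "smooth_on (coords c) (gram c)"
    and "p \<in> dom_chart c \<Longrightarrow> metric M p (tangent_vec M p c v) (tangent_vec M p c w) = gram c (map_chart c p) v w"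
    by blast+
qed

lemma C1_gram: "c \<in> atlas M \<Longrightarrow> C1_on (coords c) (gram c)"
  using gram(1) smooth_on_imp_C1_on open_coords by blast

lemma chart_norm_gram: "c \<in> charts_at M p \<Longrightarrow> chart_norm M p c v = sqrt (gram c (map_chart c p) v v)"
  by (simp add: norm_at_def gram(2) charts_at_def)

lemma chart_norm_bounds:
  assumes "c \<in> charts_at M p"
  obtains a b where "a > 0" "b > 0" "\<And>v. a * norm v \<le> chart_norm M p c v" "\<And>v. chart_norm M p c v \<le> b * norm v"
proof -
  have "c \<in> atlas M" "p \<in> dom_chart c" using assms by (auto simp: charts_at_def)
  note conjunct2[OF conjunct2[OF bspec[OF rmetric[unfolded riemannian_metric_def] this(1)]], THEN bspec, OF this(2)]
  then show ?thesis using that by blast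
qed

lemma chart_norm_change:
  assumes "c \<in> charts_at M p" "d \<in> charts_at M p"
  shows "chart_norm M p d (coord_deriv c (map_chart d) p v) = chart_norm M p c v"
  by (simp add: tangent_vec_change[OF assms])

end

text \<open>A pointwise form of a bound on the differential, in which no supremum over a possibly
  unbounded set occurs.\<close>

definition dbound :: "('p, 'h::real_normed_vector) manifold \<Rightarrow> ('p \<Rightarrow> real) \<Rightarrow> real \<Rightarrow> bool" where
  "dbound M f B \<longleftrightarrow> (\<forall>p. \<forall>c\<in>charts_at M p. \<forall>v. \<bar>coord_deriv c f p v\<bar> \<le> B * chart_norm M p c v)"

lemma dboundD: "dbound M f B \<Longrightarrow> c \<in> charts_at M p \<Longrightarrow> \<bar>coord_deriv c f p v\<bar> \<le> B * chart_norm M p c v"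
  by (simp add: dbound_def)

context riem_manifold
begin

section \<open>The metric norm in coordinates and its variation with the base point\<close>

definition cnorm :: "('p, 'h) chart \<Rightarrow> 'h \<Rightarrow> 'h \<Rightarrow> real" where
  "cnorm c x v = sqrt (gram c x v v)"

lemma chart_norm_cnorm: "c \<in> charts_at M p \<Longrightarrow> chart_norm M p c v = cnorm c (map_chart c p) v"
  by (simp add: cnorm_def chart_norm_gram)

lemma cnorm_chart_norm: "c \<in> atlas M \<Longrightarrow> x \<in> coords c \<Longrightarrow> cnorm c x v = chart_norm M (inv_chart c x) c v"
  by (simp add: chart_norm_cnorm charts_atI)

lemma inner_form_gram:
  assumes "c \<in> atlas M" "x \<in> coords c"
  shows "inner_form (gram c x)"
proof
  define p where "p = inv_chart c x"
  have p: "c \<in> charts_at M p" "map_chart c p = x" "p \<in> dom_chart c" using assms by (auto simp: p_def charts_at_def)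
  have "metric M p (tangent_vec M p c v) (tangent_vec M p c w) = metric M p (tangent_vec M p c w) (tangent_vec M p c v)" for v w
    using conjunct1[OF conjunct2[OF bspec[OF rmetric[unfolded riemannian_metric_def] assms(1)]], THEN bspec, OF p(3)] by blast
  then show "gram c x v w = gram c x w v" for v w using gram(2)[OF assms(1) p(3)] p(2) by simp
  obtain a where a: "a > 0" "\<And>v. a * norm v \<le> chart_norm M p c v" using chart_norm_bounds[OF p(1)] by metis
  have "0 \<le> sqrt (gram c x v v)" for v
    using a(2)[of v] a(1) chart_norm_gram[OF p(1)] p(2) by (smt (verit) mult_nonneg_nonneg norm_ge_zero)
  then show "gram c x v v \<ge> 0" for v by simp
qed

lemma cnorm_nrm: "c \<in> atlas M \<Longrightarrow> x \<in> coords c \<Longrightarrow> cnorm c x v = inner_form.nrm (gram c x) v"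
  by (simp add: cnorm_def inner_form.nrm_def[OF inner_form_gram])

lemma chart_norm_nonneg: "c \<in> charts_at M p \<Longrightarrow> 0 \<le> chart_norm M p c v"
  using inner_form.nonneg[OF inner_form_gram] by (auto simp: chart_norm_gram charts_at_def)

lemma chart_norm_scale: "c \<in> charts_at M p \<Longrightarrow> chart_norm M p c (t *\<^sub>R v) = \<bar>t\<bar> * chart_norm M p c v"
  using inner_form.nrm_scale[OF inner_form_gram] by (auto simp: chart_norm_cnorm cnorm_nrm charts_at_def)

text \<open>Coordinate balls need not be compact, so Hausdorffness alone does not make them closed in the
  manifold; this is where paracompactness enters.\<close>

lemma closed_chart_ball:
  assumes c: "c \<in> charts_at M p"
  obtains R where "R > 0" "cball (map_chart c p) R \<subseteq> coords c"
    "\<And>K. closed K \<Longrightarrow> K \<subseteq> cball (map_chart c p) R \<Longrightarrow> closed (inv_chart c ` K)"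
proof -
  have c': "c \<in> atlas M" "p \<in> dom_chart c" using c by (auto simp: charts_at_def)
  obtain V where V: "open V" "p \<in> V" "closure V \<subseteq> dom_chart c"
    using paracompact_t2_regular[OF paracompact open_dom[OF c'(1)] c'(2)] by blast
  have VU: "V \<subseteq> dom_chart c" using V closure_subset by blast
  have "open (map_chart c ` V)" by (rule open_map_chart_image[OF c'(1) V(1) VU])
  then obtain R where R: "R > 0" "cball (map_chart c p) R \<subseteq> map_chart c ` V"
    using V(2) by (meson imageI open_contains_cball)
  have sub: "map_chart c ` V \<subseteq> coords c" using VU by blast
  show ?thesis
  proof (rule that[OF R(1)])
    show "cball (map_chart c p) R \<subseteq> coords c" using R sub by blast
    fix K assume K: "closed K" "K \<subseteq> cball (map_chart c p) R"
    have KV: "inv_chart c ` K \<subseteq> V" using K(2) R(2) c'(1) VU by (auto simp: subset_iff)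
    \<comment> \<open>The closure of \<open>V\<close> lies in the chart domain, so the chart map is
      continuous on it and the image of \<open>K\<close> is relatively closed in a closed
      set.\<close>
    have "inv_chart c ` K = closure V \<inter> map_chart c -` K"
    proof
      show "inv_chart c ` K \<subseteq> closure V \<inter> map_chart c -` K"
        using KV closure_subset K(2) R(2) sub c'(1) by (auto simp: subset_iff)
      show "closure V \<inter> map_chart c -` K \<subseteq> inv_chart c ` K"
        using V(3) c'(1) by (auto simp: subset_iff image_iff) (metis inv_chart_map)
    qed
    moreover have "closed (closure V \<inter> map_chart c -` K)"
      by (rule continuous_closed_preimage[OF continuous_on_subset[OF continuous_on_map_chart[OF c'(1)] V(3)] closed_closure K(1)])
    ultimately show "closed (inv_chart c ` K)" by simp
  qed
qed

text \<open>The Gram map is Lipschitz near \<open>x0\<close>, so squared norms at two base points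
  differ by at most \<open>L * norm (x - y) * (norm v)^2\<close>. The displacement
  \<open>x - y\<close> is then measured in the metric as well, which is the form that matches the
  slope of \<open>cone\<close>.\<close>

lemma nice_ball:
  assumes c: "c \<in> charts_at M p"
  obtains R a b C where "R > 0" "a > 0" "b > 0" "C > 0" "cball (map_chart c p) R \<subseteq> coords c"
    "\<And>K. closed K \<Longrightarrow> K \<subseteq> cball (map_chart c p) R \<Longrightarrow> closed (inv_chart c ` K)"
    "\<And>x v. x \<in> cball (map_chart c p) R \<Longrightarrow> a * norm v \<le> cnorm c x v \<and> cnorm c x v \<le> b * norm v"
    "\<And>x y v. x \<in> cball (map_chart c p) R \<Longrightarrow> y \<in> cball (map_chart c p) R \<Longrightarrow>
       cnorm c x v \<le> (1 + C * cnorm c y (x - y)) * cnorm c y v \<and>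
       cnorm c y v \<le> (1 + C * cnorm c y (x - y)) * cnorm c x v"
proof -
  have c': "c \<in> atlas M" "p \<in> dom_chart c" using c by (auto simp: charts_at_def)
  define x0 where "x0 = map_chart c p"
  have x0: "x0 \<in> coords c" using c' by (simp add: x0_def)
  obtain R0 where R0: "R0 > 0" "cball x0 R0 \<subseteq> coords c"
    "\<And>K. closed K \<Longrightarrow> K \<subseteq> cball x0 R0 \<Longrightarrow> closed (inv_chart c ` K)"
    using closed_chart_ball[OF c] unfolding x0_def by blast
  obtain a0 b0 where ab: "a0 > 0" "b0 > 0" "\<And>v. a0 * norm v \<le> cnorm c x0 v" "\<And>v. cnorm c x0 v \<le> b0 * norm v"
    using chart_norm_bounds[OF c] unfolding chart_norm_cnorm[OF c] x0_def by metis
  obtain r L where L: "r > 0" "L > 0" "ball x0 r \<subseteq> coords c"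
    "\<And>y z. y \<in> ball x0 r \<Longrightarrow> z \<in> ball x0 r \<Longrightarrow> norm (gram c y - gram c z) \<le> L * norm (y - z)"
    using C1_on_locally_lipschitz[OF C1_gram[OF c'(1)] open_coords[OF c'(1)] x0] by blast
  \<comment> \<open>The last entry bounds the change of the squared norm by
    \<open>3/4 * a0^2 * (norm v)^2\<close>, leaving a quarter of the squared lower bound at the
    centre, that is the lower constant \<open>a0 / 2\<close>. Halving \<open>r\<close> places the
    closed ball in the open Lipschitz ball.\<close>
  define R where "R = Min {R0, r / 2, 3 * a0\<^sup>2 / (4 * L)}"
  have R: "R > 0" "R \<le> R0" "R < r" "L * R \<le> 3/4 * a0\<^sup>2"
  proof -
    show "R > 0" "R \<le> R0" using R0 L ab by (auto simp: R_def)
    have "R \<le> r / 2" by (simp add: R_def)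
    then show "R < r" using L by simp
    have "R \<le> 3 * a0\<^sup>2 / (4 * L)" by (simp add: R_def)
    then show "L * R \<le> 3/4 * a0\<^sup>2" using L by (simp add: field_simps)
  qed
  have inr: "x \<in> ball x0 r" "x \<in> coords c" if "x \<in> cball x0 R" for x using that R R0(2) by auto
  have gl: "gram c x v v \<le> gram c y v v + L * norm (x - y) * (norm v)\<^sup>2" if "x \<in> cball x0 R" "y \<in> cball x0 R" for x y v
  proof -
    have "gram c x v v - gram c y v v = (gram c x - gram c y) v v" by (simp add: blinfun.diff_left)
    also have "\<dots> \<le> norm ((gram c x - gram c y) v) * norm v" using norm_blinfun[of "(gram c x - gram c y) v" v] by simp
    also have "\<dots> \<le> (norm (gram c x - gram c y) * norm v) * norm v" by (intro mult_right_mono norm_blinfun) auto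
    also have "\<dots> \<le> (L * norm (x - y) * norm v) * norm v"
      by (intro mult_right_mono L(4) inr that) auto
    finally show ?thesis by (simp add: power2_eq_square)
  qed
  have sq: "gram c x v v = (cnorm c x v)\<^sup>2" if "x \<in> coords c" for x v
    using inner_form.nonneg[OF inner_form_gram[OF c'(1) that]] by (simp add: cnorm_def)
  have cn0: "0 \<le> cnorm c x v" if "x \<in> coords c" for x v
    using inner_form.nonneg[OF inner_form_gram[OF c'(1) that]] by (simp add: cnorm_def)
  define a b where "a = a0 / 2" and "b = b0 + a0"
  have x0R: "x0 \<in> cball x0 R" using R by simp
  have lR: "L * norm (x - y) * (norm v)\<^sup>2 \<le> 3/4 * a0\<^sup>2 * (norm v)\<^sup>2" if "norm (x - y) \<le> R" for x y v :: 'h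
  proof (rule mult_right_mono)
    show "L * norm (x - y) \<le> 3/4 * a0\<^sup>2" using mult_left_mono[OF that, of L] L R by linarith
  qed simp
  have lo: "a * norm v \<le> cnorm c x v" if x: "x \<in> cball x0 R" for x v
  proof (rule power2_le_imp_le[OF _ cn0[OF inr(2)[OF x]]])
    have "(a0 * norm v)\<^sup>2 \<le> (cnorm c x0 v)\<^sup>2" using ab by (intro power_mono) auto
    also have "\<dots> \<le> (cnorm c x v)\<^sup>2 + 3/4 * a0\<^sup>2 * (norm v)\<^sup>2"
      using gl[OF x0R x, of v] lR[of x0 x v] x sq[OF x0] sq[OF inr(2)[OF x]] by (simp add: dist_norm)
    finally show "(a * norm v)\<^sup>2 \<le> (cnorm c x v)\<^sup>2" by (simp add: a_def power_mult_distrib power_divide)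
  qed
  have hi: "cnorm c x v \<le> b * norm v" if x: "x \<in> cball x0 R" for x v
  proof (rule power2_le_imp_le)
    have "(cnorm c x v)\<^sup>2 \<le> (cnorm c x0 v)\<^sup>2 + 3/4 * a0\<^sup>2 * (norm v)\<^sup>2"
      using gl[OF x x0R, of v] lR[of x x0 v] x sq[OF x0] sq[OF inr(2)[OF x]] by (simp add: dist_norm norm_minus_commute)
    also have "(cnorm c x0 v)\<^sup>2 \<le> (b0 * norm v)\<^sup>2" using ab cn0[OF x0] by (intro power_mono) auto
    finally have "(cnorm c x v)\<^sup>2 \<le> (b0\<^sup>2 + 3/4 * a0\<^sup>2) * (norm v)\<^sup>2" by (simp add: algebra_simps power_mult_distrib)
    also have "\<dots> \<le> b\<^sup>2 * (norm v)\<^sup>2" using ab by (intro mult_right_mono) (auto simp: b_def power2_sum)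
    finally show "(cnorm c x v)\<^sup>2 \<le> (b * norm v)\<^sup>2" by (simp add: power_mult_distrib)
    show "0 \<le> b * norm v" using ab by (simp add: b_def)
  qed
  \<comment> \<open>Three factors \<open>a\<close> convert the Hilbert norms in
    \<open>L * norm (x - y) * (norm v)^2\<close> into metric norms. The estimate is for squares;
    since \<open>1 + C * t \<ge> 1\<close>, it may be weakened to \<open>(1 + C * t)^2\<close>,
    after which roots can be taken.\<close>
  define C where "C = L / a ^ 3"
  have apos: "a > 0" using ab by (simp add: a_def)
  have Cpos: "C > 0" using apos L by (simp add: C_def)
  have key: "s \<le> (1 + C * t) * u"
    if "s\<^sup>2 \<le> u\<^sup>2 + L * n * m\<^sup>2" "a * n \<le> t" "a * m \<le> u" "0 \<le> n" "0 \<le> m" for s u t n m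
  proof (rule power2_le_imp_le)
    have u0: "0 \<le> u" and t0: "0 \<le> t" using that apos by (smt (verit) mult_nonneg_nonneg)+
    have "(a * m)\<^sup>2 \<le> u\<^sup>2" using that apos by (intro power_mono) auto
    then have "(a * n) * (a * m)\<^sup>2 \<le> t * u\<^sup>2" using that apos t0 by (intro mult_mono) auto
    then have "C * ((a * n) * (a * m)\<^sup>2) \<le> C * (t * u\<^sup>2)" using Cpos by (intro mult_left_mono) auto
    moreover have "C * ((a * n) * (a * m)\<^sup>2) = (C * a ^ 3) * n * m\<^sup>2"
      by (simp add: power_mult_distrib power2_eq_square power3_eq_cube)
    moreover have "C * a ^ 3 = L" using apos by (simp add: C_def)
    ultimately have "s\<^sup>2 \<le> u\<^sup>2 + C * (t * u\<^sup>2)" using that(1) by simp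
    then have "s\<^sup>2 \<le> (1 + C * t) * u\<^sup>2" by (simp add: algebra_simps)
    also have "\<dots> \<le> (1 + C * t)\<^sup>2 * u\<^sup>2"
      using Cpos t0 by (intro mult_right_mono) (auto intro!: self_le_power)
    finally show "s\<^sup>2 \<le> ((1 + C * t) * u)\<^sup>2" by (simp add: power_mult_distrib)
    show "0 \<le> (1 + C * t) * u" using u0 t0 Cpos by simp
  qed
  show ?thesis
  proof (rule that[of R a b C, folded x0_def])
    show "b > 0" using ab by (simp add: b_def)
    show "a * norm v \<le> cnorm c x v \<and> cnorm c x v \<le> b * norm v" if "x \<in> cball x0 R" for x v using lo hi that by blast
    show "cnorm c x v \<le> (1 + C * cnorm c y (x - y)) * cnorm c y v \<and>
       cnorm c y v \<le> (1 + C * cnorm c y (x - y)) * cnorm c x v" if x: "x \<in> cball x0 R" and y: "y \<in> cball x0 R" for x y v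
      using gl[OF x y, of v] gl[OF y x, of v] sq[OF inr(2)[OF x]] sq[OF inr(2)[OF y]]
      by (intro conjI key[of _ _ "norm (x - y)" "norm v"] lo x y) (auto simp: norm_minus_commute)
    show "closed (inv_chart c ` K)" if "closed K" "K \<subseteq> cball x0 R" for K
      using R0(3)[OF that(1)] that(2) R by (meson order_trans subset_cball)
  qed (use R R0 apos Cpos in auto)
qed

section \<open>Functions on the manifold and bounds on their differentials\<close>

lemma C1_funD: "C1_fun M f \<Longrightarrow> c \<in> atlas M \<Longrightarrow> C1_on (coords c) (f \<circ> inv_chart c)"
  by (simp add: C1_fun_def)

lemma C1_fun_has_derivative:
  "C1_fun M f \<Longrightarrow> c \<in> charts_at M p \<Longrightarrow> (f \<circ> inv_chart c has_derivative coord_deriv c f p) (at (map_chart c p))"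
  using C1_on_has_derivative[OF C1_funD] by (auto simp: charts_at_def)

lemma continuous_if_locally_continuous_in_charts:
  assumes "\<And>p. \<exists>c\<in>charts_at M p. isCont (f \<circ> inv_chart c) (map_chart c p)"
  shows "continuous_on UNIV f"
proof (intro continuous_at_imp_continuous_on ballI)
  fix p
  obtain c where c: "c \<in> charts_at M p" "isCont (f \<circ> inv_chart c) (map_chart c p)" using assms by blast
  have c': "c \<in> atlas M" "p \<in> dom_chart c" using c by (auto simp: charts_at_def)
  have "isCont (map_chart c) p"
    using continuous_on_map_chart[OF c'(1)] open_dom[OF c'(1)] c'(2) by (simp add: continuous_on_eq_continuous_at)
  then have "isCont ((f \<circ> inv_chart c) \<circ> map_chart c) p"
    unfolding o_def[of "f \<circ> inv_chart c"]
    using isCont_o2[where a=p and f="map_chart c" and g="f \<circ> inv_chart c"] c(2) by blast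
  moreover have "\<forall>\<^sub>F q in nhds p. ((f \<circ> inv_chart c) \<circ> map_chart c) q = f q"
    unfolding eventually_nhds using open_dom[OF c'(1)] c' by (intro exI[of _ "dom_chart c"]) auto
  ultimately show "isCont f p" using isCont_cong by blast
qed

lemma C1_fun_continuous: "C1_fun M f \<Longrightarrow> continuous_on UNIV f"
  by (rule continuous_if_locally_continuous_in_charts)
     (meson C1_fun_has_derivative has_derivative_continuous chart_exists)

text \<open>One chart around each point suffices, since transition maps are continuously
  differentiable.\<close>

lemma C1_fun_localI:
  assumes "\<And>p. \<exists>c\<in>charts_at M p. \<exists>W. open W \<and> map_chart c p \<in> W \<and> W \<subseteq> coords c \<and> C1_on W (f \<circ> inv_chart c)"
  shows "C1_fun M f"
  unfolding C1_fun_def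
proof (intro ballI C1_on_localI)
  fix d x assume d: "d \<in> atlas M" and x: "x \<in> coords d"
  define p where "p = inv_chart d x"
  obtain c W where c: "c \<in> charts_at M p" and W: "open W" "map_chart c p \<in> W" "W \<subseteq> coords c" "C1_on W (f \<circ> inv_chart c)"
    using assms by blast
  have c': "c \<in> atlas M" "p \<in> dom_chart c" using c by (auto simp: charts_at_def)
  define S where "S = map_chart d ` (dom_chart d \<inter> dom_chart c)"
  note tr = C1_transition[OF d c'(1), folded S_def]
  define S' where "S' = S \<inter> (map_chart c \<circ> inv_chart d) -` W"
  have pd: "p \<in> dom_chart d" "map_chart d p = x" using d x by (auto simp: p_def)
  have xS: "x \<in> S" using pd c' by (auto simp: S_def intro!: image_eqI[of _ _ p])
  have oS': "open S'" unfolding S'_def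
    using continuous_open_preimage[OF C1_on_imp_continuous_on[OF tr(1)] tr(2) W(1)] .
  have "C1_on S' ((f \<circ> inv_chart c) \<circ> (map_chart c \<circ> inv_chart d))"
    by (rule C1_on_compose[OF C1_on_subset[OF tr(1)] W(4)]) (auto simp: S'_def)
  moreover have "(f \<circ> inv_chart d) y = ((f \<circ> inv_chart c) \<circ> (map_chart c \<circ> inv_chart d)) y" if "y \<in> S'" for y
    using that d c' by (auto simp: S'_def S_def)
  ultimately show "\<exists>W g. open W \<and> x \<in> W \<and> C1_on W g \<and> (\<forall>y\<in>W. (f \<circ> inv_chart d) y = g y)"
    using oS' xS W(2) p_def
    by (intro exI[of _ S'] exI[of _ "(f \<circ> inv_chart c) \<circ> (map_chart c \<circ> inv_chart d)"] conjI ballI) (auto simp: S'_def)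
qed

lemma dbound_at_change:
  assumes f: "C1_fun M f" and c: "c \<in> charts_at M p" and d: "d \<in> charts_at M p"
    and b: "\<And>v. \<bar>coord_deriv c f p v\<bar> \<le> B * chart_norm M p c v"
  shows "\<bar>coord_deriv d f p v\<bar> \<le> B * chart_norm M p d v"
  using b[of "coord_deriv d (map_chart c) p v"] coord_deriv_chain[OF d c C1_fun_has_derivative[OF f c]]
    chart_norm_change[OF d c] by simp

lemma dboundI:
  assumes "C1_fun M f" "\<And>p. \<exists>c\<in>charts_at M p. \<forall>v. \<bar>coord_deriv c f p v\<bar> \<le> B * chart_norm M p c v"
  shows "dbound M f B"
  unfolding dbound_def using assms dbound_at_change by metis

text \<open>All representatives of a tangent vector give the same value by the chain rule, which is
  the uniqueness that \<open>THE\<close> asks for.\<close>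

lemma differential_tangent_vec:
  assumes f: "C1_fun M f" and c: "c \<in> charts_at M p"
  shows "differential M f p (tangent_vec M p c v) = coord_deriv c f p v"
  unfolding differential_def
proof (rule the_equality)
  have "(c, v) \<in> tangent_vec M p c v" using c by (simp add: tangent_vec_eq transition_id)
  then show "\<exists>(d, w)\<in>tangent_vec M p c v. coord_deriv c f p v = coord_deriv d f p w" by blast
next
  fix r assume "\<exists>(d, w)\<in>tangent_vec M p c v. r = coord_deriv d f p w"
  then obtain d w where dw: "(d, w) \<in> tangent_vec M p c v" "r = coord_deriv d f p w" by blast
  then have d: "d \<in> charts_at M p" and w: "w = coord_deriv c (map_chart d) p v" by (simp_all add: tangent_vec_eq[OF c])
  show "r = coord_deriv c f p v"
    unfolding dw(2) w by (rule coord_deriv_chain[OF c d C1_fun_has_derivative[OF f d], symmetric])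
qed

lemma differential_norm_eq:
  assumes f: "C1_fun M f" and c: "c \<in> charts_at M p"
  shows "differential_norm M f p = (SUP v \<in> {v. chart_norm M p c v \<le> 1}. \<bar>coord_deriv c f p v\<bar>)"
proof -
  have "{X \<in> tangent_space M p. norm_at M p X \<le> 1} = tangent_vec M p c ` {v. chart_norm M p c v \<le> 1}"
    unfolding tangent_space_eq[OF c] by auto
  then show ?thesis unfolding differential_norm_def by (simp add: image_image differential_tangent_vec[OF f c])
qed

lemma unit_vectors_ne: "c \<in> charts_at M p \<Longrightarrow> {v. chart_norm M p c v \<le> 1} \<noteq> {}"
  using chart_norm_scale[of c p 0] by (auto intro!: exI[of _ 0])

lemma differential_norm_le:
  assumes "C1_fun M f" "c \<in> charts_at M p" "B \<ge> 0" "\<And>v. \<bar>coord_deriv c f p v\<bar> \<le> B * chart_norm M p c v"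
  shows "differential_norm M f p \<le> B"
  unfolding differential_norm_eq[OF assms(1,2)]
proof (rule cSUP_least[OF unit_vectors_ne[OF assms(2)]])
  fix v assume "v \<in> {v. chart_norm M p c v \<le> 1}"
  then show "\<bar>coord_deriv c f p v\<bar> \<le> B" using assms(4)[of v] mult_left_mono[of "chart_norm M p c v" 1 B] assms(3) by simp
qed

text \<open>The real supremum bounds its elements only once the set is known to be bounded, which
  follows from boundedness of the derivative and the lower estimate for the chart norm. That
  estimate also covers vectors of length zero.\<close>

lemma le_differential_norm:
  assumes f: "C1_fun M f" and c: "c \<in> charts_at M p"
  shows "\<bar>coord_deriv c f p v\<bar> \<le> differential_norm M f p * chart_norm M p c v"
proof -
  have bl: "bounded_linear (coord_deriv c f p)" using C1_fun_has_derivative[OF f c] has_derivative_bounded_linear by blast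
  obtain K where K: "K > 0" "\<And>v. \<bar>coord_deriv c f p v\<bar> \<le> norm v * K" using bounded_linear.pos_bounded[OF bl] by auto
  obtain a b where ab: "a > 0" "b > 0" "\<And>v. a * norm v \<le> chart_norm M p c v" "\<And>v. chart_norm M p c v \<le> b * norm v"
    using chart_norm_bounds[OF c] by metis
  have bdd: "bdd_above ((\<lambda>v. \<bar>coord_deriv c f p v\<bar>) ` {v. chart_norm M p c v \<le> 1})"
  proof (rule bdd_aboveI2)
    fix v assume "v \<in> {v. chart_norm M p c v \<le> 1}"
    then have "a * norm v \<le> 1" using ab(3)[of v] by simp
    then have "norm v \<le> 1 / a" using ab by (simp add: field_simps)
    then show "\<bar>coord_deriv c f p v\<bar> \<le> (1 / a) * K" using K(2)[of v] mult_right_mono[of "norm v" "1/a" K] K(1) by linarith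
  qed
  define n where "n = chart_norm M p c v"
  show ?thesis
  proof (cases "n = 0")
    case True
    then have "v = 0" using ab(1) ab(3)[of v] by (simp add: n_def mult_le_0_iff)
    then show ?thesis using bl True by (simp add: linear_simps n_def)
  next
    case False
    then have n: "n > 0" using chart_norm_nonneg[OF c, of v] by (simp add: n_def)
    have "chart_norm M p c ((1/n) *\<^sub>R v) \<le> 1" using n chart_norm_scale[OF c] by (simp add: n_def)
    then have "\<bar>coord_deriv c f p ((1/n) *\<^sub>R v)\<bar> \<le> differential_norm M f p"
      unfolding differential_norm_eq[OF f c] by (intro cSUP_upper bdd) simp
    moreover have "coord_deriv c f p ((1/n) *\<^sub>R v) = (1/n) * coord_deriv c f p v"
      using bl by (simp add: linear_simps)
    ultimately show ?thesis using n by (simp add: abs_mult field_simps flip: n_def)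
  qed
qed

text \<open>The image of \<open>K\<close> is closed in the manifold, so its complement is open;
  there the extended function is constant. This open set and the chart domain cover the manifold,
  and on each of them the claim is clear.\<close>

lemma extension:
  assumes c: "c \<in> atlas M" and K: "closed K" "K \<subseteq> coords c" "closed (inv_chart c ` K)"
    and F: "C1_on (coords c) F" "\<And>x. x \<in> coords c - K \<Longrightarrow> F x = k"
  defines "f \<equiv> \<lambda>p. if p \<in> dom_chart c then F (map_chart c p) else k"
  shows "C1_fun M f"
    and "(\<And>x v. x \<in> K \<Longrightarrow> \<bar>frechet_derivative F (at x) v\<bar> \<le> B * cnorm c x v) \<Longrightarrow> B \<ge> 0 \<Longrightarrow> dbound M f B"
proof -
  define V where "V = - (inv_chart c ` K)"
  have V: "open V" using K(3) by (simp add: V_def open_Compl)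
  have fV: "f p = k" if "p \<in> V" for p
    using that c F(2)[of "map_chart c p"] by (auto simp: f_def V_def image_iff) (metis inv_chart_map)
  have fin: "(f \<circ> inv_chart c) x = F x" if "x \<in> coords c" for x using that c by (simp add: f_def)
  have C1c: "C1_on (coords c) (f \<circ> inv_chart c)"
    by (rule C1_on_cong[OF F(1) open_coords[OF c]]) (metis fin)
  have constV: "\<exists>W. open W \<and> map_chart d p \<in> W \<and> W \<subseteq> coords d \<and> (\<forall>x\<in>W. (f \<circ> inv_chart d) x = k)"
    if p: "p \<in> V" and d: "d \<in> charts_at M p" for p d
  proof -
    have d': "d \<in> atlas M" "p \<in> dom_chart d" using d by (auto simp: charts_at_def)
    have "open (map_chart d ` (dom_chart d \<inter> V))" by (intro open_map_chart_image d' open_Int open_dom V) auto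
    moreover have "(f \<circ> inv_chart d) x = k" if "x \<in> map_chart d ` (dom_chart d \<inter> V)" for x
      using that d'(1) fV by auto
    ultimately show ?thesis using p d' by (intro exI[of _ "map_chart d ` (dom_chart d \<inter> V)"]) auto
  qed
  have VU: "p \<in> V" if "p \<notin> dom_chart c" for p using that K(2) c by (auto simp: V_def)
  show C1: "C1_fun M f"
  proof (rule C1_fun_localI)
    fix p
    show "\<exists>c\<in>charts_at M p. \<exists>W. open W \<and> map_chart c p \<in> W \<and> W \<subseteq> coords c \<and> C1_on W (f \<circ> inv_chart c)"
    proof (cases "p \<in> dom_chart c")
      case True
      then show ?thesis using c C1c open_coords[OF c] by (intro bexI[of _ c] exI[of _ "coords c"]) (auto simp: charts_at_def)
    next
      case False
      obtain d where d: "d \<in> charts_at M p" using chart_exists by blast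
      obtain W where W: "open W" "map_chart d p \<in> W" "W \<subseteq> coords d" "\<forall>x\<in>W. (f \<circ> inv_chart d) x = k"
        using constV[OF VU[OF False] d] by blast
      have "C1_on W (f \<circ> inv_chart d)" by (rule C1_on_cong[OF C1_on_const W(1)]) (use W(4) in auto)
      then show ?thesis using W d by blast
    qed
  qed
  assume B: "\<And>x v. x \<in> K \<Longrightarrow> \<bar>frechet_derivative F (at x) v\<bar> \<le> B * cnorm c x v" "B \<ge> 0"
  show "dbound M f B"
  proof (rule dboundI[OF C1])
    fix p
    show "\<exists>d\<in>charts_at M p. \<forall>v. \<bar>coord_deriv d f p v\<bar> \<le> B * chart_norm M p d v"
    proof (cases "p \<in> V")
      case True
      obtain d where d: "d \<in> charts_at M p" using chart_exists by blast
      obtain W where W: "open W" "map_chart d p \<in> W" "W \<subseteq> coords d" "\<forall>x\<in>W. (f \<circ> inv_chart d) x = k"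
        using constV[OF True d] by blast
      have "((\<lambda>x. k) has_derivative (\<lambda>v. 0)) (at (map_chart d p))" by simp
      then have "(f \<circ> inv_chart d has_derivative (\<lambda>v. 0)) (at (map_chart d p))"
        by (rule has_derivative_transform_within_open[OF _ W(1,2)]) (use W(4) in auto)
      then have "coord_deriv d f p = (\<lambda>v. 0)" using frechet_derivative_at by metis
      then show ?thesis using d B(2) chart_norm_nonneg[OF d] by (intro bexI[of _ d]) auto
    next
      case False
      then obtain x where x: "x \<in> K" "p = inv_chart c x" by (auto simp: V_def)
      have xc: "x \<in> coords c" "map_chart c p = x" using x K(2) c by auto
      have cp: "c \<in> charts_at M p" using x xc c by (simp add: charts_at_def)
      have "(F has_derivative frechet_derivative F (at x)) (at x)" by (rule C1_on_has_derivative[OF F(1) xc(1)])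
      then have "(f \<circ> inv_chart c has_derivative frechet_derivative F (at x)) (at x)"
        by (rule has_derivative_transform_within_open[OF _ open_coords[OF c] xc(1)]) (metis fin)
      then have "coord_deriv c f p = frechet_derivative F (at x)" using frechet_derivative_at xc(2) by metis
      then show ?thesis using cp B(1)[OF x(1)] xc chart_norm_cnorm[OF cp] by (intro bexI[of _ c]) auto
    qed
  qed
qed

end

section \<open>Path lengths and Lipschitz functions\<close>

context riem_manifold
begin

lemma chart_path_derivative_change:
  assumes \<gamma>: "continuous (at t within I) \<gamma>" "t \<in> I" and c: "c \<in> charts_at M (\<gamma> t)" and d: "d \<in> charts_at M (\<gamma> t)"
    and D: "((map_chart c \<circ> \<gamma>) has_vector_derivative D) (at t within I)"
  shows "((map_chart d \<circ> \<gamma>) has_vector_derivative coord_deriv c (map_chart d) (\<gamma> t) D) (at t within I)"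
proof -
  have c': "c \<in> atlas M" "\<gamma> t \<in> dom_chart c" using c by (auto simp: charts_at_def)
  have "((map_chart c \<circ> \<gamma>) has_derivative (\<lambda>s. s *\<^sub>R D)) (at t within I)"
    using D by (simp add: has_vector_derivative_def)
  moreover have tr: "(map_chart d \<circ> inv_chart c has_derivative coord_deriv c (map_chart d) (\<gamma> t)) (at ((map_chart c \<circ> \<gamma>) t))"
    using transition_has_derivative[OF c d] by simp
  ultimately have "(((map_chart d \<circ> inv_chart c) \<circ> (map_chart c \<circ> \<gamma>)) has_derivative
    coord_deriv c (map_chart d) (\<gamma> t) \<circ> (\<lambda>s. s *\<^sub>R D)) (at t within I)"
    by (intro diff_chain_within) (auto intro: has_derivative_at_withinI)
  moreover have "\<forall>\<^sub>F s in at t within I. ((map_chart d \<circ> inv_chart c) \<circ> (map_chart c \<circ> \<gamma>)) s = (map_chart d \<circ> \<gamma>) s"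
  proof -
    have "\<forall>\<^sub>F s in at t within I. \<gamma> s \<in> dom_chart c"
      using \<gamma>(1) open_dom[OF c'(1)] c'(2) unfolding continuous_within by (rule topological_tendstoD)
    then show ?thesis by eventually_elim (use c' in simp)
  qed
  ultimately have "((map_chart d \<circ> \<gamma>) has_derivative coord_deriv c (map_chart d) (\<gamma> t) \<circ> (\<lambda>s. s *\<^sub>R D)) (at t within I)"
    by (rule has_derivative_transform_eventually) (use c' \<gamma>(2) in auto)
  moreover have "coord_deriv c (map_chart d) (\<gamma> t) \<circ> (\<lambda>s. s *\<^sub>R D) = (\<lambda>s. s *\<^sub>R coord_deriv c (map_chart d) (\<gamma> t) D)"
    using has_derivative_bounded_linear[OF tr] by (auto simp: linear_simps)
  ultimately show ?thesis by (simp add: has_vector_derivative_def)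
qed

lemma vector_derivative_within_Icc:
  assumes "a < b" "t \<in> {a..b}" "(f has_vector_derivative D) (at t within {a..b})"
  shows "vector_derivative f (at t within {a..b::real}) = D"
  by (rule vector_derivative_within[OF _ assms(3)]) (use assms in \<open>simp add: trivial_limit_within\<close>)

text \<open>The interval is a parameter because \<open>velocity\<close> differentiates within
  \<open>{0..1}\<close>, while the pieces of a path are differentiable within their own
  intervals.\<close>

lemma velocity_set_eq:
  assumes ab: "a < b" "t \<in> {a..b}" and \<gamma>: "continuous (at t within {a..b}) \<gamma>" and c: "c \<in> charts_at M (\<gamma> t)"
    and D: "((map_chart c \<circ> \<gamma>) has_vector_derivative D) (at t within {a..b})"
  shows "{(c, v). c \<in> charts_at M (\<gamma> t) \<and> v = vector_derivative (map_chart c \<circ> \<gamma>) (at t within {a..b})}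
    = tangent_vec M (\<gamma> t) c D"
proof -
  have "vector_derivative (map_chart d \<circ> \<gamma>) (at t within {a..b}) = coord_deriv c (map_chart d) (\<gamma> t) D"
    if "d \<in> charts_at M (\<gamma> t)" for d
    by (rule vector_derivative_within_Icc[OF ab chart_path_derivative_change[OF \<gamma> ab(2) c that D]])
  then show ?thesis unfolding tangent_vec_eq[OF c] by auto
qed

text \<open>Stated for a map \<open>k\<close> from a normed space so that it serves twice: for an
  inverse chart, and for an inverse chart followed by the point map into the other manifold.\<close>

lemma rdist_segment_le:
  fixes k :: "'a::real_normed_vector \<Rightarrow> 'p"
  assumes k: "continuous_on W k" "\<And>d. d \<in> atlas M \<Longrightarrow> C1_on (W \<inter> k -` dom_chart d) (map_chart d \<circ> k)"
    and seg: "closed_segment x y \<subseteq> W" and B: "B \<ge> 0"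
    and speed: "\<And>z. z \<in> closed_segment x y \<Longrightarrow> \<exists>d\<in>charts_at M (k z).
      chart_norm M (k z) d (frechet_derivative (map_chart d \<circ> k) (at z) (y - x)) \<le> B"
  shows "rdist M (k x) (k y) \<le> ennreal B"
proof -
  define l where "l t = x + t *\<^sub>R (y - x)" for t :: real
  have lW: "l t \<in> closed_segment x y" if "t \<in> {0..1}" for t
    using that by (auto simp: l_def closed_segment_def algebra_simps intro!: exI[of _ t])
  define \<gamma> where "\<gamma> = k \<circ> l"
  have lc: "continuous_on {0..1} l" unfolding l_def by (intro continuous_intros)
  have \<gamma>c: "continuous_on {0..1} \<gamma>"
    unfolding \<gamma>_def by (intro continuous_on_compose lc continuous_on_subset[OF k(1)]) (use lW seg in auto)
  have der: "((map_chart d \<circ> \<gamma>) has_vector_derivative frechet_derivative (map_chart d \<circ> k) (at (l t)) (y - x)) (at t within I)"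
    if "t \<in> {0..1}" "d \<in> charts_at M (\<gamma> t)" for t d I
  proof -
    have "l t \<in> W \<inter> k -` dom_chart d" using that lW[OF that(1)] seg by (auto simp: \<gamma>_def charts_at_def)
    then have h: "(map_chart d \<circ> k has_derivative frechet_derivative (map_chart d \<circ> k) (at (l t))) (at (l t))"
      using C1_on_has_derivative[OF k(2)] charts_atD[OF that(2)] by blast
    have "(l has_vector_derivative (y - x)) (at t within I)"
      unfolding l_def by (auto intro!: derivative_eq_intros)
    from vector_derivative_diff_chain_within[OF this has_derivative_at_withinI[OF h]]
    show ?thesis by (simp add: \<gamma>_def o_def)
  qed
  have "C1_path_on M {0..1} \<gamma>"
    unfolding C1_path_on_def
  proof (intro conjI ballI \<gamma>c)
    fix d assume d: "d \<in> atlas M"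
    obtain f' where f': "continuous_on (W \<inter> k -` dom_chart d) f'"
      "\<And>z. z \<in> W \<inter> k -` dom_chart d \<Longrightarrow> frechet_derivative (map_chart d \<circ> k) (at z) = blinfun_apply (f' z)"
      using C1_on_blinfun_derivative[OF k(2)[OF d]] by blast
    have sub: "l ` {t \<in> {0..1}. \<gamma> t \<in> dom_chart d} \<subseteq> W \<inter> k -` dom_chart d"
      using lW seg by (auto simp: \<gamma>_def)
    have "continuous_on {t \<in> {0..1}. \<gamma> t \<in> dom_chart d} (\<lambda>t. blinfun_apply (f' (l t)) (y - x))"
      by (intro continuous_intros continuous_on_compose2[OF f'(1) continuous_on_subset[OF lc]] sub) auto
    moreover have "((map_chart d \<circ> \<gamma>) has_vector_derivative blinfun_apply (f' (l t)) (y - x)) (at t within {0..1})"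
      if "t \<in> {0..1}" "\<gamma> t \<in> dom_chart d" for t
    proof -
      have "l t \<in> W \<inter> k -` dom_chart d" using sub that by blast
      then show ?thesis using der[OF that(1), of d "{0..1}"] that(2) d f'(2)[of "l t"] by (simp add: charts_at_def)
    qed
    ultimately show "\<exists>D. continuous_on {t \<in> {0..1}. \<gamma> t \<in> dom_chart d} D \<and>
       (\<forall>t\<in>{0..1}. \<gamma> t \<in> dom_chart d \<longrightarrow> (map_chart d \<circ> \<gamma> has_vector_derivative D t) (at t within {0..1}))" by blast
  qed
  then have pw: "piecewise_C1_path M \<gamma>"
    unfolding piecewise_C1_path_def by (intro exI[of _ 1] exI[of _ real]) auto
  have ends: "\<gamma> 0 = k x" "\<gamma> 1 = k y" by (auto simp: \<gamma>_def l_def)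
  have sp: "norm_at M (\<gamma> t) (velocity M \<gamma> t) \<le> B" if t: "t \<in> {0..1}" for t
  proof -
    obtain d where d: "d \<in> charts_at M (\<gamma> t)"
      "chart_norm M (\<gamma> t) d (frechet_derivative (map_chart d \<circ> k) (at (l t)) (y - x)) \<le> B"
      using speed[OF lW[OF t]] by (auto simp: \<gamma>_def)
    have cw: "continuous (at t within {0..1}) \<gamma>" using \<gamma>c t by (simp add: continuous_on_eq_continuous_within)
    have "velocity M \<gamma> t = tangent_vec M (\<gamma> t) d (frechet_derivative (map_chart d \<circ> k) (at (l t)) (y - x))"
      unfolding velocity_def by (rule velocity_set_eq[OF _ t cw d(1) der[OF t d(1)]]) simp
    then show ?thesis using d(2) by simp
  qed
  have "path_length M \<gamma> \<le> B"
  \<comment> \<open>If the speed is not integrable, \<open>integral\<close> takes its default value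
    \<open>0\<close> and \<open>B \<ge> 0\<close> gives the bound.\<close>
  proof (cases "(\<lambda>t. norm_at M (\<gamma> t) (velocity M \<gamma> t)) integrable_on {0..1}")
    case True
    then have "path_length M \<gamma> \<le> integral {0..1} (\<lambda>t::real. B)"
      unfolding path_length_def by (rule Henstock_Kurzweil_Integration.integral_le) (use sp in auto)
    then show ?thesis by simp
  next
    case False
    then show ?thesis using B by (simp add: path_length_def not_integrable_integral)
  qed
  then have "ennreal (path_length M \<gamma>) \<le> ennreal B" by (rule ennreal_leI)
  moreover have "rdist M (k x) (k y) \<le> ennreal (path_length M \<gamma>)"
    unfolding rdist_def by (rule INF_lower) (use pw ends in simp)
  ultimately show ?thesis by order
qed

text \<open>A coordinate segment from \<open>x\<close> to \<open>x + t *\<^sub>R v\<close> has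
  length at most \<open>t * n * (1 + C * (t * n))\<close>, where \<open>n\<close> is the length of
  \<open>v\<close>. After division by \<open>t\<close> the correction disappears, so the Lipschitz
  constant is preserved exactly.\<close>

lemma dbound_if_lipschitz:
  assumes f: "C1_fun M f" and L: "L > 0" and lip: "\<And>p q. ennreal (dist (f p) (f q)) \<le> ennreal L * rdist M p q"
  shows "dbound M f L"
proof (rule dboundI[OF f])
  fix p
  obtain c where c: "c \<in> charts_at M p" using chart_exists by blast
  have c': "c \<in> atlas M" "p \<in> dom_chart c" using c by (auto simp: charts_at_def)
  define x where "x = map_chart c p"
  obtain R a b C where R: "R > 0" "C > 0" "cball x R \<subseteq> coords c"
    and var: "\<And>y z v. y \<in> cball x R \<Longrightarrow> z \<in> cball x R \<Longrightarrow>
       cnorm c y v \<le> (1 + C * cnorm c z (y - z)) * cnorm c z v"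
    using nice_ball[OF c] unfolding x_def by metis
  have xR: "x \<in> cball x R" using R by simp
  have xc: "x \<in> coords c" using R xR by blast
  define F where "F = f \<circ> inv_chart c"
  have FD: "(F has_derivative coord_deriv c f p) (at x)" using C1_fun_has_derivative[OF f c] by (simp add: F_def x_def)
  have "\<bar>coord_deriv c f p v\<bar> \<le> L * chart_norm M p c v" for v
  proof -
    define n where "n = cnorm c x v"
    have n: "n = chart_norm M p c v" using chart_norm_cnorm[OF c] by (simp add: n_def x_def)
    have n0: "n \<ge> 0" using chart_norm_nonneg[OF c] n by simp
    have est: "\<bar>F (x + t *\<^sub>R v) - F x\<bar> \<le> L * (t * n * (1 + C * (t * n)))" if t: "t > 0" "norm (t *\<^sub>R v) \<le> R" for t
    proof -
      have xt: "x + t *\<^sub>R v \<in> cball x R" using t(2) by (simp add: dist_norm)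
      have seg: "closed_segment x (x + t *\<^sub>R v) \<subseteq> cball x R"
        using closed_segment_subset[OF xR xt convex_cball] .
      have "rdist M (inv_chart c x) (inv_chart c (x + t *\<^sub>R v)) \<le> ennreal (t * n * (1 + C * (t * n)))"
      proof (rule rdist_segment_le[OF continuous_on_inv_chart[OF c'(1)]])
        show "C1_on (coords c \<inter> inv_chart c -` dom_chart d) (map_chart d \<circ> inv_chart c)" if "d \<in> atlas M" for d
        proof -
          have "coords c \<inter> inv_chart c -` dom_chart d = map_chart c ` (dom_chart c \<inter> dom_chart d)"
            using c'(1) by (subst inv_chart_image) auto
          then show ?thesis using C1_transition(1)[OF c'(1) that] by simp
        qed
        show "closed_segment x (x + t *\<^sub>R v) \<subseteq> coords c" using seg R by blast
        show "0 \<le> t * n * (1 + C * (t * n))" using t n0 R by simp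
        fix z assume z: "z \<in> closed_segment x (x + t *\<^sub>R v)"
        then have zR: "z \<in> cball x R" using seg by blast
        then have zc: "z \<in> coords c" using R by blast
        obtain s where s: "0 \<le> s" "s \<le> 1" "z = x + (s * t) *\<^sub>R v"
          using z by (auto simp: closed_segment_def algebra_simps)
        have cz: "c \<in> charts_at M (inv_chart c z)" using c' zc by (simp add: charts_at_def)
        have sc: "cnorm c x (r *\<^sub>R v) = \<bar>r\<bar> * n" for r
          using inner_form.nrm_scale[OF inner_form_gram[OF c'(1) xc]] by (simp add: n_def cnorm_nrm[OF c'(1) xc])
        have "frechet_derivative (map_chart c \<circ> inv_chart c) (at z) = id"
          using transition_id[OF cz] c'(1) zc by simp
        then have "chart_norm M (inv_chart c z) c (frechet_derivative (map_chart c \<circ> inv_chart c) (at z) (x + t *\<^sub>R v - x)) = cnorm c z (t *\<^sub>R v)"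
          using c'(1) zc by (simp add: cnorm_chart_norm)
        also have "\<dots> \<le> (1 + C * cnorm c x (z - x)) * cnorm c x (t *\<^sub>R v)" by (rule var[OF zR xR])
        also have "\<dots> = (1 + C * (s * t * n)) * (t * n)" using s t by (simp add: sc)
        also have "\<dots> \<le> (1 + C * (1 * t * n)) * (t * n)"
          using s t n0 R by (intro mult_right_mono add_left_mono mult_left_mono) auto
        finally show "\<exists>d\<in>charts_at M (inv_chart c z). chart_norm M (inv_chart c z) d
            (frechet_derivative (map_chart d \<circ> inv_chart c) (at z) (x + t *\<^sub>R v - x)) \<le> t * n * (1 + C * (t * n))"
          using cz by (intro bexI[of _ c]) (auto simp: mult_ac)
      qed
      then have "ennreal L * rdist M (inv_chart c x) (inv_chart c (x + t *\<^sub>R v)) \<le> ennreal L * ennreal (t * n * (1 + C * (t * n)))"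
        by (intro mult_left_mono) auto
      from order_trans[OF lip this]
      have "ennreal (dist (F x) (F (x + t *\<^sub>R v))) \<le> ennreal L * ennreal (t * n * (1 + C * (t * n)))"
        by (simp only: F_def o_apply)
      also have "\<dots> = ennreal (L * (t * n * (1 + C * (t * n))))"
        by (rule ennreal_mult[symmetric]) (use L t n0 R in auto)
      finally have "ennreal (dist (F x) (F (x + t *\<^sub>R v))) \<le> ennreal (L * (t * n * (1 + C * (t * n))))" .
      moreover have "0 \<le> L * (t * n * (1 + C * (t * n)))" using L t n0 R by simp
      ultimately have "dist (F x) (F (x + t *\<^sub>R v)) \<le> L * (t * n * (1 + C * (t * n)))" by simp
      then show ?thesis by (simp add: dist_real_def abs_minus_commute)
    qed
    have "((\<lambda>t. F (x + t *\<^sub>R v)) has_real_derivative coord_deriv c f p v) (at 0)"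
      by (rule directional_derivative) (simp only: FD scaleR_zero_left add_0_right)
    then have "((\<lambda>t. (F (x + t *\<^sub>R v) - F x) / t) \<longlongrightarrow> coord_deriv c f p v) (at 0)"
      by (simp add: DERIV_def)
    then have lim: "((\<lambda>t. \<bar>(F (x + t *\<^sub>R v) - F x) / t\<bar>) \<longlongrightarrow> \<bar>coord_deriv c f p v\<bar>) (at_right 0)"
      by (intro tendsto_rabs) (auto simp: filterlim_at_split)
    have lim2: "((\<lambda>t. L * (n * (1 + C * (t * n)))) \<longlongrightarrow> L * (n * (1 + C * (0 * n)))) (at_right 0)"
      by (intro tendsto_intros)
    have "((\<lambda>t. norm (t *\<^sub>R v)) \<longlongrightarrow> norm ((0::real) *\<^sub>R v)) (at_right 0)" by (intro tendsto_intros)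
    then have "\<forall>\<^sub>F t::real in at_right 0. norm (t *\<^sub>R v) < R" by (rule order_tendstoD) (use R in simp)
    moreover have "\<forall>\<^sub>F t::real in at_right 0. t > 0" by (rule eventually_at_right_less)
    ultimately have "\<forall>\<^sub>F t in at_right 0. \<bar>(F (x + t *\<^sub>R v) - F x) / t\<bar> \<le> L * (n * (1 + C * (t * n)))"
    proof eventually_elim
      case (elim t)
      then show ?case using est[of t] by (simp add: field_simps)
    qed
    then have "\<bar>coord_deriv c f p v\<bar> \<le> L * (n * (1 + C * (0 * n)))"
      by (rule tendsto_le[OF trivial_limit_at_right_real lim2 lim])
    then show ?thesis by (simp add: n)
  qed
  then show "\<exists>c\<in>charts_at M p. \<forall>v. \<bar>coord_deriv c f p v\<bar> \<le> L * chart_norm M p c v" using c by blast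
qed

text \<open>Integrability is essential for this direction: the default value \<open>0\<close> of an
  integral would ruin a lower bound for the length. It follows from continuity of the speed on each
  piece.\<close>

lemma C1_path_speed:
  assumes \<gamma>: "C1_path_on M {a..b} \<gamma>" and ab: "a < b" "{a..b} \<subseteq> {0..1}"
    and f: "C1_fun M f" and L: "dbound M f L"
  shows "(\<lambda>t. norm_at M (\<gamma> t) (velocity M \<gamma> t)) integrable_on {a..b}"
    and "\<bar>f (\<gamma> b) - f (\<gamma> a)\<bar> \<le> L * integral {a..b} (\<lambda>t. norm_at M (\<gamma> t) (velocity M \<gamma> t))"
proof -
  define n where "n t = norm_at M (\<gamma> t) (velocity M \<gamma> t)" for t
  \<comment> \<open>This is the speed computed within the piece. It is continuous up to both ends,
    where \<open>n\<close>, computed within \<open>{0..1}\<close>, may be arbitrary; the two agree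
    in the interior, and two points do not affect the integral.\<close>
  define m where "m t = norm_at M (\<gamma> t) {(c, v). c \<in> charts_at M (\<gamma> t) \<and> v = vector_derivative (map_chart c \<circ> \<gamma>) (at t within {a..b})}" for t
  have \<gamma>c: "continuous_on {a..b} \<gamma>" using \<gamma> by (simp add: C1_path_on_def)
  have cw: "continuous (at t within {a..b}) \<gamma>" if "t \<in> {a..b}" for t
    using \<gamma>c that by (simp add: continuous_on_eq_continuous_within)
  have chart: "\<exists>c D T. c \<in> charts_at M (\<gamma> t0) \<and> open T \<and> t0 \<in> T \<and> continuous_on ({a..b} \<inter> T) D \<and>
     (\<forall>t\<in>{a..b} \<inter> T. \<gamma> t \<in> dom_chart c \<and> ((map_chart c \<circ> \<gamma>) has_vector_derivative D t) (at t within {a..b}))"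
    if t0: "t0 \<in> {a..b}" for t0
  proof -
    obtain c where c: "c \<in> charts_at M (\<gamma> t0)" using chart_exists by blast
    have c': "c \<in> atlas M" "\<gamma> t0 \<in> dom_chart c" using c by (auto simp: charts_at_def)
    obtain D where D: "continuous_on {t\<in>{a..b}. \<gamma> t \<in> dom_chart c} D"
      "\<And>t. t \<in> {a..b} \<Longrightarrow> \<gamma> t \<in> dom_chart c \<Longrightarrow> ((map_chart c \<circ> \<gamma>) has_vector_derivative D t) (at t within {a..b})"
      using \<gamma> c'(1) unfolding C1_path_on_def by metis
    obtain T where T: "open T" "T \<inter> {a..b} = \<gamma> -` dom_chart c \<inter> {a..b}"
      using \<gamma>c open_dom[OF c'(1)] unfolding continuous_on_open_invariant by metis
    have eq: "{t\<in>{a..b}. \<gamma> t \<in> dom_chart c} = {a..b} \<inter> T" using T(2) by blast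
    show ?thesis
    proof (intro exI conjI ballI)
      show "t0 \<in> T" using T(2) c'(2) t0 by blast
      show "continuous_on ({a..b} \<inter> T) D" using D(1) eq by simp
      fix t assume t: "t \<in> {a..b} \<inter> T"
      then show "\<gamma> t \<in> dom_chart c" using T(2) by blast
      then show "((map_chart c \<circ> \<gamma>) has_vector_derivative D t) (at t within {a..b})" using D(2) t by blast
    qed (use c T in auto)
  qed
  have mc: "continuous_on {a..b} m"
    unfolding continuous_on_eq_continuous_within
  proof
    fix t0 assume t0: "t0 \<in> {a..b}"
    obtain c D T where c: "c \<in> charts_at M (\<gamma> t0)" and T: "open T" "t0 \<in> T" and Dc: "continuous_on ({a..b} \<inter> T) D"
      and D: "\<And>t. t \<in> {a..b} \<inter> T \<Longrightarrow> \<gamma> t \<in> dom_chart c \<and> ((map_chart c \<circ> \<gamma>) has_vector_derivative D t) (at t within {a..b})"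
      using chart[OF t0] by metis
    have c': "c \<in> atlas M" using c by (simp add: charts_at_def)
    have m_eq: "m t = sqrt (gram c (map_chart c (\<gamma> t)) (D t) (D t))" if t: "t \<in> {a..b} \<inter> T" for t
    proof -
      have ct: "c \<in> charts_at M (\<gamma> t)" using D[OF t] c' by (simp add: charts_at_def)
      have ti: "t \<in> {a..b}" using t by blast
      have "m t = chart_norm M (\<gamma> t) c (D t)"
        unfolding m_def velocity_set_eq[OF ab(1) ti cw[OF ti] ct conjunct2[OF D[OF t]]] by (rule refl)
      then show ?thesis by (simp add: chart_norm_gram[OF ct])
    qed
    have \<phi>c: "continuous_on ({a..b} \<inter> T) (\<lambda>t. map_chart c (\<gamma> t))"
      by (rule continuous_on_compose2[OF continuous_on_map_chart[OF c'] continuous_on_subset[OF \<gamma>c]]) (use D in auto)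
    have "continuous_on ({a..b} \<inter> T) (\<lambda>t. gram c (map_chart c (\<gamma> t)))"
      by (rule continuous_on_compose2[OF C1_on_imp_continuous_on[OF C1_gram[OF c']] \<phi>c]) (use D in auto)
    then have "continuous_on ({a..b} \<inter> T) (\<lambda>t. sqrt (gram c (map_chart c (\<gamma> t)) (D t) (D t)))"
      by (intro continuous_intros Dc)
    then have "continuous_on ({a..b} \<inter> T) m"
      using m_eq continuous_on_cong[of "{a..b} \<inter> T" "{a..b} \<inter> T" m "\<lambda>t. sqrt (gram c (map_chart c (\<gamma> t)) (D t) (D t))"] by blast
    then have "continuous (at t0 within {a..b} \<inter> T) m"
      using t0 T(2) by (simp add: continuous_on_eq_continuous_within)
    moreover have "at t0 within {a..b} \<inter> T = at t0 within {a..b}"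
      using T by (intro at_within_nhd[of t0 T]) auto
    ultimately show "continuous (at t0 within {a..b}) m" by simp
  qed
  have m_int: "m integrable_on {a..b}" by (rule integrable_continuous_interval[OF mc])
  have nm: "n t = m t" if t: "t \<in> {a<..<b}" for t
  proof -
    have "at t within {a..b} = at t" using t by (intro at_within_interior) simp
    moreover have "at t within {0..1} = at t"
      using t ab(2) interior_mono[OF ab(2)] by (intro at_within_interior) (auto simp: subset_iff)
    ultimately show ?thesis by (simp add: n_def m_def velocity_def)
  qed
  have n_has: "(n has_integral integral {a..b} m) {a..b}"
    by (rule has_integral_spike_finite[where f=m and S="{a, b}"]) (use nm m_int in \<open>auto simp: integrable_integral\<close>)
  then show "(\<lambda>t. norm_at M (\<gamma> t) (velocity M \<gamma> t)) integrable_on {a..b}"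
    unfolding n_def by (rule has_integral_integrable)
  define g' where "g' t = vector_derivative (f \<circ> \<gamma>) (at t within {a..b})" for t
  have g': "((f \<circ> \<gamma>) has_vector_derivative g' t) (at t within {a..b}) \<and> \<bar>g' t\<bar> \<le> L * m t" if t: "t \<in> {a..b}" for t
  proof -
    obtain c D T where c: "c \<in> charts_at M (\<gamma> t)" and T: "t \<in> T"
      and D: "\<And>s. s \<in> {a..b} \<inter> T \<Longrightarrow> \<gamma> s \<in> dom_chart c \<and> ((map_chart c \<circ> \<gamma>) has_vector_derivative D s) (at s within {a..b})"
      using chart[OF t] by metis
    have c': "c \<in> atlas M" "\<gamma> t \<in> dom_chart c" using c by (auto simp: charts_at_def)
    have Dt: "((map_chart c \<circ> \<gamma>) has_vector_derivative D t) (at t within {a..b})" using D t T by blast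
    have fd: "(f \<circ> inv_chart c has_derivative coord_deriv c f (\<gamma> t)) (at ((map_chart c \<circ> \<gamma>) t))"
      using C1_fun_has_derivative[OF f c] by simp
    have "((f \<circ> inv_chart c) \<circ> (map_chart c \<circ> \<gamma>) has_vector_derivative coord_deriv c f (\<gamma> t) (D t)) (at t within {a..b})"
      by (rule vector_derivative_diff_chain_within[OF Dt has_derivative_at_withinI[OF fd]])
    moreover have "\<forall>\<^sub>F s in at t within {a..b}. ((f \<circ> inv_chart c) \<circ> (map_chart c \<circ> \<gamma>)) s = (f \<circ> \<gamma>) s"
    proof -
      have "\<forall>\<^sub>F s in at t within {a..b}. \<gamma> s \<in> dom_chart c"
        using cw[OF t] open_dom[OF c'(1)] c'(2) unfolding continuous_within by (rule topological_tendstoD)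
      then show ?thesis by eventually_elim (use c' in simp)
    qed
    ultimately have d: "((f \<circ> \<gamma>) has_vector_derivative coord_deriv c f (\<gamma> t) (D t)) (at t within {a..b})"
      unfolding has_vector_derivative_def by (rule has_derivative_transform_eventually) (use c' t in auto)
    have g'_eq: "g' t = coord_deriv c f (\<gamma> t) (D t)"
      unfolding g'_def by (rule vector_derivative_within_Icc[OF ab(1) t d])
    have "m t = chart_norm M (\<gamma> t) c (D t)"
      unfolding m_def velocity_set_eq[OF ab(1) t cw[OF t] c Dt] by (rule refl)
    then show ?thesis using d dboundD[OF L c, of "D t"] by (simp add: g'_eq)
  qed
  have "(g' has_integral (f \<circ> \<gamma>) b - (f \<circ> \<gamma>) a) {a..b}"
    by (rule fundamental_theorem_of_calculus[OF less_imp_le[OF ab(1)] conjunct1[OF g']])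
  then have "\<bar>f (\<gamma> b) - f (\<gamma> a)\<bar> = norm (integral {a..b} g')" "g' integrable_on {a..b}"
    by (auto simp: integral_unique has_integral_integrable)
  moreover have "norm (integral {a..b} g') \<le> integral {a..b} (\<lambda>t. L * m t)"
    by (rule integral_norm_bound_integral[OF calculation(2)])
       (use g' m_int integrable_on_mult_right[of m "{a..b}" L] in auto)
  ultimately have "\<bar>f (\<gamma> b) - f (\<gamma> a)\<bar> \<le> L * integral {a..b} m" by simp
  then show "\<bar>f (\<gamma> b) - f (\<gamma> a)\<bar> \<le> L * integral {a..b} (\<lambda>t. norm_at M (\<gamma> t) (velocity M \<gamma> t))"
    using integral_unique[OF n_has] unfolding n_def by simp
qed

lemma path_length_ge:
  assumes \<gamma>: "piecewise_C1_path M \<gamma>" and f: "C1_fun M f" and L: "dbound M f L"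
  shows "\<bar>f (\<gamma> 1) - f (\<gamma> 0)\<bar> \<le> L * path_length M \<gamma>"
proof -
  define s where "s t = norm_at M (\<gamma> t) (velocity M \<gamma> t)" for t
  obtain n :: nat and t :: "nat \<Rightarrow> real" where t: "t 0 = 0" "t n = 1"
    and pieces: "\<And>i. i < n \<Longrightarrow> t i < t (Suc i)" "\<And>i. i < n \<Longrightarrow> C1_path_on M {t i..t (Suc i)} \<gamma>"
    using \<gamma> unfolding piecewise_C1_path_def by blast
  have mono: "t i \<le> t j" if "i \<le> j" "j \<le> n" for i j
    using that
  proof (induction j rule: dec_induct)
    case (step j)
    then show ?case using pieces(1)[of j] by simp
  qed simp
  have "k \<le> n \<Longrightarrow> s integrable_on {0..t k} \<and> \<bar>f (\<gamma> (t k)) - f (\<gamma> 0)\<bar> \<le> L * integral {0..t k} s" for k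
  proof (induction k)
    case 0
    then show ?case using t integrable_on_refl[of s 0] by simp
  next
    case (Suc k)
    then have k: "k < n" by simp
    have IH: "s integrable_on {0..t k}" "\<bar>f (\<gamma> (t k)) - f (\<gamma> 0)\<bar> \<le> L * integral {0..t k} s" using Suc by auto
    have tk: "0 \<le> t k" "t k \<le> t (Suc k)" "t (Suc k) \<le> 1"
      using mono[of 0 k] mono[of k "Suc k"] mono[of "Suc k" n] k t by auto
    have "{t k..t (Suc k)} \<subseteq> {0..1}" using tk by auto
    note piece = C1_path_speed[OF pieces(2)[OF k] pieces(1)[OF k] this f L, folded s_def]
    have "s integrable_on {0..t (Suc k)}" by (rule Henstock_Kurzweil_Integration.integrable_combine[OF tk(1,2) IH(1) piece(1)])
    moreover from this have "integral {0..t k} s + integral {t k..t (Suc k)} s = integral {0..t (Suc k)} s"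
      by (rule Henstock_Kurzweil_Integration.integral_combine[OF tk(1,2)])
    then have "L * integral {0..t (Suc k)} s = L * integral {0..t k} s + L * integral {t k..t (Suc k)} s"
      by (simp flip: distrib_left)
    ultimately show ?case using IH(2) piece(2) by linarith
  qed
  from this[of n] show ?thesis using t by (simp add: path_length_def s_def[abs_def])
qed

lemma lipschitz_if_dbound:
  assumes f: "C1_fun M f" and d: "dbound M f L" and L: "L > 0"
  shows "ennreal (dist (f p) (f q)) \<le> ennreal L * rdist M p q"
proof -
  have "ennreal (dist (f p) (f q) / L) \<le> rdist M p q"
    unfolding rdist_def
  proof (rule INF_greatest)
    fix \<gamma> assume "\<gamma> \<in> {\<gamma>. piecewise_C1_path M \<gamma> \<and> \<gamma> 0 = p \<and> \<gamma> 1 = q}"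
    then have "dist (f p) (f q) \<le> L * path_length M \<gamma>"
      using path_length_ge[OF _ f d, of \<gamma>] by (auto simp: dist_real_def abs_minus_commute)
    then have "dist (f p) (f q) / L \<le> path_length M \<gamma>" using L by (simp add: field_simps)
    then show "ennreal (dist (f p) (f q) / L) \<le> ennreal (path_length M \<gamma>)" by (rule ennreal_leI)
  qed
  then have "ennreal L * ennreal (dist (f p) (f q) / L) \<le> ennreal L * rdist M p q" by (rule mult_left_mono) simp
  moreover have "ennreal L * ennreal (dist (f p) (f q) / L) = ennreal (dist (f p) (f q))"
    using L by (simp flip: ennreal_mult)
  ultimately show ?thesis by simp
qed

lemma lipschitz_fun_iff:
  assumes f: "C1_fun M f"
  shows "lipschitz_fun M f \<longleftrightarrow> (\<exists>L. dbound M f L)"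
proof
  assume "lipschitz_fun M f"
  then show "\<exists>L. dbound M f L" unfolding lipschitz_fun_def using dbound_if_lipschitz[OF f] by blast
next
  assume "\<exists>L. dbound M f L"
  then obtain L where L: "dbound M f L" by blast
  \<comment> \<open>\<open>lipschitz_fun\<close> asks for a positive constant, and
    \<open>dbound\<close> does not fix the sign of \<open>L\<close>.\<close>
  have "dbound M f (\<bar>L\<bar> + 1)"
    unfolding dbound_def
  proof (intro allI ballI)
    fix p c v assume c: "c \<in> charts_at M p"
    have "L * chart_norm M p c v \<le> (\<bar>L\<bar> + 1) * chart_norm M p c v"
      by (rule mult_right_mono) (use chart_norm_nonneg[OF c] in auto)
    then show "\<bar>coord_deriv c f p v\<bar> \<le> (\<bar>L\<bar> + 1) * chart_norm M p c v" using dboundD[OF L c, of v] by linarith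
  qed
  then show "lipschitz_fun M f"
    unfolding lipschitz_fun_def using lipschitz_if_dbound[OF f, of "\<bar>L\<bar> + 1"]
    by (intro exI[of _ "\<bar>L\<bar> + 1"] conjI allI) simp_all
qed

end

section \<open>The algebra of bounded Lipschitz functions and the metric it determines\<close>

text \<open>The dual-norm distance between the evaluations at two points. It involves only the
  normed algebra, so an isomorphism preserves it wherever points correspond.\<close>

definition rho :: "('p::topological_space, 'h::real_normed_vector) manifold \<Rightarrow> 'p \<Rightarrow> 'p \<Rightarrow> real" where
  "rho M p q = (SUP f \<in> {f \<in> Cb1 M. Cb1_norm M f \<le> 1}. \<bar>f p - f q\<bar>)"

context riem_manifold
begin

lemma Cb1_iff: "f \<in> Cb1 M \<longleftrightarrow> C1_fun M f \<and> (\<exists>B. \<forall>p. \<bar>f p\<bar> \<le> B) \<and> (\<exists>L. dbound M f L)"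
  unfolding Cb1_def using lipschitz_fun_iff by (auto simp: bounded_real)

lemma Cb1I: "C1_fun M f \<Longrightarrow> (\<And>p. \<bar>f p\<bar> \<le> B) \<Longrightarrow> dbound M f L \<Longrightarrow> f \<in> Cb1 M"
  unfolding Cb1_iff by blast

lemma Cb1_C1: "f \<in> Cb1 M \<Longrightarrow> C1_fun M f"
  unfolding Cb1_iff by blast

lemma Cb1_continuous: "f \<in> Cb1 M \<Longrightarrow> continuous_on UNIV f"
  using Cb1_C1 C1_fun_continuous by blast

lemma Cb1E:
  assumes "f \<in> Cb1 M"
  obtains B L where "B \<ge> 0" "L \<ge> 0" "\<And>p. \<bar>f p\<bar> \<le> B" "dbound M f L"
proof -
  obtain B L where BL: "\<And>p. \<bar>f p\<bar> \<le> B" "dbound M f L" using assms unfolding Cb1_iff by blast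
  have "dbound M f \<bar>L\<bar>"
    unfolding dbound_def
  proof (intro allI ballI)
    fix p c v assume c: "c \<in> charts_at M p"
    have "L * chart_norm M p c v \<le> \<bar>L\<bar> * chart_norm M p c v"
      by (rule mult_right_mono) (use chart_norm_nonneg[OF c] in auto)
    then show "\<bar>coord_deriv c f p v\<bar> \<le> \<bar>L\<bar> * chart_norm M p c v" using dboundD[OF BL(2) c, of v] by linarith
  qed
  \<comment> \<open>\<open>undefined\<close> stands for any point; types are inhabited.\<close>
  moreover have "B \<ge> 0" using BL(1)[of undefined] by linarith
  ultimately show ?thesis using that[of B "\<bar>L\<bar>"] BL(1) by simp
qed

text \<open>Membership in the algebra makes both suprema suprema of bounded sets; the norm is their
  maximum, so a bound on it splits into the two conditions.\<close>

lemma Cb1_norm_le_iff: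
  assumes f: "f \<in> Cb1 M" and K: "K \<ge> 0"
  shows "Cb1_norm M f \<le> K \<longleftrightarrow> (\<forall>p. \<bar>f p\<bar> \<le> K) \<and> dbound M f K"
proof -
  have C1: "C1_fun M f" by (rule Cb1_C1[OF f])
  obtain B L where BL: "B \<ge> 0" "L \<ge> 0" "\<And>p. \<bar>f p\<bar> \<le> B" "dbound M f L" using Cb1E[OF f] by metis
  have dn: "differential_norm M f p \<le> A" if "dbound M f A" "A \<ge> 0" for A p
  proof -
    obtain c where c: "c \<in> charts_at M p" using chart_exists by blast
    show ?thesis by (rule differential_norm_le[OF C1 c that(2) dboundD[OF that(1) c]])
  qed
  have 1: "bdd_above (range (\<lambda>p. \<bar>f p\<bar>))" using BL by (intro bdd_aboveI2[of _ _ B]) auto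
  have 2: "bdd_above (range (differential_norm M f))" using dn[OF BL(4,2)] by (intro bdd_aboveI2[of _ _ L]) auto
  have "(SUP p. \<bar>f p\<bar>) \<le> K \<longleftrightarrow> (\<forall>p. \<bar>f p\<bar> \<le> K)" by (subst cSUP_le_iff[OF _ 1]) auto
  moreover have "(SUP p. differential_norm M f p) \<le> K \<longleftrightarrow> dbound M f K"
  proof -
    have "(SUP p. differential_norm M f p) \<le> K \<longleftrightarrow> (\<forall>p. differential_norm M f p \<le> K)"
      by (subst cSUP_le_iff[OF _ 2]) auto
    also have "\<dots> \<longleftrightarrow> dbound M f K"
    proof
      assume *: "\<forall>p. differential_norm M f p \<le> K"
      show "dbound M f K"
        unfolding dbound_def
      proof (intro allI ballI)
        fix p c v assume c: "c \<in> charts_at M p"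
        have "differential_norm M f p * chart_norm M p c v \<le> K * chart_norm M p c v"
          by (rule mult_right_mono) (use * chart_norm_nonneg[OF c] in auto)
        then show "\<bar>coord_deriv c f p v\<bar> \<le> K * chart_norm M p c v" using le_differential_norm[OF C1 c, of v] by linarith
      qed
    qed (use dn K in blast)
    finally show ?thesis .
  qed
  ultimately show ?thesis by (simp add: Cb1_norm_def)
qed

lemma Cb1_norm_nonneg:
  assumes f: "f \<in> Cb1 M"
  shows "0 \<le> Cb1_norm M f"
proof -
  obtain B L where BL: "\<And>p. \<bar>f p\<bar> \<le> B" using Cb1E[OF f] by metis
  then have "\<bar>f undefined\<bar> \<le> (SUP p. \<bar>f p\<bar>)" by (intro cSUP_upper bdd_aboveI2[of _ _ B]) auto
  then show ?thesis by (simp add: Cb1_norm_def)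
qed

section \<open>Closure of the algebra under arithmetic and functional calculus\<close>

lemma Cb1_const: "(\<lambda>p. k) \<in> Cb1 M"
proof (rule Cb1I[where L=0 and B="\<bar>k\<bar>"])
  have *: "(\<lambda>p. k) \<circ> inv_chart c = (\<lambda>x. k)" for c :: "('p, 'h) chart" by auto
  show "C1_fun M (\<lambda>p. k)" by (auto simp: C1_fun_def * C1_on_const)
  show "dbound M (\<lambda>p. k) 0" by (auto simp: dbound_def *)
qed simp

lemma Cb1_add:
  assumes "f \<in> Cb1 M" "g \<in> Cb1 M"
  shows "(\<lambda>p. f p + g p) \<in> Cb1 M"
proof -
  obtain B L B' L' where f: "\<And>p. \<bar>f p\<bar> \<le> B" "dbound M f L" and g: "\<And>p. \<bar>g p\<bar> \<le> B'" "dbound M g L'"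
    using Cb1E[OF assms(1)] Cb1E[OF assms(2)] by metis
  have *: "(\<lambda>p. f p + g p) \<circ> inv_chart c = (\<lambda>x. (f \<circ> inv_chart c) x + (g \<circ> inv_chart c) x)" for c :: "('p, 'h) chart" by auto
  show ?thesis
  proof (rule Cb1I[where L="L + L'" and B="B + B'"])
    show "C1_fun M (\<lambda>p. f p + g p)"
      unfolding C1_fun_def * by (intro ballI C1_on_add C1_funD Cb1_C1 assms)
    show "\<bar>f p + g p\<bar> \<le> B + B'" for p using f(1)[of p] g(1)[of p] by linarith
    show "dbound M (\<lambda>p. f p + g p) (L + L')"
      unfolding dbound_def
    proof (intro allI ballI)
      fix p c v assume c: "c \<in> charts_at M p"
      have "coord_deriv c (\<lambda>p. f p + g p) p = (\<lambda>v. coord_deriv c f p v + coord_deriv c g p v)"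
        unfolding * by (rule frechet_derivative_at[symmetric])
          (intro has_derivative_add C1_fun_has_derivative[OF Cb1_C1] assms c)
      then show "\<bar>coord_deriv c (\<lambda>p. f p + g p) p v\<bar> \<le> (L + L') * chart_norm M p c v"
        using dboundD[OF f(2) c, of v] dboundD[OF g(2) c, of v] by (simp add: distrib_right)
    qed
  qed
qed

lemma Cb1_mult:
  assumes "f \<in> Cb1 M" "g \<in> Cb1 M"
  shows "(\<lambda>p. f p * g p) \<in> Cb1 M"
proof -
  obtain B L where f: "B \<ge> 0" "\<And>p. \<bar>f p\<bar> \<le> B" "dbound M f L" using Cb1E[OF assms(1)] by metis
  obtain B' L' where g: "B' \<ge> 0" "\<And>p. \<bar>g p\<bar> \<le> B'" "dbound M g L'" using Cb1E[OF assms(2)] by metis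
  have *: "(\<lambda>p. f p * g p) \<circ> inv_chart c = (\<lambda>x. (f \<circ> inv_chart c) x * (g \<circ> inv_chart c) x)" for c :: "('p, 'h) chart" by auto
  show ?thesis
  proof (rule Cb1I[where L="B * L' + B' * L" and B="B * B'"])
    show "C1_fun M (\<lambda>p. f p * g p)"
      unfolding C1_fun_def * by (intro ballI C1_on_mult C1_funD Cb1_C1 assms)
    show "\<bar>f p * g p\<bar> \<le> B * B'" for p using f(1,2) g(1,2) by (simp add: abs_mult mult_mono)
    show "dbound M (\<lambda>p. f p * g p) (B * L' + B' * L)"
      unfolding dbound_def
    proof (intro allI ballI)
      fix p c v assume c: "c \<in> charts_at M p"
      have p: "inv_chart c (map_chart c p) = p" using c by (simp add: charts_at_def)
      have "coord_deriv c (\<lambda>p. f p * g p) p = (\<lambda>v. (f \<circ> inv_chart c) (map_chart c p) * coord_deriv c g p v + coord_deriv c f p v * (g \<circ> inv_chart c) (map_chart c p))"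
        unfolding * by (rule frechet_derivative_at[symmetric])
          (intro has_derivative_mult C1_fun_has_derivative[OF Cb1_C1] assms c)
      then have e: "coord_deriv c (\<lambda>p. f p * g p) p v = f p * coord_deriv c g p v + g p * coord_deriv c f p v"
        by (simp add: p mult.commute)
      have "\<bar>coord_deriv c (\<lambda>p. f p * g p) p v\<bar> \<le> \<bar>f p\<bar> * \<bar>coord_deriv c g p v\<bar> + \<bar>g p\<bar> * \<bar>coord_deriv c f p v\<bar>"
        unfolding e by (rule order_trans[OF abs_triangle_ineq]) (simp add: abs_mult)
      also have "\<dots> \<le> B * (L' * chart_norm M p c v) + B' * (L * chart_norm M p c v)"
        by (intro add_mono mult_mono f g dboundD[OF f(3) c] dboundD[OF g(3) c] abs_ge_zero)
      finally show "\<bar>coord_deriv c (\<lambda>p. f p * g p) p v\<bar> \<le> (B * L' + B' * L) * chart_norm M p c v"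
        by (simp add: algebra_simps)
    qed
  qed
qed

lemma Cb1_scale: "f \<in> Cb1 M \<Longrightarrow> (\<lambda>p. r * f p) \<in> Cb1 M"
  by (rule Cb1_mult[OF Cb1_const])

lemma Cb1_diff: "f \<in> Cb1 M \<Longrightarrow> g \<in> Cb1 M \<Longrightarrow> (\<lambda>p. f p - g p) \<in> Cb1 M"
  using Cb1_add[OF _ Cb1_scale[of g "-1"]] by simp

text \<open>The range of \<open>f\<close> lies in a compact interval, on which \<open>k\<close> and
  \<open>k'\<close> are bounded. It is used for square roots, through which positivity becomes
  algebraic, and for inverses of functions bounded away from zero.\<close>

lemma Cb1_compose:
  fixes k k' :: "real \<Rightarrow> real"
  assumes f: "f \<in> Cb1 M" "\<And>p. f p \<in> {a..b}" and S: "{a..b} \<subseteq> S"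
    and k: "\<And>t. t \<in> S \<Longrightarrow> (k has_real_derivative k' t) (at t)" "continuous_on S k'"
  shows "(\<lambda>p. k (f p)) \<in> Cb1 M"
proof -
  obtain L where L: "L \<ge> 0" "dbound M f L" using Cb1E[OF f(1)] by metis
  have C1: "C1_fun M f" by (rule Cb1_C1[OF f(1)])
  have "compact (k ` {a..b})"
    by (intro compact_continuous_image continuous_at_imp_continuous_on) (use k(1) S DERIV_isCont in blast)+
  from compact_imp_bounded[OF this] obtain B where "\<forall>y\<in>k ` {a..b}. \<bar>y\<bar> \<le> B" unfolding bounded_real ..
  then have B: "\<And>t. t \<in> {a..b} \<Longrightarrow> \<bar>k t\<bar> \<le> B" by blast
  have "compact (k' ` {a..b})" by (intro compact_continuous_image continuous_on_subset[OF k(2) S]) simp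
  from compact_imp_bounded[OF this] obtain B' where "\<forall>y\<in>k' ` {a..b}. \<bar>y\<bar> \<le> B'" unfolding bounded_real ..
  then have B': "\<And>t. t \<in> {a..b} \<Longrightarrow> \<bar>k' t\<bar> \<le> B'" by blast
  have *: "(\<lambda>p. k (f p)) \<circ> inv_chart c = k \<circ> (f \<circ> inv_chart c)" for c :: "('p, 'h) chart" by auto
  have kC1: "C1_on S k" by (rule C1_on_real[OF k])
  show ?thesis
  proof (rule Cb1I[where B=B and L="B' * L"])
    show "C1_fun M (\<lambda>p. k (f p))"
      unfolding C1_fun_def * using f(2) S by (intro ballI C1_on_compose[OF C1_funD[OF C1] kC1]) auto
    show "\<bar>k (f p)\<bar> \<le> B" for p using B f(2) by blast
    show "dbound M (\<lambda>p. k (f p)) (B' * L)"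
      unfolding dbound_def
    proof (intro allI ballI)
      fix p c v assume c: "c \<in> charts_at M p"
      have p: "(f \<circ> inv_chart c) (map_chart c p) = f p" using c by (simp add: charts_at_def)
      have "(k has_derivative (*) (k' (f p))) (at ((f \<circ> inv_chart c) (map_chart c p)))"
        unfolding p using k(1)[OF subsetD[OF S f(2)[of p]]] by (simp add: has_field_derivative_def)
      from frechet_derivative_at[OF diff_chain_at[OF C1_fun_has_derivative[OF C1 c] this]]
      have "coord_deriv c (\<lambda>p. k (f p)) p v = k' (f p) * coord_deriv c f p v"
        unfolding * by (metis comp_apply)
      also have "\<bar>\<dots>\<bar> \<le> B' * (L * chart_norm M p c v)"
        unfolding abs_mult using B'[OF f(2)] dboundD[OF L(2) c, of v] by (intro mult_mono) (auto intro: order_trans[OF abs_ge_zero])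
      finally show "\<bar>coord_deriv c (\<lambda>p. k (f p)) p v\<bar> \<le> B' * L * chart_norm M p c v" by (simp add: mult.assoc)
    qed
  qed
qed

lemma Cb1_sqrt_inverse:
  assumes f: "f \<in> Cb1 M" and e: "e > 0" "\<And>p. f p \<ge> e"
  shows "(\<lambda>p. sqrt (f p)) \<in> Cb1 M" and "(\<lambda>p. inverse (f p)) \<in> Cb1 M"
proof -
  obtain B where B: "\<And>p. \<bar>f p\<bar> \<le> B" using Cb1E[OF f] by metis
  have r: "f p \<in> {e..B}" for p using e(2)[of p] B[of p] by auto
  have S: "{e..B} \<subseteq> {0<..}" using e by auto
  show "(\<lambda>p. sqrt (f p)) \<in> Cb1 M"
    by (rule Cb1_compose[OF f r S DERIV_real_sqrt]) (auto intro!: continuous_intros)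
  have "(inverse has_real_derivative - (inverse t ^ Suc (Suc 0))) (at t)" if "t \<in> {0<..}" for t :: real
    using that by (intro DERIV_inverse) auto
  then show "(\<lambda>p. inverse (f p)) \<in> Cb1 M"
    by (rule Cb1_compose[OF f r S]) (auto intro!: continuous_intros)
qed

section \<open>Local comparison of \<open>rho\<close> with the norm of the metric\<close>

lemma rho_upper:
  assumes "f \<in> Cb1 M" "Cb1_norm M f \<le> 1"
  shows "\<bar>f p - f q\<bar> \<le> rho M p q"
  unfolding rho_def
proof (rule cSUP_upper)
  show "bdd_above ((\<lambda>f. \<bar>f p - f q\<bar>) ` {f \<in> Cb1 M. Cb1_norm M f \<le> 1})"
  proof (rule bdd_aboveI2)
    fix f assume "f \<in> {f \<in> Cb1 M. Cb1_norm M f \<le> 1}"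
    then have "\<bar>f p\<bar> \<le> 1" "\<bar>f q\<bar> \<le> 1" using Cb1_norm_le_iff[of f 1] by auto
    then show "\<bar>f p - f q\<bar> \<le> 2" by linarith
  qed
qed (use assms in simp)

lemma rho_least:
  assumes "\<And>f. f \<in> Cb1 M \<Longrightarrow> Cb1_norm M f \<le> 1 \<Longrightarrow> \<bar>f p - f q\<bar> \<le> B"
  shows "rho M p q \<le> B"
  unfolding rho_def
proof (rule cSUP_least)
  have "dbound M (\<lambda>p. 0) 1" using Cb1E[OF Cb1_const[of 0]] chart_norm_nonneg
    unfolding dbound_def by (auto simp: o_def)
  then show "{f \<in> Cb1 M. Cb1_norm M f \<le> 1} \<noteq> {}" using Cb1_norm_le_iff[OF Cb1_const, of 1 0] Cb1_const[of 0] by auto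
qed (use assms in auto)

text \<open>At metric distance \<open>t\<close> from \<open>y\<close> the slope
  \<open>1 - C * t\<close> meets the factor \<open>1 + C * t\<close> for measuring vectors at the
  moving point, and the product is at most one. So the radial function lies in the unit ball
  although its norm is frozen at \<open>y\<close>.\<close>

lemma radial_extension:
  assumes c: "c \<in> charts_at M p"
  obtains R C0 where "R > 0" "C0 \<ge> 1" "cball (map_chart c p) R \<subseteq> coords c"
    "\<And>y C e. y \<in> cball (map_chart c p) R \<Longrightarrow> C \<ge> C0 \<Longrightarrow> e > 0 \<Longrightarrow>
       (\<lambda>q. if q \<in> dom_chart c then inner_form.radial (gram c y) C e y (map_chart c q) else 1 / (2 * C)) \<in> Cb1 M \<and>
       Cb1_norm M (\<lambda>q. if q \<in> dom_chart c then inner_form.radial (gram c y) C e y (map_chart c q) else 1 / (2 * C)) \<le> 1"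
proof -
  define x0 where "x0 = map_chart c p"
  have c': "c \<in> atlas M" using c by (simp add: charts_at_def)
  obtain R a b C1 where R: "R > 0" "a > 0" "b > 0" "C1 > 0" "cball x0 R \<subseteq> coords c"
    and cl: "\<And>K. closed K \<Longrightarrow> K \<subseteq> cball x0 R \<Longrightarrow> closed (inv_chart c ` K)"
    and bounds: "\<And>x v. x \<in> cball x0 R \<Longrightarrow> a * norm v \<le> cnorm c x v \<and> cnorm c x v \<le> b * norm v"
    and var: "\<And>x y v. x \<in> cball x0 R \<Longrightarrow> y \<in> cball x0 R \<Longrightarrow>
       cnorm c x v \<le> (1 + C1 * cnorm c y (x - y)) * cnorm c y v \<and>
       cnorm c y v \<le> (1 + C1 * cnorm c y (x - y)) * cnorm c x v"
    using nice_ball[OF c] unfolding x0_def by metis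
  \<comment> \<open>The entry \<open>1\<close> bounds the supremum \<open>1 / (2 * C)\<close> by
    one, \<open>C1\<close> serves the gradient estimate, and \<open>2 / (a * R)\<close> makes the
    radial function constant outside the ball of radius \<open>R / 2\<close> around
    \<open>y\<close>, so that it extends to the manifold.\<close>
  define C0 where "C0 = Max {1, C1, 2 / (a * R)}"
  have C0: "C0 \<ge> 1" "C0 \<ge> C1" "C0 \<ge> 2 / (a * R)" by (auto simp: C0_def)
  show ?thesis
  proof (rule that[of "R/2" C0, folded x0_def])
    show "R/2 > 0" using R by simp
    show "cball x0 (R/2) \<subseteq> coords c" using R subset_cball[of "R/2" R x0] by auto
    fix y C e assume y: "y \<in> cball x0 (R/2)" and C: "C \<ge> C0" and e: "e > (0::real)"
    have Cpos: "C > 0" "C \<ge> 1" using C C0 by auto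
    have K: "cball y (R/2) \<subseteq> cball x0 R"
    proof
      fix z assume "z \<in> cball y (R/2)"
      then show "z \<in> cball x0 R" using y dist_triangle[of x0 z y] by auto
    qed
    have yR: "y \<in> cball x0 R" by (rule subsetD[OF K]) (use R in simp)
    have yc: "y \<in> coords c" using yR R by blast
    interpret g: inner_form "gram c y" by (rule inner_form_gram[OF c' yc])
    have nrm: "g.nrm v = cnorm c y v" for v using cnorm_nrm[OF c' yc] by simp
    have "C * (a * R) \<ge> 2"
    proof -
      have "2 / (a * R) \<le> C" using C C0 by linarith
      then show ?thesis using R by (simp add: field_simps)
    qed
    then have aR: "1 / C \<le> a * (R / 2)" using Cpos by (simp add: field_simps)
    let ?F = "g.radial C e y"
    let ?f = "\<lambda>q. if q \<in> dom_chart c then ?F (map_chart c q) else 1 / (2 * C)"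
    have far: "?F x = 1 / (2 * C)" if "x \<in> coords c - cball y (R/2)" for x
    proof (rule g.radial_far[OF Cpos(1)])
      have "R / 2 \<le> norm (x - y)" using that by (auto simp: dist_norm norm_minus_commute)
      then have "a * (R / 2) \<le> a * norm (x - y)" using R by (intro mult_left_mono) auto
      also have "\<dots> \<le> g.nrm (x - y)" using bounds[OF yR] nrm by simp
      finally show "g.nrm (x - y) \<ge> 1 / C" using aR by linarith
    qed
    have grad: "\<bar>frechet_derivative ?F (at x) v\<bar> \<le> 1 * cnorm c x v" if x: "x \<in> cball y (R/2)" for x v
    proof -
      have xR: "x \<in> cball x0 R" using K x by blast
      define t where "t = cnorm c y (x - y)"
      have t: "t \<ge> 0" using g.nrm_nonneg nrm by (simp add: t_def)
      have xv: "0 \<le> cnorm c x v" using bounds[OF xR, of v] R by (smt (verit) mult_nonneg_nonneg norm_ge_zero)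
      have "\<bar>frechet_derivative ?F (at x) v\<bar> \<le> max 0 (1 - C * t) * cnorm c y v"
        using g.radial_derivative(2)[OF Cpos(1) e, of y x v] by (simp add: nrm t_def)
      also have "\<dots> \<le> max 0 (1 - C * t) * ((1 + C1 * t) * cnorm c x v)"
        using var[OF xR yR, of v] by (intro mult_left_mono) (auto simp: t_def)
      also have "\<dots> \<le> max 0 (1 - C * t) * ((1 + C * t) * cnorm c x v)"
        using C C0 t xv by (intro mult_left_mono mult_right_mono add_left_mono) auto
      also have "\<dots> = (max 0 (1 - C * t) * (1 + C * t)) * cnorm c x v" by simp
      also have "\<dots> \<le> 1 * cnorm c x v"
      proof (rule mult_right_mono[OF _ xv])
        have "(1 - C * t) * (1 + C * t) = 1 - (C * t)\<^sup>2" by (simp add: algebra_simps power2_eq_square)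
        then have "(1 - C * t) * (1 + C * t) \<le> 1" by simp
        then show "max 0 (1 - C * t) * (1 + C * t) \<le> 1" by (auto simp: max_def)
      qed
      finally show ?thesis .
    qed
    note ext = extension[OF c' closed_cball order_trans[OF K R(5)] cl[OF closed_cball K] C1_on_subset[OF g.radial_derivative(1)[OF Cpos(1) e, of y] subset_UNIV] far]
    have db: "dbound M ?f 1" by (rule ext(2)) (use grad in auto)
    have "1 / (2 * C) \<le> 1" using Cpos by (simp add: field_simps)
    moreover have "0 \<le> ?f q \<and> ?f q \<le> 1 / (2 * C)" for q
      using g.radial_bounds[OF Cpos(1), of e y "map_chart c q"] Cpos by simp
    ultimately have bd: "\<bar>?f q\<bar> \<le> 1" for q by (smt (verit))
    have "C1_fun M ?f" by (rule ext(1))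
    then have Cb: "?f \<in> Cb1 M" by (rule Cb1I[OF _ bd db])
    moreover have "Cb1_norm M ?f \<le> 1" using Cb1_norm_le_iff[OF Cb, of 1] bd db by simp
    ultimately show "?f \<in> Cb1 M \<and> Cb1_norm M ?f \<le> 1" by blast
  qed (use C0 in auto)
qed

text \<open>For the upper bound the mean value theorem produces a gradient at an intermediate point,
  and returning to the norm at \<open>y\<close> costs the factor \<open>1 + C * s\<close>. For the
  lower bound the loss is that of \<open>cone_ge\<close>. The norm is frozen at \<open>y\<close>, so
  the comparison is with a Hilbert norm, to which the parallelogram law applies.\<close>

lemma rho_local:
  assumes c: "c \<in> charts_at M p"
  obtains R a b C where "R > 0" "a > 0" "b > 0" "C > 0" "cball (map_chart c p) R \<subseteq> coords c"
    "\<And>x v. x \<in> cball (map_chart c p) R \<Longrightarrow> a * norm v \<le> cnorm c x v \<and> cnorm c x v \<le> b * norm v"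
    "\<And>x y v. x \<in> cball (map_chart c p) R \<Longrightarrow> y \<in> cball (map_chart c p) R \<Longrightarrow>
       cnorm c x v \<le> (1 + C * cnorm c y (x - y)) * cnorm c y v \<and>
       cnorm c y v \<le> (1 + C * cnorm c y (x - y)) * cnorm c x v"
    "\<And>x y. x \<in> cball (map_chart c p) R \<Longrightarrow> y \<in> cball (map_chart c p) R \<Longrightarrow>
       cnorm c y (x - y) - C * (cnorm c y (x - y))\<^sup>2 \<le> rho M (inv_chart c x) (inv_chart c y) \<and>
       rho M (inv_chart c x) (inv_chart c y) \<le> cnorm c y (x - y) + C * (cnorm c y (x - y))\<^sup>2"
proof -
  define x0 where "x0 = map_chart c p"
  have c': "c \<in> atlas M" using c by (simp add: charts_at_def)
  obtain R1 a b C1 where R1: "R1 > 0" "a > 0" "b > 0" "C1 > 0" "cball x0 R1 \<subseteq> coords c"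
    and bounds: "\<And>x v. x \<in> cball x0 R1 \<Longrightarrow> a * norm v \<le> cnorm c x v \<and> cnorm c x v \<le> b * norm v"
    and var: "\<And>x y v. x \<in> cball x0 R1 \<Longrightarrow> y \<in> cball x0 R1 \<Longrightarrow>
       cnorm c x v \<le> (1 + C1 * cnorm c y (x - y)) * cnorm c y v \<and>
       cnorm c y v \<le> (1 + C1 * cnorm c y (x - y)) * cnorm c x v"
    using nice_ball[OF c] unfolding x0_def by metis
  obtain R2 C0 where R2: "R2 > 0" "C0 \<ge> 1" "cball x0 R2 \<subseteq> coords c"
    and test: "\<And>y C e. y \<in> cball x0 R2 \<Longrightarrow> C \<ge> C0 \<Longrightarrow> e > 0 \<Longrightarrow>
       (\<lambda>q. if q \<in> dom_chart c then inner_form.radial (gram c y) C e y (map_chart c q) else 1 / (2 * C)) \<in> Cb1 M \<and>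
       Cb1_norm M (\<lambda>q. if q \<in> dom_chart c then inner_form.radial (gram c y) C e y (map_chart c q) else 1 / (2 * C)) \<le> 1"
    using that by (rule radial_extension[OF c, folded x0_def])
  define R C where "R = min R1 R2" and "C = max C0 C1"
  have R: "R > 0" "cball x0 R \<subseteq> cball x0 R1" "cball x0 R \<subseteq> cball x0 R2" using R1 R2 by (auto simp: R_def)
  have C: "C > 0" "C \<ge> C0" "C \<ge> C1" using R1 R2 by (auto simp: C_def)
  have var': "cnorm c x v \<le> (1 + C * cnorm c y (x - y)) * cnorm c y v \<and>
       cnorm c y v \<le> (1 + C * cnorm c y (x - y)) * cnorm c x v"
    if x: "x \<in> cball x0 R" and y: "y \<in> cball x0 R" for x y v
  proof -
    have x1: "x \<in> cball x0 R1" and y1: "y \<in> cball x0 R1" using x y R by blast+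
    have nn: "0 \<le> cnorm c z w" if "z \<in> cball x0 R1" for z w
      using bounds[OF that, of w] R1 by (smt (verit) mult_nonneg_nonneg norm_ge_zero)
    have "(1 + C1 * cnorm c y (x - y)) * w \<le> (1 + C * cnorm c y (x - y)) * w" if "w \<ge> 0" for w
      using that C nn[OF y1] by (intro mult_right_mono add_left_mono) auto
    then show ?thesis using var[OF x1 y1, of v] nn[OF y1, of v] nn[OF x1, of v] by (meson order_trans)
  qed
  have main: "cnorm c y (x - y) - C * (cnorm c y (x - y))\<^sup>2 \<le> rho M (inv_chart c x) (inv_chart c y) \<and>
       rho M (inv_chart c x) (inv_chart c y) \<le> cnorm c y (x - y) + C * (cnorm c y (x - y))\<^sup>2"
    if x: "x \<in> cball x0 R" and y: "y \<in> cball x0 R" for x y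
  proof
    have xc: "x \<in> coords c" and yc: "y \<in> coords c" using x y R R1 by blast+
    interpret g: inner_form "gram c y" by (rule inner_form_gram[OF c' yc])
    have nrm: "g.nrm v = cnorm c y v" for v using cnorm_nrm[OF c' yc] by simp
    define s where "s = cnorm c y (x - y)"
    have s: "s \<ge> 0" using g.nrm_nonneg nrm by (simp add: s_def)
    have sn: "g.nrm (x - y) = s" by (simp add: nrm s_def)
    have n0: "g.nrm 0 = 0" using g.nrm_scale[of 0 0] by simp
    have le: "cone C (sqrt (e\<^sup>2 + s\<^sup>2)) - cone C e \<le> rho M (inv_chart c x) (inv_chart c y)" if e: "e > 0" for e
    proof -
      have yR2: "y \<in> cball x0 R2" using y R by blast
      note f = test[OF yR2 C(2) e]
      have "\<bar>g.radial C e y x - g.radial C e y y\<bar> \<le> rho M (inv_chart c x) (inv_chart c y)"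
        using rho_upper[OF conjunct1[OF f] conjunct2[OF f], of "inv_chart c x" "inv_chart c y"] c' xc yc by simp
      moreover have "g.radial C e y y = cone C e" using e by (simp add: g.radial_def n0)
      moreover have "g.radial C e y x = cone C (sqrt (e\<^sup>2 + s\<^sup>2))" by (simp add: g.radial_def sn)
      ultimately show ?thesis by linarith
    qed
    have cc: "isCont (cone C) t" for t by (rule DERIV_isCont[OF cone_derivative[OF C(1)]])
    \<comment> \<open>The rounding parameter is removed here: every \<open>e > 0\<close> gives a
      lower bound for the same number \<open>rho\<close>.\<close>
    have "((\<lambda>e. cone C (sqrt (e\<^sup>2 + s\<^sup>2)) - cone C e) \<longlongrightarrow> cone C (sqrt (0\<^sup>2 + s\<^sup>2)) - cone C 0) (at_right 0)"
      by (intro tendsto_diff isCont_tendsto_compose[OF cc] tendsto_intros)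
    then have "cone C (sqrt (0\<^sup>2 + s\<^sup>2)) - cone C 0 \<le> rho M (inv_chart c x) (inv_chart c y)"
      by (rule tendsto_upperbound) (use le in \<open>auto simp: eventually_at_filter\<close>)
    then have "cone C s \<le> rho M (inv_chart c x) (inv_chart c y)" using s C by (simp add: cone_0)
    then show "cnorm c y (x - y) - C * (cnorm c y (x - y))\<^sup>2 \<le> rho M (inv_chart c x) (inv_chart c y)"
      using cone_ge[OF C(1) s] unfolding s_def by linarith
    show "rho M (inv_chart c x) (inv_chart c y) \<le> cnorm c y (x - y) + C * (cnorm c y (x - y))\<^sup>2"
    proof (rule rho_least)
      fix f assume f: "f \<in> Cb1 M" "Cb1_norm M f \<le> 1"
      then have db: "dbound M f 1" using Cb1_norm_le_iff[of f 1] by simp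
      define F where "F = f \<circ> inv_chart c"
      define D where "D t = frechet_derivative F (at (y + t *\<^sub>R (x - y))) (x - y)" for t
      have seg: "y + t *\<^sub>R (x - y) \<in> cball x0 R" if "0 \<le> t" "t \<le> 1" for t
      proof -
        have "y + t *\<^sub>R (x - y) = (1 - t) *\<^sub>R y + t *\<^sub>R x" by (simp add: algebra_simps)
        then show ?thesis using convexD[OF convex_cball y x, of "1 - t" t] that by simp
      qed
      have der: "((\<lambda>t. F (y + t *\<^sub>R (x - y))) has_real_derivative D t) (at t)" if "0 \<le> t" "t \<le> 1" for t
        unfolding D_def
        by (rule directional_derivative, rule C1_on_has_derivative[OF C1_funD[OF Cb1_C1[OF f(1)] c', folded F_def]])
          (use seg[OF that] R R1 in blast)
      obtain t where t: "0 < t" "t < 1" "F (y + 1 *\<^sub>R (x - y)) - F (y + 0 *\<^sub>R (x - y)) = (1 - 0) * D t"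
        using MVT2[of 0 1 "\<lambda>t. F (y + t *\<^sub>R (x - y))" D] der by auto
      define z where "z = y + t *\<^sub>R (x - y)"
      have zR: "z \<in> cball x0 R" using seg t by (simp add: z_def)
      have zc: "z \<in> coords c" using zR R R1 by blast
      have cz: "c \<in> charts_at M (inv_chart c z)" using zc c' by (simp add: charts_at_def)
      have "cnorm c y (z - y) = t * s" using g.nrm_scale[of t "x - y"] t by (simp add: z_def nrm s_def)
      then have "cnorm c z (x - y) \<le> (1 + C * (t * s)) * s" using var'[OF zR y, of "x - y"] by (simp add: s_def)
      also have "\<dots> \<le> (1 + C * (1 * s)) * s" using t s C by (intro mult_right_mono add_left_mono mult_left_mono) auto
      finally have zs: "cnorm c z (x - y) \<le> s + C * s\<^sup>2" by (simp add: algebra_simps power2_eq_square)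
      have "\<bar>D t\<bar> \<le> 1 * chart_norm M (inv_chart c z) c (x - y)"
        using dboundD[OF db cz, of "x - y"] c' zc by (simp add: D_def F_def z_def)
      then have "\<bar>D t\<bar> \<le> s + C * s\<^sup>2" using zs cnorm_chart_norm[OF c' zc] by simp
      then show "\<bar>f (inv_chart c x) - f (inv_chart c y)\<bar> \<le> cnorm c y (x - y) + C * (cnorm c y (x - y))\<^sup>2"
        using t(3) by (simp add: F_def s_def)
    qed
  qed
  show ?thesis
  proof (rule that[of R a b C, folded x0_def])
    show "cball x0 R \<subseteq> coords c" using R R1 by blast
    show "a * norm v \<le> cnorm c x v \<and> cnorm c x v \<le> b * norm v" if "x \<in> cball x0 R" for x v
      using bounds that R by blast
  qed (use R R1 C var' main in auto)
qed

text \<open>An inverted radial function. The uniform gap in the last clause turns the superlevel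
  sets of \<open>\<beta>\<close> into a neighbourhood base at \<open>p\<close>; without compactness
  a strict maximum alone would not give this.\<close>

lemma peak_function:
  assumes c: "c \<in> charts_at M p" and r: "r > 0"
  obtains \<beta> where "\<beta> \<in> Cb1 M" "0 < \<beta> p" "\<And>q. 0 \<le> \<beta> q" "\<And>q. \<beta> q \<le> \<beta> p"
    "\<And>q. \<beta> q \<noteq> 0 \<Longrightarrow> q \<in> dom_chart c \<and> map_chart c q \<in> cball (map_chart c p) r"
    "\<And>V. open V \<Longrightarrow> p \<in> V \<Longrightarrow> \<exists>\<delta>>0. \<forall>q. q \<notin> V \<longrightarrow> \<beta> q \<le> \<beta> p - \<delta>"
proof -
  define x0 where "x0 = map_chart c p"
  have c': "c \<in> atlas M" "p \<in> dom_chart c" using c by (auto simp: charts_at_def)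
  have x0c: "x0 \<in> coords c" using c' by (simp add: x0_def)
  obtain a b0 where a: "a > 0" "\<And>v. a * norm v \<le> cnorm c x0 v"
    using chart_norm_bounds[OF c] unfolding chart_norm_cnorm[OF c] x0_def by metis
  obtain R2 C0 where R2: "R2 > 0" "C0 \<ge> 1" "cball x0 R2 \<subseteq> coords c"
    and test: "\<And>y C e. y \<in> cball x0 R2 \<Longrightarrow> C \<ge> C0 \<Longrightarrow> e > 0 \<Longrightarrow>
       (\<lambda>q. if q \<in> dom_chart c then inner_form.radial (gram c y) C e y (map_chart c q) else 1 / (2 * C)) \<in> Cb1 M \<and>
       Cb1_norm M (\<lambda>q. if q \<in> dom_chart c then inner_form.radial (gram c y) C e y (map_chart c q) else 1 / (2 * C)) \<le> 1"
    using that by (rule radial_extension[OF c, folded x0_def])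
  interpret g: inner_form "gram c x0" by (rule inner_form_gram[OF c'(1) x0c])
  have nrm: "g.nrm v = cnorm c x0 v" for v using cnorm_nrm[OF c'(1) x0c] by simp
  \<comment> \<open>A slope constant of at least \<open>1 / (a * r)\<close> confines the support to
    the coordinate ball of radius \<open>r\<close>. The value of \<open>e\<close> lies below
    \<open>1 / C\<close>, where \<open>cone\<close> is still strictly increasing, so the peak is
    strict.\<close>
  define C e where "C = max C0 (1 / (a * r))" and "e = 1 / (2 * C)"
  have C: "C > 0" "C \<ge> C0" "1 / C \<le> a * r"
  proof -
    show "C > 0" "C \<ge> C0" using R2 by (auto simp: C_def)
    have "1 / (a * r) \<le> C" by (simp add: C_def)
    then show "1 / C \<le> a * r" using a r \<open>C > 0\<close> by (simp add: field_simps)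
  qed
  have e: "e > 0" "e < 1 / C" using C by (auto simp: e_def field_simps)
  let ?F = "g.radial C e x0"
  let ?f = "\<lambda>q. if q \<in> dom_chart c then ?F (map_chart c q) else 1 / (2 * C)"
  have f: "?f \<in> Cb1 M" using test[OF _ C(2) e(1), of x0] R2 by simp
  define \<beta> where "\<beta> q = 1 / (2 * C) - ?f q" for q
  have n0: "g.nrm 0 = 0" using g.nrm_scale[of 0 0] by simp
  have fp: "?f p = cone C e" using c' e by (simp add: g.radial_def n0 flip: x0_def)
  have ge: "?f q \<ge> cone C (sqrt (e\<^sup>2 + (a * s)\<^sup>2))"
    if "0 \<le> s" "q \<in> dom_chart c \<Longrightarrow> norm (map_chart c q - x0) \<ge> s" for q s
  proof (cases "q \<in> dom_chart c")
    case True
    have "a * s \<le> a * norm (map_chart c q - x0)" using that(2)[OF True] a by (intro mult_left_mono) auto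
    also have "\<dots> \<le> g.nrm (map_chart c q - x0)" using a(2) nrm by simp
    finally have "(a * s)\<^sup>2 \<le> (g.nrm (map_chart c q - x0))\<^sup>2" using a that by (intro power_mono) auto
    then show ?thesis using True C(1) by (auto simp: g.radial_def intro!: cone_mono)
  qed (use cone_le[OF C(1)] in simp)
  show ?thesis
  proof (rule that[of \<beta>, folded x0_def])
    show "\<beta> \<in> Cb1 M" unfolding \<beta>_def by (rule Cb1_diff[OF Cb1_const f])
    have "cone C e < cone C (1 / C)" by (rule cone_strict_mono[OF C(1) e(2) e(2)])
    then show "0 < \<beta> p" using fp cone_far[OF C(1), of "1 / C"] by (simp add: \<beta>_def)
    show "0 \<le> \<beta> q" for q using g.radial_bounds[OF C(1), of e x0 "map_chart c q"] by (simp add: \<beta>_def)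
    show "\<beta> q \<le> \<beta> p" for q using ge[of 0 q] fp e by (simp add: \<beta>_def)
    show "q \<in> dom_chart c \<and> map_chart c q \<in> cball x0 r" if "\<beta> q \<noteq> 0" for q
    proof -
      have q: "q \<in> dom_chart c"
      proof (rule ccontr)
        assume "q \<notin> dom_chart c"
        then show False using that by (simp add: \<beta>_def)
      qed
      have "g.nrm (map_chart c q - x0) < 1 / C"
      proof (rule ccontr)
        assume "\<not> g.nrm (map_chart c q - x0) < 1 / C"
        then show False using g.radial_far[OF C(1), of "map_chart c q" x0 e] that q by (simp add: \<beta>_def)
      qed
      then have "a * norm (map_chart c q - x0) \<le> a * r" using a(2)[of "map_chart c q - x0"] nrm C(3) by (smt (verit))
      then have "norm (map_chart c q - x0) \<le> r" using a(1) by simp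
      then show ?thesis using q by (simp add: dist_norm norm_minus_commute)
    qed
    fix V assume V: "open V" "p \<in> V"
    have "open (map_chart c ` (dom_chart c \<inter> V))" by (intro open_map_chart_image c' open_Int open_dom V) auto
    moreover have "x0 \<in> map_chart c ` (dom_chart c \<inter> V)" using V c' by (auto simp: x0_def)
    ultimately obtain s where s: "s > 0" "ball x0 s \<subseteq> map_chart c ` (dom_chart c \<inter> V)" by (meson openE)
    define \<delta> where "\<delta> = cone C (sqrt (e\<^sup>2 + (a * s)\<^sup>2)) - cone C e"
    have "sqrt (e\<^sup>2) < sqrt (e\<^sup>2 + (a * s)\<^sup>2)" using a s by (intro real_sqrt_less_mono) simp
    then have "\<delta> > 0" using cone_strict_mono[OF C(1) _ e(2)] e by (simp add: \<delta>_def)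
    moreover have "\<beta> q \<le> \<beta> p - \<delta>" if q: "q \<notin> V" for q
    proof -
      have "norm (map_chart c q - x0) \<ge> s" if qd: "q \<in> dom_chart c"
      proof (rule ccontr)
        assume "\<not> norm (map_chart c q - x0) \<ge> s"
        then have "map_chart c q \<in> map_chart c ` (dom_chart c \<inter> V)" using s(2) by (auto simp: dist_norm norm_minus_commute)
        then obtain q' where "q' \<in> dom_chart c" "q' \<in> V" "map_chart c q = map_chart c q'" by blast
        then show False using q qd inv_chart_map[OF c'(1)] by metis
      qed
      then show ?thesis using ge[of s q] s(1) fp by (simp add: \<beta>_def \<delta>_def)
    qed
    ultimately show "\<exists>\<delta>>0. \<forall>q. q \<notin> V \<longrightarrow> \<beta> q \<le> \<beta> p - \<delta>" by blast
  qed
qed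

text \<open>The factor \<open>\<beta>\<close> vanishes off \<open>K\<close>, so the product extends
  by zero; the product rule bounds its gradient, with \<open>a\<close> converting the Hilbert norm
  into the metric norm.\<close>

lemma localized_function:
  assumes c: "c \<in> atlas M" and K: "closed K" "K \<subseteq> coords c" "closed (inv_chart c ` K)"
    and a: "a > 0" "\<And>x v. x \<in> K \<Longrightarrow> a * norm v \<le> cnorm c x v"
    and \<beta>: "\<beta> \<in> Cb1 M" "\<And>q. \<beta> q \<noteq> 0 \<Longrightarrow> q \<in> dom_chart c \<and> map_chart c q \<in> K"
    and F: "C1_on UNIV F" "\<And>x. 0 \<le> F x \<and> F x \<le> (1::real)" "\<And>x v. \<bar>frechet_derivative F (at x) v\<bar> \<le> L * norm v"
  shows "(\<lambda>q. \<beta> q * F (map_chart c q)) \<in> Cb1 M"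
proof -
  obtain B B' where B: "B \<ge> 0" "B' \<ge> 0" "\<And>q. \<bar>\<beta> q\<bar> \<le> B" "dbound M \<beta> B'" using Cb1E[OF \<beta>(1)] by metis
  define H where "H x = (\<beta> \<circ> inv_chart c) x * F x" for x
  have HC1: "C1_on (coords c) H"
    unfolding H_def by (intro C1_on_mult C1_funD Cb1_C1 \<beta> c C1_on_subset[OF F(1)]) auto
  have H0: "H x = 0" if "x \<in> coords c - K" for x using that \<beta>(2)[of "inv_chart c x"] c by (auto simp: H_def)
  have eq: "(\<lambda>q. \<beta> q * F (map_chart c q)) = (\<lambda>q. if q \<in> dom_chart c then H (map_chart c q) else 0)"
    using \<beta>(2) c by (auto simp: H_def fun_eq_iff)
  have grad: "\<bar>frechet_derivative H (at x) v\<bar> \<le> (B' + B * (\<bar>L\<bar> / a)) * cnorm c x v" if x: "x \<in> K" for x v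
  proof -
    have xc: "x \<in> coords c" using x K by blast
    have cx: "c \<in> charts_at M (inv_chart c x)" using xc c by (simp add: charts_at_def)
    have d1: "(\<beta> \<circ> inv_chart c has_derivative coord_deriv c \<beta> (inv_chart c x)) (at x)"
      using C1_fun_has_derivative[OF Cb1_C1[OF \<beta>(1)] cx] c xc by simp
    have d2: "(F has_derivative frechet_derivative F (at x)) (at x)" by (rule C1_on_has_derivative[OF F(1)]) simp
    have e: "frechet_derivative H (at x) v = (\<beta> \<circ> inv_chart c) x * frechet_derivative F (at x) v + coord_deriv c \<beta> (inv_chart c x) v * F x"
      unfolding H_def by (subst frechet_derivative_at[OF has_derivative_mult[OF d1 d2], symmetric]) simp
    have "\<bar>frechet_derivative H (at x) v\<bar> \<le> \<bar>\<beta> (inv_chart c x)\<bar> * \<bar>frechet_derivative F (at x) v\<bar> + \<bar>coord_deriv c \<beta> (inv_chart c x) v\<bar> * \<bar>F x\<bar>"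
      unfolding e by (rule order_trans[OF abs_triangle_ineq]) (simp add: abs_mult)
    also have "\<dots> \<le> B * (\<bar>L\<bar> / a * cnorm c x v) + (B' * cnorm c x v) * 1"
    proof (intro add_mono mult_mono B abs_ge_zero)
      have "\<bar>frechet_derivative F (at x) v\<bar> \<le> \<bar>L\<bar> * norm v"
        using F(3)[of x v] mult_right_mono[OF abs_ge_self norm_ge_zero, of L v] by linarith
      also have "\<dots> \<le> \<bar>L\<bar> * (cnorm c x v / a)" using a(2)[OF x, of v] a(1) by (intro mult_left_mono) (auto simp: field_simps)
      finally show "\<bar>frechet_derivative F (at x) v\<bar> \<le> \<bar>L\<bar> / a * cnorm c x v" by simp
      show "\<bar>coord_deriv c \<beta> (inv_chart c x) v\<bar> \<le> B' * cnorm c x v"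
        using dboundD[OF B(4) cx, of v] c xc by (simp add: cnorm_chart_norm)
      show "\<bar>F x\<bar> \<le> 1" using F(2)[of x] by simp
      show "0 \<le> B' * cnorm c x v" using B(2) a(1) a(2)[OF x, of v] by (smt (verit) mult_nonneg_nonneg norm_ge_zero)
    qed
    finally show ?thesis by (simp add: algebra_simps)
  qed
  have pos: "0 \<le> B' + B * (\<bar>L\<bar> / a)" using B a by simp
  note ext = extension[OF c K HC1 H0, folded eq]
  have bd: "\<bar>\<beta> q * F (map_chart c q)\<bar> \<le> B * 1" for q
    unfolding abs_mult using F(2)[of "map_chart c q"] B by (intro mult_mono) auto
  have "dbound M (\<lambda>q. \<beta> q * F (map_chart c q)) (B' + B * (\<bar>L\<bar> / a))" by (rule ext(2)[OF _ grad pos])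
  moreover have "C1_fun M (\<lambda>q. \<beta> q * F (map_chart c q))" by (rule ext(1))
  ultimately show ?thesis using bd by (intro Cb1I)
qed

text \<open>The last clause says that a character of the algebra which is a limit of a sequence of points,
  and which does not vanish at \<open>\<beta>\<close>, is itself evaluation at a point.\<close>

lemma localizing_bump:
  assumes c: "c \<in> charts_at M p" and r: "r > 0"
  obtains \<beta> where "\<beta> \<in> Cb1 M" "0 < \<beta> p"
    "\<And>q. \<beta> q \<noteq> 0 \<Longrightarrow> q \<in> dom_chart c \<and> map_chart c q \<in> cball (map_chart c p) r"
    "\<forall>X l. (\<forall>f\<in>Cb1 M. convergent (\<lambda>n. f (X n))) \<longrightarrow> (\<lambda>n. \<beta> (X n)) \<longlonglongrightarrow> l \<longrightarrow> l > 0 \<longrightarrow> (\<exists>x. X \<longlonglongrightarrow> x)"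
proof -
  define x0 where "x0 = map_chart c p"
  have c': "c \<in> atlas M" using c by (simp add: charts_at_def)
  obtain R a b C1 where R: "R > 0" "a > 0" "cball x0 R \<subseteq> coords c"
    and cl: "\<And>K. closed K \<Longrightarrow> K \<subseteq> cball x0 R \<Longrightarrow> closed (inv_chart c ` K)"
    and bounds: "\<And>x v. x \<in> cball x0 R \<Longrightarrow> a * norm v \<le> cnorm c x v \<and> cnorm c x v \<le> b * norm v"
    using nice_ball[OF c] unfolding x0_def by metis
  define s where "s = min r R"
  have s: "s > 0" "s \<le> r" "cball x0 s \<subseteq> cball x0 R" using r R by (auto simp: s_def)
  obtain \<beta> where \<beta>: "\<beta> \<in> Cb1 M" "0 < \<beta> p"
    "\<And>q. \<beta> q \<noteq> 0 \<Longrightarrow> q \<in> dom_chart c \<and> map_chart c q \<in> cball x0 s"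
    using peak_function[OF c s(1)] unfolding x0_def by metis
  show ?thesis
  proof (rule that[of \<beta>, folded x0_def])
    show "\<beta> \<in> Cb1 M" "0 < \<beta> p" by (fact \<beta>)+
    show "q \<in> dom_chart c \<and> map_chart c q \<in> cball x0 r" if "\<beta> q \<noteq> 0" for q
      using \<beta>(3)[OF that] s(2) by auto
    show "\<forall>X l. (\<forall>f\<in>Cb1 M. convergent (\<lambda>n. f (X n))) \<longrightarrow> (\<lambda>n. \<beta> (X n)) \<longlonglongrightarrow> l \<longrightarrow> l > 0 \<longrightarrow> (\<exists>x. X \<longlonglongrightarrow> x)"
    proof (intro allI impI)
      fix X l assume conv: "\<forall>f\<in>Cb1 M. convergent (\<lambda>n. f (X n))" and l: "(\<lambda>n. \<beta> (X n)) \<longlonglongrightarrow> l" "l > 0"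
      have ev: "\<forall>\<^sub>F n in sequentially. \<beta> (X n) > 0" using l by (rule order_tendstoD)
      define \<xi> where "\<xi> n = map_chart c (X n)" for n
      have "Cauchy \<xi>"
      proof (rule Cauchy_if_C1_convergent)
        fix F :: "'h \<Rightarrow> real" and L assume F: "C1_on UNIV F" "\<And>x. 0 \<le> F x \<and> F x \<le> (1::real)" "\<And>x v. \<bar>frechet_derivative F (at x) v\<bar> \<le> L * norm v"
        have "(\<lambda>q. \<beta> q * F (map_chart c q)) \<in> Cb1 M"
        proof (rule localized_function[OF c' closed_cball _ cl[OF closed_cball s(3)] R(2) _ \<beta>(1,3) F])
          show "cball x0 s \<subseteq> coords c" using s R by blast
          show "a * norm v \<le> cnorm c x v" if "x \<in> cball x0 s" for x v using bounds that s by blast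
        qed
        from conv[rule_format, OF this] obtain m where "(\<lambda>n. \<beta> (X n) * F (\<xi> n)) \<longlonglongrightarrow> m" by (auto simp: convergent_def \<xi>_def)
        \<comment> \<open>The localizing factor is divided out again, which is possible because its
          limit \<open>l\<close> is positive. So every coordinate test function converges along the
          sequence, as the hump argument requires.\<close>
        then have "(\<lambda>n. \<beta> (X n) * F (\<xi> n) / \<beta> (X n)) \<longlonglongrightarrow> m / l" using l by (intro tendsto_divide) auto
        moreover have "\<forall>\<^sub>F n in sequentially. \<beta> (X n) * F (\<xi> n) / \<beta> (X n) = F (\<xi> n)"
          using ev by eventually_elim simp
        ultimately have "(\<lambda>n. F (\<xi> n)) \<longlonglongrightarrow> m / l" by (rule Lim_transform_eventually)
        then show "convergent (\<lambda>n. F (\<xi> n))" by (auto simp: convergent_def)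
      qed
      then obtain y where y: "\<xi> \<longlonglongrightarrow> y" using Cauchy_convergent_iff convergent_def by blast
      have "\<forall>\<^sub>F n in sequentially. X n \<in> dom_chart c \<and> \<xi> n \<in> cball x0 s"
        using ev by eventually_elim (use \<beta>(3) in \<open>auto simp: \<xi>_def\<close>)
      then have ev2: "\<forall>\<^sub>F n in sequentially. \<xi> n \<in> cball x0 s" and ev3: "\<forall>\<^sub>F n in sequentially. inv_chart c (\<xi> n) = X n"
        by (auto elim: eventually_mono simp: \<xi>_def c')
      \<comment> \<open>The limit stays in a closed ball inside the coordinate domain, where the
        inverse chart is continuous and carries the limit back to the manifold.\<close>
      have "y \<in> cball x0 s" by (rule Lim_in_closed_set[OF closed_cball ev2 _ y]) simp
      then have "y \<in> coords c" using s R by blast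
      then have "isCont (inv_chart c) y"
        using continuous_on_inv_chart[OF c'] unfolding continuous_on_eq_continuous_at[OF open_coords[OF c']] by blast
      then have "(\<lambda>n. inv_chart c (\<xi> n)) \<longlonglongrightarrow> inv_chart c y" by (rule isCont_tendsto_compose[OF _ y])
      then have "X \<longlonglongrightarrow> inv_chart c y" by (rule Lim_transform_eventually[OF _ ev3])
      then show "\<exists>x. X \<longlonglongrightarrow> x" by blast
    qed
  qed
qed

end

section \<open>The correspondence of points given by an isomorphism\<close>

context riem_manifold
begin

lemma Cb1_separates:
  assumes "\<And>f. f \<in> Cb1 M \<Longrightarrow> f p = f q"
  shows "p = q"
proof (rule ccontr)
  assume "p \<noteq> q"
  then obtain V where V: "open V" "p \<in> V" "q \<notin> V" using t1_space by blast
  obtain c where c: "c \<in> charts_at M p" using chart_exists by blast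
  obtain \<beta> where "\<beta> \<in> Cb1 M" "\<exists>\<delta>>0. \<forall>q. q \<notin> V \<longrightarrow> \<beta> q \<le> \<beta> p - \<delta>"
    using peak_function[OF c zero_less_one] V by metis
  then show False using assms[of \<beta>] V(3) by fastforce
qed

end

text \<open>The inverse \<open>S\<close> is a parameter and every law is listed for both maps, so
  the situation is symmetric and each result is available with the manifolds exchanged.\<close>

locale Cb1_dual = M: riem_manifold M + N: riem_manifold N
  for M :: "('p::t2_space, 'h::{real_inner, complete_space}) manifold"
    and N :: "('q::t2_space, 'k::{real_inner, complete_space}) manifold" +
  fixes T :: "('q \<Rightarrow> real) \<Rightarrow> 'p \<Rightarrow> real" and S :: "('p \<Rightarrow> real) \<Rightarrow> 'q \<Rightarrow> real"
  assumes complete_M: "complete_manifold M" and complete_N: "complete_manifold N"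
    and T_Cb1: "\<And>f. f \<in> Cb1 N \<Longrightarrow> T f \<in> Cb1 M" and S_Cb1: "\<And>g. g \<in> Cb1 M \<Longrightarrow> S g \<in> Cb1 N"
    and ST: "\<And>f. f \<in> Cb1 N \<Longrightarrow> S (T f) = f" and TS: "\<And>g. g \<in> Cb1 M \<Longrightarrow> T (S g) = g"
    and T_add: "\<And>f f'. f \<in> Cb1 N \<Longrightarrow> f' \<in> Cb1 N \<Longrightarrow> T (\<lambda>x. f x + f' x) = (\<lambda>x. T f x + T f' x)"
    and S_add: "\<And>g g'. g \<in> Cb1 M \<Longrightarrow> g' \<in> Cb1 M \<Longrightarrow> S (\<lambda>x. g x + g' x) = (\<lambda>x. S g x + S g' x)"
    and T_scale: "\<And>r f. f \<in> Cb1 N \<Longrightarrow> T (\<lambda>x. r * f x) = (\<lambda>x. r * T f x)"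
    and S_scale: "\<And>r g. g \<in> Cb1 M \<Longrightarrow> S (\<lambda>x. r * g x) = (\<lambda>x. r * S g x)"
    and T_mult: "\<And>f f'. f \<in> Cb1 N \<Longrightarrow> f' \<in> Cb1 N \<Longrightarrow> T (\<lambda>x. f x * f' x) = (\<lambda>x. T f x * T f' x)"
    and S_mult: "\<And>g g'. g \<in> Cb1 M \<Longrightarrow> g' \<in> Cb1 M \<Longrightarrow> S (\<lambda>x. g x * g' x) = (\<lambda>x. S g x * S g' x)"
    and T_norm: "\<And>f. f \<in> Cb1 N \<Longrightarrow> Cb1_norm M (T f) = Cb1_norm N f"
    and S_norm: "\<And>g. g \<in> Cb1 M \<Longrightarrow> Cb1_norm N (S g) = Cb1_norm M g"

lemma (in Cb1_dual) swap: "Cb1_dual N M S T"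
  by unfold_locales (rule complete_N, rule complete_M, erule S_Cb1, erule T_Cb1, erule TS, erule ST,
    erule (1) S_add, erule (1) T_add, erule S_scale, erule T_scale, erule (1) S_mult, erule (1) T_mult,
    erule S_norm, erule T_norm)

context Cb1_dual
begin

lemma S_one: "S (\<lambda>x. 1) = (\<lambda>y. 1)"
proof -
  have "(\<lambda>y. 1) = S (T (\<lambda>y. 1))" by (simp add: ST N.Cb1_const)
  also have "\<dots> = S (\<lambda>x. T (\<lambda>y. 1) x * 1)" by simp
  also have "\<dots> = (\<lambda>y. S (T (\<lambda>y. 1)) y * S (\<lambda>x. 1) y)" by (rule S_mult[OF T_Cb1[OF N.Cb1_const] M.Cb1_const])
  also have "\<dots> = S (\<lambda>x. 1)" by (simp add: ST N.Cb1_const)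
  finally show ?thesis by simp
qed

lemma S_const: "S (\<lambda>x. k) = (\<lambda>y. k)"
  using S_scale[OF M.Cb1_const[of 1], of k] by (simp add: S_one)

lemma T_const: "T (\<lambda>y. k) = (\<lambda>x. k)"
  using TS[OF M.Cb1_const[of k]] by (simp add: S_const)

lemma S_diff: "g \<in> Cb1 M \<Longrightarrow> g' \<in> Cb1 M \<Longrightarrow> S (\<lambda>x. g x - g' x) = (\<lambda>x. S g x - S g' x)"
  using S_add[OF _ M.Cb1_scale[of g' "-1"], of g] S_scale[of g' "-1"] by simp

text \<open>Positivity is algebraic, since \<open>g + \<epsilon>\<close> is a square for nonnegative \<open>g\<close>.\<close>

lemma S_nonneg:
  assumes g: "g \<in> Cb1 M" "\<And>x. g x \<ge> 0"
  shows "S g y \<ge> 0"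
proof (rule field_le_epsilon)
  fix e :: real assume e: "e > 0"
  have ge: "(\<lambda>x. g x + e) \<in> Cb1 M" by (rule M.Cb1_add[OF g(1) M.Cb1_const])
  define r where "r = (\<lambda>x. sqrt (g x + e))"
  have r: "r \<in> Cb1 M" unfolding r_def by (rule M.Cb1_sqrt_inverse(1)[OF ge e]) (use g(2) in simp)
  have "(\<lambda>x. r x * r x) = (\<lambda>x. g x + e)" using g(2) e by (auto simp: r_def add_nonneg_nonneg)
  then have "(\<lambda>y. S r y * S r y) = (\<lambda>y. S g y + e)"
    using S_mult[OF r r] S_add[OF g(1) M.Cb1_const[of e]] by (simp add: S_const)
  then have "S g y + e = S r y * S r y" by metis
  then show "0 \<le> S g y + e" by simp
qed

definition related :: "'p \<Rightarrow> 'q \<Rightarrow> bool" where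
  "related x y \<longleftrightarrow> (\<forall>f\<in>Cb1 N. T f x = f y)"

lemma relatedD: "related x y \<Longrightarrow> f \<in> Cb1 N \<Longrightarrow> T f x = f y"
  by (simp add: related_def)

lemma related_iff: "related x y \<longleftrightarrow> (\<forall>g\<in>Cb1 M. S g y = g x)"
  unfolding related_def
proof (intro iffI ballI)
  fix g assume "\<forall>f\<in>Cb1 N. T f x = f y" and g: "g \<in> Cb1 M"
  from bspec[OF this(1) S_Cb1[OF g]] show "S g y = g x" by (simp only: TS[OF g])
next
  fix f assume "\<forall>g\<in>Cb1 M. S g y = g x" and f: "f \<in> Cb1 N"
  from bspec[OF this(1) T_Cb1[OF f]] show "T f x = f y" by (simp only: ST[OF f])
qed

text \<open>A single function \<open>a\<close>, vanishing at \<open>p\<close> and bounded below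
  outside each neighbourhood of \<open>p\<close>, selects the sequence; it then works for all
  \<open>f\<close> at once.\<close>

lemma approximating_sequence:
  obtains Y where "\<And>f. f \<in> Cb1 N \<Longrightarrow> (\<lambda>n::nat. f (Y n)) \<longlonglongrightarrow> T f p"
proof -
  obtain c where c: "c \<in> charts_at M p" using M.chart_exists by blast
  obtain \<beta> where \<beta>: "\<beta> \<in> Cb1 M" "\<And>q. \<beta> q \<le> \<beta> p"
    and base: "\<And>V. open V \<Longrightarrow> p \<in> V \<Longrightarrow> \<exists>\<delta>>0. \<forall>q. q \<notin> V \<longrightarrow> \<beta> q \<le> \<beta> p - \<delta>"
    using M.peak_function[OF c zero_less_one] by metis
  define a where "a = (\<lambda>x. \<beta> p - \<beta> x)"
  have a: "a \<in> Cb1 M" "\<And>x. a x \<ge> 0" "a p = 0"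
    unfolding a_def using \<beta> by (auto intro: M.Cb1_diff M.Cb1_const)
  \<comment> \<open>If \<open>S a\<close> were bounded away from zero, its inverse would belong to
    the algebra and \<open>T\<close> would make \<open>a\<close> invertible, contrary to
    \<open>a p = 0\<close>.\<close>
  have "\<exists>y. S a y < 1 / real (Suc n)" for n
  proof (rule ccontr)
    assume "\<nexists>y. S a y < 1 / real (Suc n)"
    then have ge: "S a y \<ge> 1 / real (Suc n)" for y by (simp add: not_less)
    have pos: "0 < 1 / real (Suc n)" by simp
    have inv: "(\<lambda>y. inverse (S a y)) \<in> Cb1 N" by (rule N.Cb1_sqrt_inverse(2)[OF S_Cb1[OF a(1)] pos ge])
    have "(\<lambda>y. S a y * inverse (S a y)) = (\<lambda>y. 1)"
    proof
      fix y
      have "S a y \<noteq> 0" using ge[of y] pos by linarith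
      then show "S a y * inverse (S a y) = 1" by simp
    qed
    then have "(\<lambda>x. T (S a) x * T (\<lambda>y. inverse (S a y)) x) = (\<lambda>x. 1)"
      using T_mult[OF S_Cb1[OF a(1)] inv] by (simp add: T_const)
    then have "a p * T (\<lambda>y. inverse (S a y)) p = 1" using TS[OF a(1)] by metis
    then show False using a(3) by simp
  qed
  then obtain Y where Y: "\<And>n. S a (Y n) < 1 / real (Suc n)" by metis
  show ?thesis
  proof (rule that[of Y])
    fix f assume f: "f \<in> Cb1 N"
    define k where "k = T f p"
    define d where "d = (\<lambda>x. T f x - k)"
    have d: "d \<in> Cb1 M" unfolding d_def by (rule M.Cb1_diff[OF T_Cb1[OF f] M.Cb1_const])
    define u where "u = (\<lambda>x. d x * d x)"
    have u: "u \<in> Cb1 M" unfolding u_def by (rule M.Cb1_mult[OF d d])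
    have Sd: "S d = (\<lambda>y. f y - k)"
      unfolding d_def using S_diff[OF T_Cb1[OF f] M.Cb1_const[of k]] by (simp add: S_const ST f)
    have Su: "S u = (\<lambda>y. (f y - k) * (f y - k))"
      unfolding u_def using S_mult[OF d d] Sd by simp
    obtain K where K: "K \<ge> 0" "\<And>x. \<bar>u x\<bar> \<le> K" using M.Cb1E[OF u] by metis
    \<comment> \<open>On a neighbourhood of \<open>p\<close> the function \<open>u\<close> is below
      \<open>e\<close>, and outside it a multiple of \<open>a\<close> dominates \<open>u\<close>.
      This inequality between functions on \<open>M\<close> is transported to \<open>N\<close> by
      positivity. The factor \<open>L\<close> depends on \<open>e\<close> and \<open>f\<close>, but
      along the sequence \<open>S a\<close> tends to zero.\<close>
    have bound: "\<exists>L. \<forall>y. (f y - k)\<^sup>2 \<le> e + L * S a y" if e: "e > 0" for e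
    proof -
      define V where "V = {x. u x < e}"
      have "open V" unfolding V_def
        by (rule open_Collect_less[OF M.Cb1_continuous[OF u] continuous_on_const])
      moreover have "p \<in> V" using e by (simp add: V_def u_def d_def k_def)
      ultimately obtain \<delta> where \<delta>: "\<delta> > 0" "\<And>q. q \<notin> V \<Longrightarrow> a q \<ge> \<delta>"
        using base[of V] unfolding a_def by (smt (verit))
      define w where "w = (\<lambda>x. (e + (K / \<delta>) * a x) - u x)"
      have w1: "(\<lambda>x. (K / \<delta>) * a x) \<in> Cb1 M" by (rule M.Cb1_scale[OF a(1)])
      have w2: "(\<lambda>x. e + (K / \<delta>) * a x) \<in> Cb1 M" by (rule M.Cb1_add[OF M.Cb1_const w1])
      have w: "w \<in> Cb1 M" unfolding w_def by (rule M.Cb1_diff[OF w2 u])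
      have "w x \<ge> 0" for x
      proof (cases "x \<in> V")
        case True
        have "0 \<le> (K / \<delta>) * a x" using K \<delta> a(2)[of x] by simp
        then show ?thesis using True by (simp add: w_def V_def)
      next
        case False
        have "K = (K / \<delta>) * \<delta>" using \<delta> by simp
        also have "\<dots> \<le> (K / \<delta>) * a x" using K \<delta>(1) \<delta>(2)[OF False] by (intro mult_left_mono) auto
        finally show ?thesis using K(2)[of x] e by (simp add: w_def)
      qed
      then have "S w y \<ge> 0" for y by (rule S_nonneg[OF w])
      moreover have "S w = (\<lambda>y. (e + (K / \<delta>) * S a y) - (f y - k) * (f y - k))"
        unfolding w_def using S_diff[OF w2 u] S_add[OF M.Cb1_const[of e] w1] S_scale[OF a(1), of "K / \<delta>"] Su
        by (simp add: S_const)
      ultimately show ?thesis by (intro exI[of _ "K / \<delta>"]) (simp add: power2_eq_square)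
    qed
    have "(\<lambda>n. f (Y n)) \<longlonglongrightarrow> k"
    proof (rule metric_LIMSEQ_I)
      fix r :: real assume r: "r > 0"
      obtain L where L: "\<And>y. (f y - k)\<^sup>2 \<le> r\<^sup>2 / 2 + L * S a y" using bound[of "r\<^sup>2 / 2"] r by auto
      have "(\<lambda>n. \<bar>L\<bar> * (1 / real (Suc n))) \<longlonglongrightarrow> \<bar>L\<bar> * 0"
        by (intro tendsto_mult tendsto_const LIMSEQ_Suc[OF lim_1_over_n])
      then have "\<forall>\<^sub>F n in sequentially. \<bar>L\<bar> * (1 / real (Suc n)) < r\<^sup>2 / 2"
        by (rule order_tendstoD) (use r in simp)
      then obtain n0 where n0: "\<And>n. n \<ge> n0 \<Longrightarrow> \<bar>L\<bar> * (1 / real (Suc n)) < r\<^sup>2 / 2" unfolding eventually_sequentially by blast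
      have "dist (f (Y n)) k < r" if "n \<ge> n0" for n
      proof -
        have "L * S a (Y n) \<le> \<bar>L\<bar> * S a (Y n)" by (rule mult_right_mono) (use S_nonneg[OF a(1,2)] in auto)
        also have "\<dots> \<le> \<bar>L\<bar> * (1 / real (Suc n))" using Y[of n] by (intro mult_left_mono) auto
        finally have "(f (Y n) - k)\<^sup>2 < r\<^sup>2" using L[of "Y n"] n0[OF that] by linarith
        then have "\<bar>f (Y n) - k\<bar>\<^sup>2 < r\<^sup>2" by simp
        then have "\<bar>f (Y n) - k\<bar> < r" by (rule power2_less_imp_less) (use r in simp)
        then show ?thesis by (simp add: dist_real_def)
      qed
      then show "\<exists>no. \<forall>n\<ge>no. dist (f (Y n)) k < r" by blast
    qed
    then show "(\<lambda>n. f (Y n)) \<longlonglongrightarrow> T f p" by (simp add: k_def)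
  qed
qed

text \<open>Evaluation at \<open>y\<close> composed with \<open>S\<close> is a limit of point
  evaluations on \<open>M\<close>. Where \<open>S \<beta>\<close> is positive the bump does not
  vanish at this limit, so the points themselves converge, and the values of functions pass to the
  limit.\<close>

lemma related_bump:
  assumes c: "c \<in> charts_at M p" and r: "r > 0"
  obtains \<beta> where "\<beta> \<in> Cb1 M" "0 < \<beta> p"
    "\<And>q. \<beta> q \<noteq> 0 \<Longrightarrow> q \<in> dom_chart c \<and> map_chart c q \<in> cball (map_chart c p) r"
    "\<And>y. S \<beta> y > 0 \<Longrightarrow> \<exists>x. related x y"
proof -
  interpret sym: Cb1_dual N M S T by (rule swap)
  obtain \<beta> where \<beta>: "\<beta> \<in> Cb1 M" "0 < \<beta> p"
    "\<And>q. \<beta> q \<noteq> 0 \<Longrightarrow> q \<in> dom_chart c \<and> map_chart c q \<in> cball (map_chart c p) r"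
    "\<forall>X l. (\<forall>f\<in>Cb1 M. convergent (\<lambda>n. f (X n))) \<longrightarrow> (\<lambda>n. \<beta> (X n)) \<longlonglongrightarrow> l \<longrightarrow> l > 0 \<longrightarrow> (\<exists>x. X \<longlonglongrightarrow> x)"
    using that by (rule M.localizing_bump[OF c r])
  show ?thesis
  proof (rule that[OF \<beta>(1-3)])
    fix y assume y: "S \<beta> y > 0"
    obtain X where X: "\<And>g. g \<in> Cb1 M \<Longrightarrow> (\<lambda>n::nat. g (X n)) \<longlonglongrightarrow> S g y"
      using sym.approximating_sequence by blast
    have "\<exists>x. X \<longlonglongrightarrow> x"
      by (rule \<beta>(4)[rule_format, OF _ X[OF \<beta>(1)] y]) (use X convergent_def in blast)
    then obtain x where x: "X \<longlonglongrightarrow> x" by blast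
    have "S g y = g x" if g: "g \<in> Cb1 M" for g
    proof -
      have "isCont g x" using M.Cb1_continuous[OF g] by (simp add: continuous_on_eq_continuous_at)
      then have "(\<lambda>n. g (X n)) \<longlonglongrightarrow> g x" by (rule isCont_tendsto_compose[OF _ x])
      then show ?thesis using X[OF g] LIMSEQ_unique by blast
    qed
    then show "\<exists>x. related x y" unfolding related_iff by blast
  qed
qed

text \<open>Along the sequence approximating evaluation at \<open>p\<close>, the values of
  \<open>S \<beta>\<close> tend to \<open>\<beta> p\<close>, which is positive. So some term
  \<open>Y n\<close> has a partner \<open>x\<close>, and \<open>\<beta> x = S \<beta> (Y n)\<close>
  being nonzero places \<open>x\<close> in the coordinate ball.\<close>

lemma related_dense:
  assumes c: "c \<in> charts_at M p" and r: "r > 0"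
  obtains x y where "related x y" "x \<in> dom_chart c" "map_chart c x \<in> cball (map_chart c p) r"
proof -
  obtain \<beta> where \<beta>: "\<beta> \<in> Cb1 M" "0 < \<beta> p"
    "\<And>q. \<beta> q \<noteq> 0 \<Longrightarrow> q \<in> dom_chart c \<and> map_chart c q \<in> cball (map_chart c p) r"
    "\<And>y. S \<beta> y > 0 \<Longrightarrow> \<exists>x. related x y" using related_bump[OF c r] by metis
  obtain Y where Y: "\<And>f. f \<in> Cb1 N \<Longrightarrow> (\<lambda>n::nat. f (Y n)) \<longlonglongrightarrow> T f p" using approximating_sequence by blast
  have "(\<lambda>n. S \<beta> (Y n)) \<longlonglongrightarrow> \<beta> p" using Y[OF S_Cb1[OF \<beta>(1)]] by (simp add: TS \<beta>(1))
  then have "\<forall>\<^sub>F n in sequentially. S \<beta> (Y n) > 0" by (rule order_tendstoD) (rule \<beta>(2))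
  then obtain n where n: "S \<beta> (Y n) > 0" using eventually_happens by fastforce
  then obtain x where x: "related x (Y n)" using \<beta>(4) by blast
  then have "\<beta> x > 0" using n \<beta>(1) unfolding related_iff by simp
  then show ?thesis using that[OF x] \<beta>(3)[of x] by simp
qed

lemma related_unique:
  assumes "related x y" "related x y'"
  shows "y = y'"
proof (rule N.Cb1_separates)
  fix f assume "f \<in> Cb1 N"
  then show "f y = f y'" using relatedD[OF assms(1), of f] relatedD[OF assms(2), of f] by simp
qed

text \<open>With the bump taken at \<open>q\<close> on the other manifold, positivity of
  \<open>T \<beta>\<close> is an open condition that holds at \<open>p\<close> and implies the
  existence of a partner.\<close>

lemma related_open:
  assumes "related p q"
  obtains V where "open V" "p \<in> V" "\<And>x. x \<in> V \<Longrightarrow> \<exists>y. related x y"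
proof -
  interpret sym: Cb1_dual N M S T by (rule swap)
  have sym: "sym.related y x \<longleftrightarrow> related x y" for x y
    unfolding sym.related_def related_iff by blast
  obtain d where d: "d \<in> charts_at N q" using N.chart_exists by blast
  obtain \<beta> where \<beta>: "\<beta> \<in> Cb1 N" "0 < \<beta> q" "\<And>x. T \<beta> x > 0 \<Longrightarrow> \<exists>y. related x y"
    using sym.related_bump[OF d zero_less_one] unfolding sym by metis
  show ?thesis
  proof (rule that[of "{x. T \<beta> x > 0}"])
    show "open {x. T \<beta> x > 0}"
      by (rule open_Collect_less[OF continuous_on_const M.Cb1_continuous[OF T_Cb1[OF \<beta>(1)]]])
    show "p \<in> {x. T \<beta> x > 0}" using \<beta>(2) relatedD[OF assms \<beta>(1)] by simp
  qed (use \<beta>(3) in simp)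
qed

section \<open>The point map on the matched points\<close>

definition M0 :: "'p set" where "M0 = {x. \<exists>y. related x y}"

definition h :: "'p \<Rightarrow> 'q" where "h x = (SOME y. related x y)"

lemma related_h: "x \<in> M0 \<Longrightarrow> related x (h x)"
  unfolding h_def M0_def by (simp add: someI_ex)

lemma T_eq_h: "x \<in> M0 \<Longrightarrow> f \<in> Cb1 N \<Longrightarrow> T f x = f (h x)"
  by (rule relatedD[OF related_h])

lemma related_imp: "related x y \<Longrightarrow> x \<in> M0 \<and> h x = y"
  using related_h related_unique unfolding M0_def by blast

lemma open_M0: "open M0"
proof (subst open_subopen, intro ballI)
  fix x assume "x \<in> M0"
  from related_open[OF related_h[OF this]] show "\<exists>V. open V \<and> x \<in> V \<and> V \<subseteq> M0"
    unfolding M0_def by (metis (mono_tags, lifting) mem_Collect_eq subsetI)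
qed

text \<open>The topology of \<open>N\<close> at \<open>h x\<close> is generated by superlevel sets
  of a peak function \<open>\<beta>\<close>, whose pullback is the continuous function
  \<open>T \<beta>\<close>.\<close>

lemma continuous_on_h: "continuous_on M0 h"
  unfolding continuous_on_eq_continuous_at[OF open_M0]
proof
  fix x assume x: "x \<in> M0"
  show "isCont h x"
    unfolding continuous_at tendsto_def
  proof (intro allI impI)
    fix V assume V: "open V" "h x \<in> V"
    obtain d where d: "d \<in> charts_at N (h x)" using N.chart_exists by blast
    obtain \<beta> where \<beta>: "\<beta> \<in> Cb1 N" "\<exists>\<delta>>0. \<forall>q. q \<notin> V \<longrightarrow> \<beta> q \<le> \<beta> (h x) - \<delta>"
      using N.peak_function[OF d zero_less_one] V by metis
    then obtain \<delta> where \<delta>: "\<delta> > 0" "\<And>q. q \<notin> V \<Longrightarrow> \<beta> q \<le> \<beta> (h x) - \<delta>" by blast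
    define W where "W = M0 \<inter> {x'. T \<beta> x - \<delta> < T \<beta> x'}"
    have "open {x'. T \<beta> x - \<delta> < T \<beta> x'}"
      by (rule open_Collect_less[OF continuous_on_const M.Cb1_continuous[OF T_Cb1[OF \<beta>(1)]]])
    then have "open W" unfolding W_def by (intro open_Int open_M0)
    moreover have "x \<in> W" using x \<delta>(1) by (simp add: W_def)
    ultimately have "\<forall>\<^sub>F x' in at x. x' \<in> W" using eventually_at_in_open' by blast
    then show "\<forall>\<^sub>F x' in at x. h x' \<in> V"
    proof eventually_elim
      case (elim x')
      then show ?case using \<delta>(2)[of "h x'"] T_eq_h[OF x \<beta>(1)] T_eq_h[OF _ \<beta>(1), of x'] by (force simp: W_def)
    qed
  qed
qed

text \<open>\<open>T\<close> and \<open>S\<close> preserve norms, so they exchange the unit balls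
  over which the two suprema are taken.\<close>

lemma rho_h:
  assumes x: "x \<in> M0" and x': "x' \<in> M0"
  shows "rho N (h x) (h x') = rho M x x'"
proof (rule antisym)
  show "rho N (h x) (h x') \<le> rho M x x'"
  proof (rule N.rho_least)
    fix f assume f: "f \<in> Cb1 N" "Cb1_norm N f \<le> 1"
    show "\<bar>f (h x) - f (h x')\<bar> \<le> rho M x x'"
      using M.rho_upper[OF T_Cb1[OF f(1)], of x x'] f T_norm[OF f(1)] T_eq_h[OF x f(1)] T_eq_h[OF x' f(1)] by simp
  qed
  show "rho M x x' \<le> rho N (h x) (h x')"
  proof (rule M.rho_least)
    fix g assume g: "g \<in> Cb1 M" "Cb1_norm M g \<le> 1"
    show "\<bar>g x - g x'\<bar> \<le> rho N (h x) (h x')"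
      using N.rho_upper[OF S_Cb1[OF g(1)], of "h x" "h x'"] g S_norm[OF g(1)]
        T_eq_h[OF x S_Cb1[OF g(1)]] T_eq_h[OF x' S_Cb1[OF g(1)]] TS[OF g(1)] by simp
  qed
qed

text \<open>\<open>rho_local\<close> on both sides, joined by \<open>rho_h\<close>, yields the
  hypotheses \<open>upper\<close> and \<open>lower\<close> of \<open>approx_isometry\<close>.
  Continuity of \<open>h\<close> is used to shrink the source ball until its image lies in the
  target ball.\<close>

lemma local_isometry:
  assumes p: "p \<in> M0" and c: "c \<in> charts_at M p" and d: "d \<in> charts_at N (h p)"
  obtains r where "r > 0" "ball (map_chart c p) r \<subseteq> coords c"
    "\<And>x. x \<in> ball (map_chart c p) r \<Longrightarrow> inv_chart c x \<in> M0 \<and> h (inv_chart c x) \<in> dom_chart d"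
    "C1_on (ball (map_chart c p) r) (map_chart d \<circ> h \<circ> inv_chart c)"
    "\<And>x v. x \<in> ball (map_chart c p) r \<Longrightarrow>
       N.cnorm d ((map_chart d \<circ> h \<circ> inv_chart c) x) (frechet_derivative (map_chart d \<circ> h \<circ> inv_chart c) (at x) v) = M.cnorm c x v"
proof -
  define x0 y0 where "x0 = map_chart c p" and "y0 = map_chart d (h p)"
  have c': "c \<in> atlas M" "p \<in> dom_chart c" and d': "d \<in> atlas N" "h p \<in> dom_chart d"
    using c d by (auto simp: charts_at_def)
  obtain RM aM bM CM where M: "RM > 0" "aM > 0" "bM > 0" "CM > 0" "cball x0 RM \<subseteq> coords c"
    and Mb: "\<And>x v. x \<in> cball x0 RM \<Longrightarrow> aM * norm v \<le> M.cnorm c x v \<and> M.cnorm c x v \<le> bM * norm v"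
    and Mv: "\<And>x y v. x \<in> cball x0 RM \<Longrightarrow> y \<in> cball x0 RM \<Longrightarrow>
       M.cnorm c x v \<le> (1 + CM * M.cnorm c y (x - y)) * M.cnorm c y v \<and>
       M.cnorm c y v \<le> (1 + CM * M.cnorm c y (x - y)) * M.cnorm c x v"
    and Mr: "\<And>x y. x \<in> cball x0 RM \<Longrightarrow> y \<in> cball x0 RM \<Longrightarrow>
       M.cnorm c y (x - y) - CM * (M.cnorm c y (x - y))\<^sup>2 \<le> rho M (inv_chart c x) (inv_chart c y) \<and>
       rho M (inv_chart c x) (inv_chart c y) \<le> M.cnorm c y (x - y) + CM * (M.cnorm c y (x - y))\<^sup>2"
    using that by (rule M.rho_local[OF c, folded x0_def])
  obtain RN aN bN CN where N: "RN > 0" "aN > 0" "bN > 0" "CN > 0" "cball y0 RN \<subseteq> coords d"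
    and Nb: "\<And>x v. x \<in> cball y0 RN \<Longrightarrow> aN * norm v \<le> N.cnorm d x v \<and> N.cnorm d x v \<le> bN * norm v"
    and Nv: "\<And>x y v. x \<in> cball y0 RN \<Longrightarrow> y \<in> cball y0 RN \<Longrightarrow>
       N.cnorm d x v \<le> (1 + CN * N.cnorm d y (x - y)) * N.cnorm d y v \<and>
       N.cnorm d y v \<le> (1 + CN * N.cnorm d y (x - y)) * N.cnorm d x v"
    and Nr: "\<And>x y. x \<in> cball y0 RN \<Longrightarrow> y \<in> cball y0 RN \<Longrightarrow>
       N.cnorm d y (x - y) - CN * (N.cnorm d y (x - y))\<^sup>2 \<le> rho N (inv_chart d x) (inv_chart d y) \<and>
       rho N (inv_chart d x) (inv_chart d y) \<le> N.cnorm d y (x - y) + CN * (N.cnorm d y (x - y))\<^sup>2"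
    using that by (rule N.rho_local[OF d, folded y0_def])
  define C where "C = max CM CN"
  have C: "C > 0" "CM \<le> C" "CN \<le> C" using M N by (auto simp: C_def)
  \<comment> \<open>Points of the ball differ by at most \<open>2 * \<rho>\<close>, hence by at most
    \<open>bN * (2 * \<rho>)\<close> in the metric; the choice makes \<open>C\<close> times this at
    most \<open>1/2\<close>, as \<open>N_small\<close> asks. The radius \<open>r\<close> below is
    chosen in the same way for \<open>M_small\<close>.\<close>
  define \<rho> where "\<rho> = min RN (1 / (4 * C * bN))"
  have \<rho>: "\<rho> > 0" "\<rho> \<le> RN" "C * (bN * (2 * \<rho>)) \<le> 1/2"
  proof -
    show "\<rho> > 0" "\<rho> \<le> RN" using N C by (auto simp: \<rho>_def)
    have "\<rho> \<le> 1 / (4 * C * bN)" by (simp add: \<rho>_def)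
    then show "C * (bN * (2 * \<rho>)) \<le> 1/2" using N C by (simp add: field_simps)
  qed
  have EN: "cball y0 \<rho> \<subseteq> cball y0 RN" using \<rho> by auto
  define V where "V = inv_chart d ` ball y0 \<rho>"
  have bd: "ball y0 \<rho> \<subseteq> coords d" using EN N(5) ball_subset_cball by blast
  have V: "open V" unfolding V_def by (rule N.open_inv_chart_image[OF d'(1) open_ball bd])
  have hpV: "h p \<in> V" unfolding V_def using \<rho>(1) d' by (auto simp: y0_def intro!: image_eqI[of _ _ "map_chart d (h p)"])
  define W where "W = dom_chart c \<inter> (M0 \<inter> h -` V)"
  have W: "open W" unfolding W_def
    by (intro open_Int M.open_dom c' continuous_open_preimage[OF continuous_on_h open_M0 V])
  have Wc: "W \<subseteq> dom_chart c" by (simp add: W_def)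
  have "open (map_chart c ` W)" by (rule M.open_map_chart_image[OF c'(1) W Wc])
  moreover have "x0 \<in> map_chart c ` W" using p hpV c' by (simp add: W_def x0_def)
  ultimately obtain r1 where r1: "r1 > 0" "ball x0 r1 \<subseteq> map_chart c ` W" by (meson openE)
  define r where "r = Min {r1, RM, 1 / (4 * C * bM)}"
  have r: "r > 0" "r \<le> r1" "r \<le> RM" "C * (bM * (2 * r)) \<le> 1/2"
  proof -
    show "r > 0" "r \<le> r1" "r \<le> RM" using r1 M C by (auto simp: r_def)
    have "r \<le> 1 / (4 * C * bM)" by (simp add: r_def)
    then show "C * (bM * (2 * r)) \<le> 1/2" using M C by (simp add: field_simps)
  qed
  define ht where "ht = map_chart d \<circ> h \<circ> inv_chart c"
  have rM: "x \<in> cball x0 RM" if "x \<in> ball x0 r" for x using that r by simp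
  have rc: "x \<in> coords c" if "x \<in> ball x0 r" for x using rM[OF that] M by blast
  have inW: "inv_chart c x \<in> W" if x: "x \<in> ball x0 r" for x
  proof -
    have "x \<in> map_chart c ` W" using r1(2) x r(2) by auto
    then show ?thesis using c'(1) Wc by auto
  qed
  have M0: "inv_chart c x \<in> M0" "h (inv_chart c x) \<in> V" if "x \<in> ball x0 r" for x using inW[OF that] by (auto simp: W_def)
  have hd: "h (inv_chart c x) \<in> dom_chart d" "ht x \<in> ball y0 \<rho>" if x: "x \<in> ball x0 r" for x
  proof -
    obtain y where "y \<in> ball y0 \<rho>" "h (inv_chart c x) = inv_chart d y" using M0(2)[OF x] by (auto simp: V_def)
    then show "h (inv_chart c x) \<in> dom_chart d" "ht x \<in> ball y0 \<rho>" using bd d'(1) by (auto simp: ht_def subset_iff)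
  qed
  have htE: "ht x \<in> cball y0 \<rho>" if "x \<in> ball x0 r" for x using hd(2)[OF that] by simp
  have ihd: "inv_chart d (ht x) = h (inv_chart c x)" if "x \<in> ball x0 r" for x
    using hd(1)[OF that] d'(1) by (simp add: ht_def)
  have rho_eq: "rho N (inv_chart d (ht x)) (inv_chart d (ht y)) = rho M (inv_chart c x) (inv_chart c y)"
    if "x \<in> ball x0 r" "y \<in> ball x0 r" for x y
    using that by (simp add: ihd rho_h M0)
  have inner: "inner_form (N.gram d y)" "N.cnorm d y w = inner_form.nrm (N.gram d y) w" if "y \<in> cball y0 \<rho>" for y w
    using that EN N(5) d'(1) N.inner_form_gram N.cnorm_nrm by (meson subsetD)+
  have innerM: "inner_form (M.gram c x)" "M.cnorm c x w = inner_form.nrm (M.gram c x) w" if "x \<in> ball x0 r" for x w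
    using rc[OF that] c'(1) M.inner_form_gram M.cnorm_nrm by blast+
  have nM0: "0 \<le> M.cnorm c x v" if "x \<in> ball x0 r" for x v
    using inner_form.nrm_nonneg[OF innerM(1)[OF that]] innerM(2)[OF that] by simp
  have nN0: "0 \<le> N.cnorm d y v" if "y \<in> cball y0 \<rho>" for y v
    using inner_form.nrm_nonneg[OF inner(1)[OF that]] inner(2)[OF that] by simp
  have mono: "(1 + K * a) * b \<le> (1 + C * a) * b" if "K \<le> C" "0 \<le> a" "0 \<le> b" for K a b :: real
    using that by (intro mult_right_mono add_left_mono) auto
  have sq: "K * a\<^sup>2 \<le> C * a\<^sup>2" if "K \<le> C" for K a :: real using that by (intro mult_right_mono) auto
  interpret approx_isometry ht x0 r "cball y0 \<rho>" "M.cnorm c" "N.cnorm d" aM bM aN bN C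
  proof unfold_locales
    show "r > 0" "aM > 0" "bM > 0" "aN > 0" "bN > 0" "C > 0" by (fact r M N C)+
    show "ht ` ball x0 r \<subseteq> cball y0 \<rho>" using htE by blast
    fix x y v assume x: "x \<in> ball x0 r"
    show "aM * norm v \<le> M.cnorm c x v \<and> M.cnorm c x v \<le> bM * norm v" using Mb[OF rM[OF x]] .
    show "M.cnorm c x (t *\<^sub>R v) = \<bar>t\<bar> * M.cnorm c x v" for t
      using inner_form.nrm_scale[OF innerM(1)[OF x]] innerM(2)[OF x] by simp
    assume y: "y \<in> ball x0 r"
    show "M.cnorm c x v \<le> (1 + C * M.cnorm c y (x - y)) * M.cnorm c y v"
      using Mv[OF rM[OF x] rM[OF y], of v] mono[OF C(2) nM0[OF y] nM0[OF y], of "x - y" v] by linarith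
    show "C * M.cnorm c y (x - y) \<le> 1/2"
    proof -
      have "norm (x - y) \<le> 2 * r" using x y dist_triangle[of x y x0] by (simp add: dist_norm norm_minus_commute)
      then have "C * (bM * norm (x - y)) \<le> C * (bM * (2 * r))" using C M by (intro mult_left_mono) auto
      moreover have "C * M.cnorm c y (x - y) \<le> C * (bM * norm (x - y))"
        using Mb[OF rM[OF y], of "x - y"] C by (intro mult_left_mono) auto
      ultimately show ?thesis using r(4) by linarith
    qed
    show "C * N.cnorm d (ht y) (ht x - ht y) \<le> 1/2"
    proof -
      have "norm (ht x - ht y) \<le> 2 * \<rho>"
        using htE[OF x] htE[OF y] dist_triangle[of "ht x" "ht y" y0] by (simp add: dist_norm norm_minus_commute)
      then have "C * (bN * norm (ht x - ht y)) \<le> C * (bN * (2 * \<rho>))" using C N by (intro mult_left_mono) auto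
      moreover have "C * N.cnorm d (ht y) (ht x - ht y) \<le> C * (bN * norm (ht x - ht y))"
        using Nb[OF subsetD[OF EN htE[OF y]], of "ht x - ht y"] C by (intro mult_left_mono) auto
      ultimately show ?thesis using \<rho>(3) by linarith
    qed
    note NR = Nr[OF subsetD[OF EN htE[OF x]] subsetD[OF EN htE[OF y]], unfolded rho_eq[OF x y]]
      and MR = Mr[OF rM[OF x] rM[OF y]]
    show "N.cnorm d (ht y) (ht x - ht y) - C * (N.cnorm d (ht y) (ht x - ht y))\<^sup>2 \<le> M.cnorm c y (x - y) + C * (M.cnorm c y (x - y))\<^sup>2"
      using NR MR sq[OF C(2), of "M.cnorm c y (x - y)"] sq[OF C(3), of "N.cnorm d (ht y) (ht x - ht y)"] by linarith
    show "M.cnorm c y (x - y) - C * (M.cnorm c y (x - y))\<^sup>2 \<le> N.cnorm d (ht y) (ht x - ht y) + C * (N.cnorm d (ht y) (ht x - ht y))\<^sup>2"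
      using NR MR sq[OF C(2), of "M.cnorm c y (x - y)"] sq[OF C(3), of "N.cnorm d (ht y) (ht x - ht y)"] by linarith
  next
    fix y w assume y: "y \<in> cball y0 \<rho>"
    show "aN * norm w \<le> N.cnorm d y w \<and> N.cnorm d y w \<le> bN * norm w" using Nb[OF subsetD[OF EN y]] .
    show "N.cnorm d y (t *\<^sub>R w) = \<bar>t\<bar> * N.cnorm d y w" for t
      using inner_form.nrm_scale[OF inner(1)[OF y]] inner(2)[OF y] by simp
    show "N.cnorm d y (w + w') \<le> N.cnorm d y w + N.cnorm d y w'" for w'
      using inner_form.nrm_triangle[OF inner(1)[OF y]] inner(2)[OF y] by simp
    show "(N.cnorm d y (w + w'))\<^sup>2 + (N.cnorm d y (w - w'))\<^sup>2 = 2 * (N.cnorm d y w)\<^sup>2 + 2 * (N.cnorm d y w')\<^sup>2" for w'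
      using inner_form.nrm_parallelogram[OF inner(1)[OF y]] inner(2)[OF y] by simp
  next
    fix x y w assume x: "x \<in> cball y0 \<rho>" and y: "y \<in> cball y0 \<rho>"
    show "N.cnorm d y w \<le> (1 + C * N.cnorm d x (y - x)) * N.cnorm d x w"
      using Nv[OF subsetD[OF EN y] subsetD[OF EN x], of w] mono[OF C(3) nN0[OF x] nN0[OF x], of "y - x" w] by linarith
  qed
  show ?thesis
    by (rule that[of r, folded x0_def ht_def]) (use r rc M0 hd C1 derivative_isometric in auto)
qed

text \<open>Along a segment that starts in \<open>M0\<close>, the image under \<open>h\<close> has bounded speed. At the first
  parameter outside \<open>M0\<close> it would converge, by completeness of \<open>N\<close>, to a point matching
  the end of the segment.\<close>

lemma M0_UNIV: "p \<in> M0"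
proof -
  obtain c where c: "c \<in> charts_at M p" using M.chart_exists by blast
  have c': "c \<in> atlas M" "p \<in> dom_chart c" using c by (auto simp: charts_at_def)
  define x0 where "x0 = map_chart c p"
  obtain R a b C where R: "R > 0" "b > 0" "cball x0 R \<subseteq> coords c"
    and bounds: "\<And>x v. x \<in> cball x0 R \<Longrightarrow> a * norm v \<le> M.cnorm c x v \<and> M.cnorm c x v \<le> b * norm v"
    using M.nice_ball[OF c] unfolding x0_def by metis
  obtain x1 y1 where x1: "related x1 y1" "x1 \<in> dom_chart c" "map_chart c x1 \<in> cball x0 R"
    using related_dense[OF c R(1)] unfolding x0_def by metis
  define \<xi> where "\<xi> = map_chart c x1"
  define l where "l t = \<xi> + t *\<^sub>R (x0 - \<xi>)" for t :: real
  define \<gamma> where "\<gamma> t = inv_chart c (l t)" for t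
  have lR: "l t \<in> cball x0 R" if "t \<in> {0..1}" for t
  proof -
    have "l t = (1 - t) *\<^sub>R \<xi> + t *\<^sub>R x0" by (simp add: l_def algebra_simps)
    then show ?thesis using convexD[OF convex_cball x1(3)[folded \<xi>_def], of x0 "1 - t" t] R that by simp
  qed
  have lc: "l t \<in> coords c" if "t \<in> {0..1}" for t using lR[OF that] R by blast
  have \<gamma>c: "continuous_on {0..1} \<gamma>"
    unfolding \<gamma>_def
    by (rule continuous_on_compose2[OF M.continuous_on_inv_chart[OF c'(1)]])
       (use lc in \<open>auto simp: l_def intro!: continuous_intros\<close>)
  \<comment> \<open>Since \<open>M0\<close> is open this set is compact, so it has a least element
    if it is not empty.\<close>
  define Bad where "Bad = {0..1} \<inter> \<gamma> -` (- M0)"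
  have Bad: "compact Bad"
    unfolding Bad_def compact_eq_bounded_closed
    using continuous_closed_preimage[OF \<gamma>c closed_atLeastAtMost] open_M0
    by (auto intro: bounded_subset[OF bounded_closed_interval] simp: closed_Compl)
  have "Bad = {}"
  proof (rule ccontr)
    assume "Bad \<noteq> {}"
    then obtain \<tau> where \<tau>: "\<tau> \<in> Bad" "\<And>t. t \<in> Bad \<Longrightarrow> \<tau> \<le> t" using compact_attains_inf[OF Bad] by blast
    have \<tau>01: "\<tau> \<in> {0..1}" using \<tau>(1) by (simp add: Bad_def)
    have "\<gamma> 0 = x1" using x1 c' by (simp add: \<gamma>_def l_def \<xi>_def)
    then have "\<gamma> 0 \<in> M0" using related_imp[OF x1(1)] by simp
    then have \<tau>0: "\<tau> > 0" using \<tau>(1) \<tau>01 by (cases "\<tau> = 0") (auto simp: Bad_def)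
    have good: "\<gamma> t \<in> M0" if "0 \<le> t" "t < \<tau>" for t using \<tau>(2)[of t] \<tau>01 that by (force simp: Bad_def)
    \<comment> \<open>The parameters start at \<open>s 0 = 0\<close> and increase to
      \<open>\<tau>\<close> without reaching it, so \<open>h\<close> is defined along all of
      them.\<close>
    define s where "s n = \<tau> - \<tau> * (1 / real (Suc n))" for n
    have s: "0 \<le> s n" "s n < \<tau>" for n using \<tau>0 by (auto simp: s_def field_simps)
    have s01: "s n \<in> {0..1}" for n using s[of n] \<tau>01 by auto
    have "s \<longlonglongrightarrow> \<tau> - \<tau> * 0" unfolding s_def
      by (intro tendsto_diff tendsto_mult tendsto_const LIMSEQ_Suc[OF lim_1_over_n])
    then have slim: "s \<longlonglongrightarrow> \<tau>" by simp
    \<comment> \<open>On \<open>M0\<close> the derivative of \<open>h\<close> is isometric, so the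
      image of the segment has the same speed as the segment, at most \<open>b\<close> times its
      coordinate speed.\<close>
    define B where "B = b * norm (x0 - \<xi>)"
    have B: "B \<ge> 0" using R by (simp add: B_def)
    define W where "W = coords c \<inter> inv_chart c -` M0"
    define k where "k = h \<circ> inv_chart c"
    have est: "rdist N (h (\<gamma> (s m))) (h (\<gamma> (s n))) \<le> ennreal (B * \<bar>s n - s m\<bar>)" for m n
    proof -
      have "rdist N (k (l (s m))) (k (l (s n))) \<le> ennreal (B * \<bar>s n - s m\<bar>)"
      proof (rule N.rdist_segment_le[where W=W])
        show "continuous_on W k"
          unfolding k_def by (rule continuous_on_compose[OF continuous_on_subset[OF M.continuous_on_inv_chart[OF c'(1)]]
            continuous_on_subset[OF continuous_on_h]]) (auto simp: W_def)
        have loc: "\<exists>r>0. ball z r \<subseteq> coords c \<and> C1_on (ball z r) (map_chart d \<circ> k) \<and>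
            (\<forall>v. chart_norm N (k z) d (frechet_derivative (map_chart d \<circ> k) (at z) v) = M.cnorm c z v)"
          if z: "z \<in> W" and d: "d \<in> charts_at N (k z)" for z d
        proof -
          have zc: "z \<in> coords c" and zM: "inv_chart c z \<in> M0" using z by (auto simp: W_def)
          have cz: "c \<in> charts_at M (inv_chart c z)" using c' zc by (simp add: charts_at_def)
          have dz: "d \<in> charts_at N (h (inv_chart c z))" using d by (simp add: k_def)
          have ass: "map_chart d \<circ> h \<circ> inv_chart c = map_chart d \<circ> k" by (simp add: k_def comp_assoc)
          obtain r where r: "r > 0" "ball z r \<subseteq> coords c" "C1_on (ball z r) (map_chart d \<circ> k)"
            "\<And>x v. x \<in> ball z r \<Longrightarrow> N.cnorm d ((map_chart d \<circ> k) x) (frechet_derivative (map_chart d \<circ> k) (at x) v) = M.cnorm c x v"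
            using local_isometry[OF zM cz dz] unfolding ass M.map_inv_chart[OF c'(1) zc] by metis
          then show ?thesis using N.chart_norm_cnorm[OF d] by (intro exI[of _ r]) simp
        qed
        show "C1_on (W \<inter> k -` dom_chart d) (map_chart d \<circ> k)" if d: "d \<in> atlas N" for d
        proof (rule C1_on_localI)
          fix z assume "z \<in> W \<inter> k -` dom_chart d"
          then have "z \<in> W" "d \<in> charts_at N (k z)" using d by (auto simp: charts_at_def)
          from loc[OF this] show "\<exists>W g. open W \<and> z \<in> W \<and> C1_on W g \<and> (\<forall>y\<in>W. (map_chart d \<circ> k) y = g y)"
            by (metis centre_in_ball open_ball)
        qed
        have seg: "\<exists>t. 0 \<le> t \<and> t < \<tau> \<and> z = l t" if z: "z \<in> closed_segment (l (s m)) (l (s n))" for z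
        proof -
          obtain u where u: "0 \<le> u" "u \<le> 1" "z = (1 - u) *\<^sub>R l (s m) + u *\<^sub>R l (s n)"
            using z by (auto simp: closed_segment_def)
          have "z = l ((1 - u) * s m + u * s n)" by (simp add: u(3) l_def algebra_simps)
          moreover have "(1 - u) * s m + u * s n < \<tau>" using convex_bound_lt[of "s m" \<tau> "s n" "1 - u" u] s u by simp
          moreover have "0 \<le> (1 - u) * s m + u * s n" using s u by simp
          ultimately show ?thesis by blast
        qed
        show segW: "closed_segment (l (s m)) (l (s n)) \<subseteq> W"
        proof
          fix z assume "z \<in> closed_segment (l (s m)) (l (s n))"
          then obtain t where t: "0 \<le> t" "t < \<tau>" "z = l t" using seg by blast
          then show "z \<in> W" using good[OF t(1,2)] lc[of t] \<tau>01 by (simp add: W_def \<gamma>_def)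
        qed
        show "0 \<le> B * \<bar>s n - s m\<bar>" using B by simp
        fix z assume z: "z \<in> closed_segment (l (s m)) (l (s n))"
        then obtain t where t: "0 \<le> t" "t < \<tau>" "z = l t" using seg by blast
        obtain d where d: "d \<in> charts_at N (k z)" using N.chart_exists by blast
        have lmn: "l (s n) - l (s m) = (s n - s m) *\<^sub>R (x0 - \<xi>)" by (simp add: l_def algebra_simps)
        have "chart_norm N (k z) d (frechet_derivative (map_chart d \<circ> k) (at z) (l (s n) - l (s m))) = M.cnorm c z (l (s n) - l (s m))"
          using loc[OF subsetD[OF segW z] d] by blast
        also have "\<dots> \<le> b * norm (l (s n) - l (s m))" using bounds[OF lR[of t]] t \<tau>01 by simp
        also have "\<dots> = B * \<bar>s n - s m\<bar>" unfolding lmn by (simp add: B_def)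
        finally show "\<exists>d\<in>charts_at N (k z). chart_norm N (k z) d (frechet_derivative (map_chart d \<circ> k) (at z) (l (s n) - l (s m))) \<le> B * \<bar>s n - s m\<bar>"
          using d by blast
      qed
      then show ?thesis by (simp add: k_def \<gamma>_def)
    qed
    have "\<exists>K. \<forall>m\<ge>K. \<forall>n\<ge>K. rdist N (h (\<gamma> (s m))) (h (\<gamma> (s n))) < \<epsilon>" if "\<epsilon> > 0" for \<epsilon>
    proof -
      \<comment> \<open>Here \<open>\<epsilon>\<close> is an extended real and may be infinite; a
        finite positive number below it is chosen.\<close>
      obtain z where z: "0 < z" "z < \<epsilon>" using \<open>\<epsilon> > 0\<close> dense by blast
      then have "z < top" using order.strict_trans2[OF z(2)] by simp
      then obtain e where e: "z = ennreal e" "e > 0" using z(1) by (cases z) (auto simp: ennreal_less_zero_iff)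
      have "Cauchy s" using slim by (rule LIMSEQ_imp_Cauchy)
      then obtain K where K: "\<And>m n. m \<ge> K \<Longrightarrow> n \<ge> K \<Longrightarrow> dist (s m) (s n) < e / (B + 1)"
        using metric_CauchyD[of s "e / (B + 1)"] e B by auto
      have "rdist N (h (\<gamma> (s m))) (h (\<gamma> (s n))) < \<epsilon>" if mn: "m \<ge> K" "n \<ge> K" for m n
      proof -
        have "\<bar>s n - s m\<bar> \<le> e / (B + 1)" using K[OF mn] by (simp add: dist_real_def)
        then have "B * \<bar>s n - s m\<bar> \<le> B * (e / (B + 1))" using B by (intro mult_left_mono) auto
        also have "\<dots> \<le> e" using B e by (simp add: field_simps)
        finally have "ennreal (B * \<bar>s n - s m\<bar>) \<le> z" unfolding e(1) by (rule ennreal_leI)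
        then show ?thesis using est[of m n] z(2) by order
      qed
      then show ?thesis by blast
    qed
    then obtain q where q: "(\<lambda>n. rdist N (h (\<gamma> (s n))) q) \<longlonglongrightarrow> 0"
      using complete_N[unfolded complete_manifold_def, rule_format, of "\<lambda>n. h (\<gamma> (s n))"] by blast
    \<comment> \<open>Functions of the algebra are Lipschitz for \<open>rdist\<close>, so
      convergence to \<open>q\<close> in that distance passes to the values of \<open>f\<close>; on
      the other side \<open>T f\<close> is continuous along the segment.\<close>
    have "T f (\<gamma> \<tau>) = f q" if f: "f \<in> Cb1 N" for f
    proof -
      obtain L where L: "L > 0" "\<And>x y. ennreal (dist (f x) (f y)) \<le> ennreal L * rdist N x y"
        using f unfolding Cb1_def lipschitz_fun_def by blast
      have "(\<lambda>n. ennreal L * rdist N (h (\<gamma> (s n))) q) \<longlonglongrightarrow> ennreal L * 0"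
        by (rule ennreal_tendsto_cmult[OF _ q]) simp
      then have lim0: "(\<lambda>n. ennreal L * rdist N (h (\<gamma> (s n))) q) \<longlonglongrightarrow> 0" by simp
      have "(\<lambda>n. ennreal (dist (f (h (\<gamma> (s n)))) (f q))) \<longlonglongrightarrow> 0"
        by (rule tendsto_sandwich[OF _ _ tendsto_const lim0]) (use L(2) in auto)
      then have "(\<lambda>n. ennreal (dist (f (h (\<gamma> (s n)))) (f q))) \<longlonglongrightarrow> ennreal 0" by simp
      then have "(\<lambda>n. dist (f (h (\<gamma> (s n)))) (f q)) \<longlonglongrightarrow> 0"
        by (subst (asm) tendsto_ennreal_iff) auto
      then have 1: "(\<lambda>n. f (h (\<gamma> (s n)))) \<longlonglongrightarrow> f q" by (rule iffD2[OF tendsto_dist_iff])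
      have "(\<lambda>n. \<gamma> (s n)) \<longlonglongrightarrow> \<gamma> \<tau>"
        by (rule continuous_on_tendsto_compose[OF \<gamma>c slim \<tau>01]) (rule always_eventually, rule allI, rule s01)
      moreover have "isCont (T f) (\<gamma> \<tau>)" using M.Cb1_continuous[OF T_Cb1[OF f]] by (simp add: continuous_on_eq_continuous_at)
      ultimately have "(\<lambda>n. T f (\<gamma> (s n))) \<longlonglongrightarrow> T f (\<gamma> \<tau>)" using isCont_tendsto_compose by blast
      moreover have "T f (\<gamma> (s n)) = f (h (\<gamma> (s n)))" for n using T_eq_h[OF good[OF s] f] .
      ultimately show ?thesis using 1 LIMSEQ_unique by simp
    qed
    then have "related (\<gamma> \<tau>) q" by (simp add: related_def)
    then have "\<gamma> \<tau> \<in> M0" using related_imp by blast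
    then show False using \<tau>(1) by (simp add: Bad_def)
  qed
  then have "1 \<notin> Bad" by simp
  then have "\<gamma> 1 \<in> M0" by (simp add: Bad_def)
  then show ?thesis using c' by (simp add: \<gamma>_def l_def x0_def)
qed

end

section \<open>Isometries\<close>

locale riem_pair = M: riem_manifold M + N: riem_manifold N
  for M :: "('p::t2_space, 'h::{real_inner, complete_space}) manifold"
    and N :: "('q::t2_space, 'k::{real_inner, complete_space}) manifold"
begin

definition diff :: "('p \<Rightarrow> 'q) \<Rightarrow> 'p \<Rightarrow> ('p, 'h) chart \<Rightarrow> ('q, 'k) chart \<Rightarrow> 'h \<Rightarrow> 'k" where
  "diff h p c d = frechet_derivative (map_chart d \<circ> h \<circ> inv_chart c) (at (map_chart c p))"

context
  fixes h :: "'p \<Rightarrow> 'q"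
  assumes h: "C1_map M N h"
begin

lemma map_continuous: "continuous_on UNIV h"
  using h by (simp add: C1_map_def)

lemma C1_on_map:
  "c \<in> atlas M \<Longrightarrow> d \<in> atlas N \<Longrightarrow> C1_on (map_chart c ` (dom_chart c \<inter> h -` dom_chart d)) (map_chart d \<circ> h \<circ> inv_chart c)"
  using h by (simp add: C1_map_def)

lemma open_map_domain:
  assumes "c \<in> atlas M" "d \<in> atlas N"
  shows "open (map_chart c ` (dom_chart c \<inter> h -` dom_chart d))"
  using open_vimage[OF N.open_dom[OF assms(2)] map_continuous] assms
  by (intro M.open_map_chart_image open_Int M.open_dom) auto

lemma diff_has_derivative:
  assumes "c \<in> charts_at M p" "d \<in> charts_at N (h p)"
  shows "(map_chart d \<circ> h \<circ> inv_chart c has_derivative diff h p c d) (at (map_chart c p))"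
  unfolding diff_def using assms C1_on_has_derivative[OF C1_on_map] by (auto simp: charts_at_def)

lemma pullback_has_derivative:
  assumes c: "c \<in> charts_at M p" and d: "d \<in> charts_at N (h p)"
    and f: "(f \<circ> inv_chart d has_derivative D) (at (map_chart d (h p)))"
  shows "((f \<circ> h) \<circ> inv_chart c has_derivative D \<circ> diff h p c d) (at (map_chart c p))"
proof -
  have c': "c \<in> atlas M" "p \<in> dom_chart c" and d': "d \<in> atlas N" "h p \<in> dom_chart d"
    using c d by (auto simp: charts_at_def)
  have f': "(f \<circ> inv_chart d has_derivative D) (at ((map_chart d \<circ> h \<circ> inv_chart c) (map_chart c p)))"
    using f c' by simp
  show ?thesis
    by (rule has_derivative_transform_within_open[OF diff_chain_at[OF diff_has_derivative[OF c d] f']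
        open_map_domain[OF c'(1) d'(1)]]) (use c' d' in auto)
qed

text \<open>By the chain rule every representative \<open>(c', v')\<close> of the tangent vector
  yields the same coordinates in each chart at \<open>h p\<close>, so the set defined by
  \<open>tangent_map\<close> is one tangent vector.\<close>

lemma tangent_map_eq:
  assumes c: "c \<in> charts_at M p" and d: "d \<in> charts_at N (h p)"
  shows "tangent_map M N h p (tangent_vec M p c v) = tangent_vec N (h p) d (diff h p c d v)"
proof -
  have change: "frechet_derivative (map_chart e \<circ> h \<circ> inv_chart c') (at (map_chart c' p)) v' = coord_deriv d (map_chart e) (h p) (diff h p c d v)"
    if e: "e \<in> charts_at N (h p)" and c': "(c', v') \<in> tangent_vec M p c v" for e c' v'
  proof -
    have c'p: "c' \<in> charts_at M p" and v': "v' = coord_deriv c (map_chart c') p v"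
      using c' by (simp_all add: M.tangent_vec_eq[OF c])
    have "frechet_derivative (map_chart e \<circ> h \<circ> inv_chart c') (at (map_chart c' p)) v' = coord_deriv c (map_chart e \<circ> h) p v"
      unfolding v' using M.coord_deriv_chain[OF c c'p diff_has_derivative[OF c'p e]] by (simp add: diff_def)
    also have "\<dots> = coord_deriv d (map_chart e) (h p) (diff h p c d v)"
      using frechet_derivative_at[OF pullback_has_derivative[OF c d N.transition_has_derivative[OF d e]]] by (metis comp_apply)
    finally show ?thesis .
  qed
  have mem: "(c, v) \<in> tangent_vec M p c v" using c by (simp add: M.tangent_vec_eq M.transition_id)
  show ?thesis
  proof (rule set_eqI)
    fix x :: "('q, 'k) chart \<times> 'k"
    obtain e w where x: "x = (e, w)" by (cases x)
    have "(\<exists>(c', v')\<in>tangent_vec M p c v. w = frechet_derivative (map_chart e \<circ> h \<circ> inv_chart c') (at (map_chart c' p)) v')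
      \<longleftrightarrow> w = coord_deriv d (map_chart e) (h p) (diff h p c d v)" (is "?E \<longleftrightarrow> ?F") if e: "e \<in> charts_at N (h p)"
    proof
      assume ?E
      then obtain c' v' where m: "(c', v') \<in> tangent_vec M p c v"
        "w = frechet_derivative (map_chart e \<circ> h \<circ> inv_chart c') (at (map_chart c' p)) v'" by blast
      then show ?F using change[OF e m(1)] by simp
    next
      assume ?F
      then show ?E using change[OF e mem] by (intro bexI[OF _ mem]) simp
    qed
    then show "x \<in> tangent_map M N h p (tangent_vec M p c v) \<longleftrightarrow> x \<in> tangent_vec N (h p) d (diff h p c d v)"
      unfolding tangent_map_def N.tangent_vec_eq[OF d] x by (simp cong: conj_cong)
  qed
qed

text \<open>The derivative is linear, so polarization recovers the inner products from the norms;
  the analytic part delivers equality of norms only.\<close>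

lemma isometric_iff:
  "(\<forall>p. \<forall>X\<in>tangent_space M p. \<forall>Y\<in>tangent_space M p.
      metric N (h p) (tangent_map M N h p X) (tangent_map M N h p Y) = metric M p X Y) \<longleftrightarrow>
   (\<forall>p. \<forall>c\<in>charts_at M p. \<forall>d\<in>charts_at N (h p). \<forall>v. chart_norm N (h p) d (diff h p c d v) = chart_norm M p c v)"
  (is "?L \<longleftrightarrow> ?R")
proof
  assume L: ?L
  show ?R
  proof (intro allI ballI)
    fix p c d v assume c: "c \<in> charts_at M p" and d: "d \<in> charts_at N (h p)"
    have "tangent_vec M p c v \<in> tangent_space M p" unfolding M.tangent_space_eq[OF c] by simp
    then show "chart_norm N (h p) d (diff h p c d v) = chart_norm M p c v"
      unfolding norm_at_def tangent_map_eq[OF c d, symmetric] using L by simp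
  qed
next
  assume R: ?R
  show ?L
  proof (intro allI ballI)
    fix p X Y assume X: "X \<in> tangent_space M p" and Y: "Y \<in> tangent_space M p"
    obtain c where c: "c \<in> charts_at M p" using M.chart_exists by blast
    obtain d where d: "d \<in> charts_at N (h p)" using N.chart_exists by blast
    have c': "c \<in> atlas M" "p \<in> dom_chart c" and d': "d \<in> atlas N" "h p \<in> dom_chart d"
      using c d by (auto simp: charts_at_def)
    obtain v w where v: "X = tangent_vec M p c v" and w: "Y = tangent_vec M p c w"
      using X Y unfolding M.tangent_space_eq[OF c] by blast
    define D where "D = diff h p c d"
    have bl: "bounded_linear D" unfolding D_def using diff_has_derivative[OF c d] has_derivative_bounded_linear by blast
    have xc: "map_chart c p \<in> coords c" and yd: "map_chart d (h p) \<in> coords d" using c' d' by auto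
    interpret gM: inner_form "M.gram c (map_chart c p)" by (rule M.inner_form_gram[OF c'(1) xc])
    interpret gN: inner_form "N.gram d (map_chart d (h p))" by (rule N.inner_form_gram[OF d'(1) yd])
    have nrm: "gN.nrm (D u) = gM.nrm u" for u
    proof -
      have "chart_norm N (h p) d (D u) = chart_norm M p c u" using R c d by (simp add: D_def)
      then show ?thesis
        unfolding M.chart_norm_cnorm[OF c] N.chart_norm_cnorm[OF d] M.cnorm_nrm[OF c'(1) xc] N.cnorm_nrm[OF d'(1) yd] .
    qed
    have "N.gram d (map_chart d (h p)) (D v) (D w) = M.gram c (map_chart c p) v w"
      unfolding gM.polarization gN.polarization
      using nrm[of "v + w"] nrm[of "v - w"] bl by (simp add: linear_simps)
    then show "metric N (h p) (tangent_map M N h p X) (tangent_map M N h p Y) = metric M p X Y"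
      unfolding v w tangent_map_eq[OF c d] by (simp add: N.gram(2)[OF d'] M.gram(2)[OF c'] D_def)
  qed
qed

end

lemma isometry_chart_norm:
  assumes "riemannian_isometry M N h" "c \<in> charts_at M p" "d \<in> charts_at N (h p)"
  shows "chart_norm N (h p) d (diff h p c d v) = chart_norm M p c v"
proof -
  have "C1_map M N h" using assms(1) by (simp add: riemannian_isometry_def)
  from iffD1[OF isometric_iff[OF this]] show ?thesis
    using assms by (simp add: riemannian_isometry_def)
qed

text \<open>One inequality of norms is enough, since the same statement for the inverse isometry
  gives the other.\<close>

lemma isometry_pullback:
  assumes h: "riemannian_isometry M N h" and f: "f \<in> Cb1 N"
  shows "f \<circ> h \<in> Cb1 M" and "Cb1_norm M (f \<circ> h) \<le> Cb1_norm N f"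
proof -
  have hC1: "C1_map M N h" using h by (simp add: riemannian_isometry_def)
  have fC1: "C1_fun N f" by (rule N.Cb1_C1[OF f])
  have C1: "C1_fun M (f \<circ> h)"
  proof (rule M.C1_fun_localI)
    fix p
    obtain c where c: "c \<in> charts_at M p" using M.chart_exists by blast
    obtain d where d: "d \<in> charts_at N (h p)" using N.chart_exists by blast
    have c': "c \<in> atlas M" "p \<in> dom_chart c" and d': "d \<in> atlas N" "h p \<in> dom_chart d"
      using c d by (auto simp: charts_at_def)
    define W where "W = map_chart c ` (dom_chart c \<inter> h -` dom_chart d)"
    have W: "open W" unfolding W_def by (rule open_map_domain[OF hC1 c'(1) d'(1)])
    have "C1_on W ((f \<circ> inv_chart d) \<circ> (map_chart d \<circ> h \<circ> inv_chart c))"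
      unfolding W_def
      by (rule C1_on_compose[OF C1_on_map[OF hC1 c'(1) d'(1)] N.C1_funD[OF fC1 d'(1)]]) (use c' in auto)
    then have "C1_on W ((f \<circ> h) \<circ> inv_chart c)"
      by (rule C1_on_cong[OF _ W]) (use c' d' in \<open>auto simp: W_def\<close>)
    moreover have "map_chart c p \<in> W" "W \<subseteq> coords c" using c' d' by (auto simp: W_def)
    ultimately show "\<exists>c\<in>charts_at M p. \<exists>W. open W \<and> map_chart c p \<in> W \<and> W \<subseteq> coords c \<and> C1_on W ((f \<circ> h) \<circ> inv_chart c)"
      using c W by blast
  qed
  have db: "dbound M (f \<circ> h) K" if K: "dbound N f K" for K
    unfolding dbound_def
  proof (intro allI ballI)
    fix p c v assume c: "c \<in> charts_at M p"
    obtain d where d: "d \<in> charts_at N (h p)" using N.chart_exists by blast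
    have "coord_deriv c (f \<circ> h) p v = coord_deriv d f (h p) (diff h p c d v)"
      using frechet_derivative_at[OF pullback_has_derivative[OF hC1 c d N.C1_fun_has_derivative[OF fC1 d]]] by (metis comp_apply)
    then show "\<bar>coord_deriv c (f \<circ> h) p v\<bar> \<le> K * chart_norm M p c v"
      using dboundD[OF K d, of "diff h p c d v"] isometry_chart_norm[OF h c d] by simp
  qed
  obtain B L where B: "\<And>q. \<bar>f q\<bar> \<le> B" "dbound N f L" using N.Cb1E[OF f] by metis
  show Cb: "f \<circ> h \<in> Cb1 M" by (rule M.Cb1I[OF C1 _ db[OF B(2)]]) (use B(1) in simp)
  have "(\<forall>q. \<bar>f q\<bar> \<le> Cb1_norm N f) \<and> dbound N f (Cb1_norm N f)"
    using N.Cb1_norm_le_iff[OF f N.Cb1_norm_nonneg[OF f]] by simp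
  then show "Cb1_norm M (f \<circ> h) \<le> Cb1_norm N f"
    using M.Cb1_norm_le_iff[OF Cb N.Cb1_norm_nonneg[OF f]] db by simp
qed

text \<open>Differentiating \<open>h\<close> after \<open>inv h\<close> shows that the two
  differentials compose to the identity, so lengths are preserved in the reverse direction as
  well.\<close>

lemma isometry_inv:
  assumes h: "riemannian_isometry M N h"
  shows "riemannian_isometry N M (inv h)"
proof -
  interpret sym: riem_pair N M ..
  have bij: "bij h" and hC1: "C1_map M N h" and iC1: "C1_map N M (inv h)"
    using h by (auto simp: riemannian_isometry_def)
  have hi: "h (inv h q) = q" for q using bij by (simp add: bij_is_surj surj_f_inv_f)
  have "chart_norm M (inv h q) c (sym.diff (inv h) q d c w) = chart_norm N q d w"
    if d: "d \<in> charts_at N q" and c: "c \<in> charts_at M (inv h q)" for q c d w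
  proof -
    have d': "d \<in> charts_at N (h (inv h q))" using d by (simp add: hi)
    have "((map_chart d \<circ> h) \<circ> inv h) \<circ> inv_chart d = map_chart d \<circ> inv_chart d" using hi by auto
    moreover have "(((map_chart d \<circ> h) \<circ> inv h) \<circ> inv_chart d has_derivative diff h (inv h q) c d \<circ> sym.diff (inv h) q d c) (at (map_chart d q))"
      by (rule sym.pullback_has_derivative[OF iC1 d c diff_has_derivative[OF hC1 c d']])
    ultimately have "diff h (inv h q) c d \<circ> sym.diff (inv h) q d c = coord_deriv d (map_chart d) q"
      using frechet_derivative_at by metis
    then have "diff h (inv h q) c d (sym.diff (inv h) q d c w) = w"
      unfolding N.transition_id[OF d] by (metis comp_apply id_apply)
    then show ?thesis using isometry_chart_norm[OF h c d', of "sym.diff (inv h) q d c w"] by (simp add: hi)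
  qed
  then show ?thesis
    unfolding riemannian_isometry_def sym.isometric_iff[OF iC1]
    using bij hC1 iC1 by (simp add: bij_imp_bij_inv inv_inv_eq)
qed

lemma isometry_imp_iso:
  assumes h: "riemannian_isometry M N h"
  shows "normed_algebra_iso (Cb1 N) (Cb1_norm N) (Cb1 M) (Cb1_norm M) (\<lambda>f. f \<circ> h)"
proof -
  interpret sym: riem_pair N M ..
  have bij: "bij h" using h by (simp add: riemannian_isometry_def)
  have i: "riemannian_isometry N M (inv h)" by (rule isometry_inv[OF h])
  have 1: "(f \<circ> h) \<circ> inv h = f" for f :: "'q \<Rightarrow> real" using bij by (simp add: fun_eq_iff bij_is_surj surj_f_inv_f)
  have 2: "(g \<circ> inv h) \<circ> h = g" for g :: "'p \<Rightarrow> real" using bij by (simp add: fun_eq_iff bij_is_inj)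
  have "bij_betw (\<lambda>f. f \<circ> h) (Cb1 N) (Cb1 M)"
    by (rule bij_betw_byWitness[where f'="\<lambda>g. g \<circ> inv h"])
       (use 1 2 isometry_pullback(1)[OF h] sym.isometry_pullback(1)[OF i] in auto)
  moreover have "Cb1_norm M (f \<circ> h) = Cb1_norm N f" if f: "f \<in> Cb1 N" for f
    using isometry_pullback[OF h f] sym.isometry_pullback(2)[OF i isometry_pullback(1)[OF h f]] by (simp add: 1)
  ultimately show ?thesis by (auto simp: normed_algebra_iso_def o_def)
qed

end

section \<open>From an algebra isomorphism to an isometry\<close>

lemma normed_algebra_iso_inv_into:
  assumes T: "normed_algebra_iso A nA B nB T"
    and A: "\<And>f g. f \<in> A \<Longrightarrow> g \<in> A \<Longrightarrow> (\<lambda>x. f x + g x) \<in> A" "\<And>r f. f \<in> A \<Longrightarrow> (\<lambda>x. r * f x) \<in> A"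
      "\<And>f g. f \<in> A \<Longrightarrow> g \<in> A \<Longrightarrow> (\<lambda>x. f x * g x) \<in> A"
  shows "normed_algebra_iso B nB A nA (inv_into A T)"
proof -
  define S where "S = inv_into A T"
  have bij: "bij_betw T A B" using T by (simp add: normed_algebra_iso_def)
  have S: "S g \<in> A" "T (S g) = g" if "g \<in> B" for g
    using bij that by (auto simp: S_def bij_betw_def inv_into_into f_inv_into_f)
  have ST: "S (T f) = f" if "f \<in> A" for f using bij that by (simp add: S_def bij_betw_def)
  have add: "S (\<lambda>x. f x + g x) = (\<lambda>y. S f y + S g y)" if "f \<in> B" "g \<in> B" for f g
  proof -
    have "T (\<lambda>y. S f y + S g y) = (\<lambda>x. f x + g x)" using T S that by (simp add: normed_algebra_iso_def)
    then show ?thesis using ST[OF A(1)[OF S(1)[OF that(1)] S(1)[OF that(2)]]] by simp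
  qed
  have mult: "S (\<lambda>x. f x * g x) = (\<lambda>y. S f y * S g y)" if "f \<in> B" "g \<in> B" for f g
  proof -
    have "T (\<lambda>y. S f y * S g y) = (\<lambda>x. f x * g x)" using T S that by (simp add: normed_algebra_iso_def)
    then show ?thesis using ST[OF A(3)[OF S(1)[OF that(1)] S(1)[OF that(2)]]] by simp
  qed
  have scale: "S (\<lambda>x. r * f x) = (\<lambda>y. r * S f y)" if "f \<in> B" for r f
  proof -
    have "T (\<lambda>y. r * S f y) = (\<lambda>x. r * f x)" using T S that by (simp add: normed_algebra_iso_def)
    then show ?thesis using ST[OF A(2)[OF S(1)[OF that], of r]] by simp
  qed
  have "nA (S f) = nB f" if "f \<in> B" for f using T S[OF that] unfolding normed_algebra_iso_def by metis
  then show ?thesis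
    unfolding normed_algebra_iso_def S_def[symmetric]
    using add mult scale bij_betw_inv_into[OF bij] by (simp add: S_def)
qed

lemma (in riem_pair) dual_if_iso:
  assumes T: "normed_algebra_iso (Cb1 N) (Cb1_norm N) (Cb1 M) (Cb1_norm M) T"
    and compl: "complete_manifold M" "complete_manifold N"
  shows "Cb1_dual M N T (inv_into (Cb1 N) T)"
proof -
  have S: "normed_algebra_iso (Cb1 M) (Cb1_norm M) (Cb1 N) (Cb1_norm N) (inv_into (Cb1 N) T)"
    by (rule normed_algebra_iso_inv_into[OF T N.Cb1_add N.Cb1_scale N.Cb1_mult])
  have bij: "bij_betw T (Cb1 N) (Cb1 M)" using T by (simp add: normed_algebra_iso_def)
  show ?thesis
  proof (unfold_locales, goal_cases)
    case (3 f) then show ?case using bij by (auto simp: bij_betw_def)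
  next
    case (4 g) then show ?case using bij by (auto simp: bij_betw_def inv_into_into)
  next
    case (5 f) then show ?case using bij by (auto simp: bij_betw_def)
  next
    case (6 g) then show ?case using bij by (auto simp: bij_betw_def f_inv_into_f)
  qed (use S T compl in \<open>simp_all add: normed_algebra_iso_def\<close>)
qed

context Cb1_dual
begin

lemma C1_map_h: "C1_map M N h"
  unfolding C1_map_def
proof (intro conjI ballI)
  have "M0 = UNIV" using M0_UNIV by blast
  then show "continuous_on UNIV h" using continuous_on_h by simp
  fix c d assume c: "c \<in> atlas M" and d: "d \<in> atlas N"
  show "C1_on (map_chart c ` (dom_chart c \<inter> h -` dom_chart d)) (map_chart d \<circ> h \<circ> inv_chart c)"
  proof (rule C1_on_localI)
    fix x assume "x \<in> map_chart c ` (dom_chart c \<inter> h -` dom_chart d)"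
    then obtain p where p: "x = map_chart c p" "p \<in> dom_chart c" "h p \<in> dom_chart d" by blast
    have "c \<in> charts_at M p" "d \<in> charts_at N (h p)" using c d p by (auto simp: charts_at_def)
    from local_isometry[OF M0_UNIV this] obtain r where "r > 0" "C1_on (ball x r) (map_chart d \<circ> h \<circ> inv_chart c)"
      unfolding p(1) by metis
    then show "\<exists>W g. open W \<and> x \<in> W \<and> C1_on W g \<and> (\<forall>y\<in>W. (map_chart d \<circ> h \<circ> inv_chart c) y = g y)"
      by (intro exI[of _ "ball x r"] exI[of _ "map_chart d \<circ> h \<circ> inv_chart c"]) auto
  qed
qed

text \<open>The inverse of \<open>h\<close> is the point map of the exchanged situation. It is
  therefore defined everywhere, by completeness of \<open>M\<close>, and continuously differentiable
  by the same argument as \<open>h\<close>.\<close>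

lemma isometry_h: "riemannian_isometry M N h"
proof -
  interpret sym: Cb1_dual N M S T by (rule swap)
  interpret riem_pair M N ..
  have rel: "related x (h x)" for x by (rule related_h[OF M0_UNIV])
  have rel': "related (sym.h y) y" for y
    using sym.related_h[OF sym.M0_UNIV] unfolding sym.related_def related_iff by blast
  have inj: "sym.h (h x) = x" for x
    using sym.related_unique[of "h x" "sym.h (h x)" x] sym.related_h[OF sym.M0_UNIV] rel
    unfolding sym.related_def related_iff by blast
  have surj: "h (sym.h y) = y" for y using related_imp[OF rel'] by simp
  have bij: "bij h" by (rule o_bij[of sym.h]) (use inj surj in auto)
  have inv: "inv h = sym.h" by (rule inv_unique_comp) (use inj surj in auto)
  have "chart_norm N (h p) d (diff h p c d v) = chart_norm M p c v"
    if c: "c \<in> charts_at M p" and d: "d \<in> charts_at N (h p)" for p c d v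
  proof -
    have c': "c \<in> atlas M" "p \<in> dom_chart c" using c by (auto simp: charts_at_def)
    obtain r where "r > 0" "\<And>x v. x \<in> ball (map_chart c p) r \<Longrightarrow>
       N.cnorm d ((map_chart d \<circ> h \<circ> inv_chart c) x) (frechet_derivative (map_chart d \<circ> h \<circ> inv_chart c) (at x) v) = M.cnorm c x v"
      using local_isometry[OF M0_UNIV c d] by metis
    from this(2)[of "map_chart c p" v] this(1) show ?thesis
      using c' by (simp add: M.chart_norm_cnorm[OF c] N.chart_norm_cnorm[OF d] diff_def)
  qed
  then show ?thesis
    unfolding riemannian_isometry_def isometric_iff[OF C1_map_h] inv
    using bij C1_map_h sym.C1_map_h by blast
qed

lemma T_h: "f \<in> Cb1 N \<Longrightarrow> T f = f \<circ> h"
  using T_eq_h[OF M0_UNIV] by (simp add: fun_eq_iff)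

end

theorem corollary4p5:
  fixes M :: "('p::t2_space, 'h::{real_inner, complete_space}) manifold"
    and N :: "('q::t2_space, 'k::{real_inner, complete_space}) manifold"
  assumes "riemannian_manifold M" and "complete_manifold M"
    and "riemannian_manifold N" and "complete_manifold N"
  shows "(riemannian_equivalent M N \<longleftrightarrow>
            normed_algebra_equivalent (Cb1 M) (Cb1_norm M) (Cb1 N) (Cb1_norm N)) \<and>
         (\<forall>T. normed_algebra_iso (Cb1 N) (Cb1_norm N) (Cb1 M) (Cb1_norm M) T \<longrightarrow>
            (\<exists>h. riemannian_isometry M N h \<and> (\<forall>f\<in>Cb1 N. T f = f \<circ> h)))"
proof -
  interpret riem_pair M N by unfold_locales (fact assms)+
  have iso: "\<exists>h. riemannian_isometry M N h \<and> (\<forall>f\<in>Cb1 N. T f = f \<circ> h)"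
    if "normed_algebra_iso (Cb1 N) (Cb1_norm N) (Cb1 M) (Cb1_norm M) T" for T
  proof -
    interpret Cb1_dual M N T "inv_into (Cb1 N) T" by (rule dual_if_iso[OF that assms(2,4)])
    show ?thesis using isometry_h T_h by blast
  qed
  have "normed_algebra_equivalent (Cb1 M) (Cb1_norm M) (Cb1 N) (Cb1_norm N)" if "riemannian_equivalent M N"
    using that normed_algebra_iso_inv_into[OF isometry_imp_iso N.Cb1_add N.Cb1_scale N.Cb1_mult]
    unfolding riemannian_equivalent_def normed_algebra_equivalent_def by blast
  moreover have "riemannian_equivalent M N"
    if "normed_algebra_equivalent (Cb1 M) (Cb1_norm M) (Cb1 N) (Cb1_norm N)"
    using that iso normed_algebra_iso_inv_into[OF _ M.Cb1_add M.Cb1_scale M.Cb1_mult]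
    unfolding riemannian_equivalent_def normed_algebra_equivalent_def by blast
  ultimately show ?thesis using iso by blast
qed

end
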